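(* Let $q\ge2$ be an integer. For every $\beta>\beta_1(q)$ and any $k\in(0,k_1)$, the event $$\Omega_{\mathrm{meta}}(N)=\bigl\{(\Sigma^N(t))_{t\ge0}\text{ is } e^{-kN}\text{-metastable w.r.t. }\{\mathcal M_{i,N}:i\in\mathcal I_\beta\}\bigr\}$$ for the Markov chain $\Sigma^N$ of the disordered Curie--Weiss--Potts (DCWP) model satisfies $$\mathbb P\Bigl[\liminf_{N\to\infty}\Omega_{\mathrm{meta}}(N)\Bigr]=1 .$$
   Context: **Model.** Let $v\in(0,\infty)$. On a probability space $(\Omega,\mathcal F,\mathbb P)$ let $(J_{ij})_{1\le i<j<\infty}$ be i.i.d. real random variables with mean $1$ and variance $v$ such that $\{\lambda\in\mathbb R:\mathbb E[e^{\lambda J_{12}}]<\infty\}$ has non-empty interior containing $0$. $\mathcal S_N=\{1,\dots,q\}^N$. The DCWP Hamiltonian is $H_N(\sigma)=-\frac1N\sum_{1\le i<j\le N}J_{ij}\mathbf 1_{\{\sigma_i=\sigma_j\}}$, with random Gibbs measure $\mu_N(\sigma)=e^{-\beta H_N(\sigma)}/Z_N$, $Z_N=\sum_\sigma e^{-\beta H_N(\sigma)}$. Given $J$, $(\Sigma^N(t))_{t\ge0}$ is the discrete-time Markov chain on $\mathcal S_N$ with transition probabilities $\pi_N(\sigma,\eta)=\frac1{Nq}e^{-\beta[H_N(\eta)-H_N(\sigma)]_+}$ if $\sigma,\eta$ differ in exactly one coordinate, $\pi_N(\sigma,\sigma)=1-\sum_{\eta\ne\sigma}\pi_N(\sigma,\eta)$,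 and $0$ otherwise ($[a]_+=\max\{0,a\}$). $\mathrm P^N_\nu$ is its law with initial distribution $\nu$, and $\tau^N_{\mathcal A}=\inf\{t>0:\Sigma^N(t)\in\mathcal A\}$. **$\rho_N$-metastability.** Let $\mathcal M_{1},\dots,\mathcal M_{K}$ be disjoint subsets of $\mathcal S_N$ with union $\mathcal M$, and $\rho_N>0$. The chain $(\Sigma^N(t))$ is $\rho_N$-metastable with respect to $\{\mathcal M_1,\dots,\mathcal M_K\}$ when $$K\,\frac{\max_{j}\mathrm P^N_{\mu_N|\mathcal M_j}[\tau^N_{\mathcal M\setminus\mathcal M_j}<\tau^N_{\mathcal M_j}]}{\min_{\emptyset\ne\mathcal X\subset\mathcal S_N\setminus\mathcal M}\mathrm P^N_{\mu_N|\mathcal X}[\tau^N_{\mathcal M}<\tau^N_{\mathcal X}]}\le\rho_N\ll1,$$ where $\mu_N|\mathcal X$ is $\mu_N$ conditioned on $\mathcal X$ and $\rho_N\ll1$ means $\rho_N\to0$ as $N\to\infty$. **Free energy and metastable sets.** $\mathcal P=\{x\in[0,1]^q:\sum_k x_k=1\}$, $\mathcal P_N=\mathcal P\cap\frac1N\mathbb N_0^q$, and $L_N:\mathcal S_N\to\mathcal P_N$ has components $L_N(\sigma)_k=\frac1N\sum_{i=1}^N\mathbf 1_{\{\sigma_i=k\}}$. The limiting free energy of the CWP model (the model with all $J_{ij}\equiv1$) is $\widetilde F_{\beta,q}(x)=-\frac12\|x\|_2^2+\frac1\beta\sum_{i=1}^q x_i\ln x_i$ on $\mathcal P$ ($0\ln0=0$).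 $\boldsymbol m_0=(1/q,\dots,1/q)$; for $i\in\{1,\dots,q\}$, $\boldsymbol m_i\in\mathcal P$ has $k$-th coordinate $(1-s)/q$ for $k\ne i$ and $(1+(q-1)s)/q$ for $k=i$, where $s\in[0,1)$ is the largest solution of $\ln(1+(q-1)s)-\ln(1-s)=\beta s$. $\beta_1(q)$ is the infimum of all $\beta>0$ for which $\widetilde F_{\beta,q}$ has a local minimizer in $\mathcal P$ other than $\boldsymbol m_0$. $\mathcal I_\beta=\{0,\dots,q\}$ if $\beta_1(q)<\beta<q$ and $\mathcal I_\beta=\{1,\dots,q\}$ if $\beta\ge q$. For $i\in\mathcal I_\beta$, $\boldsymbol m_{i,N}\in\mathcal P_N$ is a closest lattice point to $\boldsymbol m_i$, and $\mathcal M_{i,N}=L_N^{-1}(\boldsymbol m_{i,N})$. **The constant $k_1$.** The communication height is $c(x,y)=\inf_\gamma\max_{t\in[0,1]}\widetilde F_{\beta,q}(\gamma(t))$, the infimum being over continuous $\gamma:[0,1]\to\mathcal P$ with $\gamma(0)=x,\gamma(1)=y$, and $k_1=\beta\min_{i\ne j\in\mathcal I_\beta}\bigl(c(\boldsymbol m_i,\boldsymbol m_j)-\widetilde F_{\beta,q}(\boldsymbol m_j)\bigr)$. *)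

theory Defs
  imports "HOL-Probability.Probability"
begin

text \<open>The path space carries the product of the discrete sigma-algebras; the law is obtained from the
  theorem of Ionescu-Tulcea.\<close>

definition markov_step :: "'s pmf \<Rightarrow> ('s \<Rightarrow> 's pmf) \<Rightarrow> nat \<Rightarrow> (nat \<Rightarrow> 's) \<Rightarrow> 's measure" where
  "markov_step \<nu> K n w = measure_pmf (if n = 0 then \<nu> else K (w (n - 1)))"

interpretation markov: Ionescu_Tulcea "markov_step \<nu> K" "\<lambda>_. count_space UNIV"
  for \<nu> :: "'s pmf" and K :: "'s \<Rightarrow> 's pmf"
proof (rule Ionescu_Tulcea.intro)
  fix i :: nat
  let ?P = "PiM {0..<i} (\<lambda>_. count_space UNIV) :: (nat \<Rightarrow> 's) measure"
  show "markov_step \<nu> K i \<in> ?P \<rightarrow>\<^sub>M subprob_algebra (count_space UNIV)"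
  proof (cases "i = 0")
    case True
    have "(\<lambda>_. measure_pmf \<nu>) \<in> ?P \<rightarrow>\<^sub>M subprob_algebra (count_space UNIV)"
      by (rule measurable_const) (rule measure_pmf_in_subprob_algebra)
    then show ?thesis
      by (simp add: markov_step_def[abs_def] True)
  next
    case False
    have comp: "(\<lambda>w. w (i - 1)) \<in> ?P \<rightarrow>\<^sub>M count_space UNIV"
      using False by (intro measurable_component_singleton) auto
    have "(\<lambda>s. measure_pmf (K s)) \<in> count_space UNIV \<rightarrow>\<^sub>M subprob_algebra (count_space UNIV)"
      by (simp add: Pi_iff measure_pmf_in_subprob_algebra)
    from measurable_compose[OF comp this] show ?thesis
      using False by (simp add: markov_step_def[abs_def])
  qed
  show "prob_space (markov_step \<nu> K i w)" for w
    by (simp add: markov_step_def prob_space_measure_pmf)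
qed

definition markov_law :: "'s pmf \<Rightarrow> ('s \<Rightarrow> 's pmf) \<Rightarrow> (nat \<Rightarrow> 's) measure" where
  "markov_law \<nu> K = markov.PF.lim \<nu> K"

definition hitting :: "'s set \<Rightarrow> (nat \<Rightarrow> 's) \<Rightarrow> enat" where
  "hitting A w = Inf {enat t | t. 0 < t \<and> w t \<in> A}"

definition prob_hits_before :: "('s \<Rightarrow> 's pmf) \<Rightarrow> 's pmf \<Rightarrow> 's set \<Rightarrow> 's set \<Rightarrow> real" where
  "prob_hits_before K \<nu> A B = measure (markov_law \<nu> K) {w. hitting A w < hitting B w}"

text \<open>For an irreducible chain on \<open>S\<close> and nonempty \<open>A i\<close> the denominator is a minimum of positive numbers
  as soon as \<open>U \<noteq> S\<close>, so the convention \<open>x / 0 = 0\<close> plays no role.\<close>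

definition metastable_ratio ::
    "('s \<Rightarrow> 's pmf) \<Rightarrow> 's pmf \<Rightarrow> 's set \<Rightarrow> 'i set \<Rightarrow> ('i \<Rightarrow> 's set) \<Rightarrow> real" where
  "metastable_ratio K mu S I A = (let U = (\<Union>i\<in>I. A i) in
     real (card I) *
     ((MAX j\<in>I. prob_hits_before K (cond_pmf mu (A j)) (U - A j) (A j)) /
      (MIN X\<in>{X. X \<noteq> {} \<and> X \<subseteq> S - U}. prob_hits_before K (cond_pmf mu X) U X)))"

text \<open>The condition is imposed at the single system size \<open>N\<close>; only the clause \<open>\<rho> \<longlonglongrightarrow> 0\<close>, which renders
  \<open>\<rho>\<close> being much smaller than 1, refers to the whole sequence.\<close>

definition metastable_at ::
    "(nat \<Rightarrow> real) \<Rightarrow> (nat \<Rightarrow> 's \<Rightarrow> 's pmf) \<Rightarrow> (nat \<Rightarrow> 's pmf) \<Rightarrow> (nat \<Rightarrow> 's set) \<Rightarrow>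
     'i set \<Rightarrow> (nat \<Rightarrow> 'i \<Rightarrow> 's set) \<Rightarrow> nat \<Rightarrow> bool" where
  "metastable_at \<rho> K mu S I A N \<longleftrightarrow>
     (\<forall>i\<in>I. A N i \<subseteq> S N) \<and> disjoint_family_on (A N) I \<and> 0 < \<rho> N \<and>
     metastable_ratio (K N) (mu N) (S N) I (A N) \<le> \<rho> N \<and> \<rho> \<longlonglongrightarrow> 0"

text \<open>The colours \<open>1, \<dots>, q\<close> are the elements of the finite type \<open>'q\<close>, so \<open>q = CARD('q)\<close>. A realisation of
  the couplings is a function \<open>g\<close>, of which only the values \<open>g i j\<close> with \<open>1 \<le> i < j\<close> matter.\<close>

definition configs :: "nat \<Rightarrow> (nat \<Rightarrow> 'q::finite) set" where
  "configs N = {1..N} \<rightarrow>\<^sub>E UNIV"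

definition hamiltonian :: "(nat \<Rightarrow> nat \<Rightarrow> real) \<Rightarrow> nat \<Rightarrow> (nat \<Rightarrow> 'q::finite) \<Rightarrow> real" where
  "hamiltonian g N \<sigma> =
     - (1 / real N) * (\<Sum>(i, j)\<in>{(i, j). 1 \<le> i \<and> i < j \<and> j \<le> N}. g i j * of_bool (\<sigma> i = \<sigma> j))"

definition partition_sum :: "'q::finite itself \<Rightarrow> real \<Rightarrow> (nat \<Rightarrow> nat \<Rightarrow> real) \<Rightarrow> nat \<Rightarrow> real" where
  "partition_sum _ \<beta> g N =
     (\<Sum>\<sigma>\<in>(configs N :: (nat \<Rightarrow> 'q) set). exp (- \<beta> * hamiltonian g N \<sigma>))"

definition gibbs :: "real \<Rightarrow> (nat \<Rightarrow> nat \<Rightarrow> real) \<Rightarrow> nat \<Rightarrow> (nat \<Rightarrow> 'q::finite) pmf" where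
  "gibbs \<beta> g N = embed_pmf (\<lambda>\<sigma>. if \<sigma> \<in> configs N
     then exp (- \<beta> * hamiltonian g N \<sigma>) / partition_sum TYPE('q) \<beta> g N else 0)"

definition flip_prob ::
    "real \<Rightarrow> (nat \<Rightarrow> nat \<Rightarrow> real) \<Rightarrow> nat \<Rightarrow> (nat \<Rightarrow> 'q::finite) \<Rightarrow> (nat \<Rightarrow> 'q) \<Rightarrow> real" where
  "flip_prob \<beta> g N \<sigma> \<eta> =
     (if \<sigma> \<in> configs N \<and> \<eta> \<in> configs N \<and> card {i\<in>{1..N}. \<sigma> i \<noteq> \<eta> i} = 1
      then 1 / (real N * real CARD('q)) *
           exp (- \<beta> * max 0 (hamiltonian g N \<eta> - hamiltonian g N \<sigma>))
      else 0)"

text \<open>Outside \<open>configs N\<close> all states are absorbing.\<close>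

definition metropolis :: "real \<Rightarrow> (nat \<Rightarrow> nat \<Rightarrow> real) \<Rightarrow> nat \<Rightarrow> (nat \<Rightarrow> 'q::finite) \<Rightarrow> (nat \<Rightarrow> 'q) pmf" where
  "metropolis \<beta> g N \<sigma> = embed_pmf (\<lambda>\<eta>. if \<eta> = \<sigma>
     then 1 - (\<Sum>\<xi>\<in>configs N - {\<sigma>}. flip_prob \<beta> g N \<sigma> \<xi>) else flip_prob \<beta> g N \<sigma> \<eta>)"

definition prob_simplex :: "(real ^ 'q::finite) set" where
  "prob_simplex = {x. (\<forall>k. x $ k \<in> {0..1}) \<and> (\<Sum>k\<in>UNIV. x $ k) = 1}"

definition lattice_simplex :: "nat \<Rightarrow> (real ^ 'q::finite) set" where
  "lattice_simplex N = {x\<in>prob_simplex. \<forall>k. \<exists>n::nat. x $ k = real n / real N}"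

definition magnetization :: "nat \<Rightarrow> (nat \<Rightarrow> 'q::finite) \<Rightarrow> real ^ 'q" where
  "magnetization N \<sigma> = (\<chi> k. 1 / real N * (\<Sum>i\<in>{1..N}. of_bool (\<sigma> i = k)))"

definition free_energy :: "real \<Rightarrow> real ^ 'q::finite \<Rightarrow> real" where
  "free_energy \<beta> x = - (1 / 2) * (norm x)\<^sup>2 + 1 / \<beta> * (\<Sum>k\<in>UNIV. x $ k * ln (x $ k))"

definition order_parameter :: "'q::finite itself \<Rightarrow> real \<Rightarrow> real" where
  "order_parameter _ \<beta> = (GREATEST s. 0 \<le> s \<and> s < 1 \<and>
     ln (1 + (real CARD('q) - 1) * s) - ln (1 - s) = \<beta> * s)"

text \<open>The index set \<open>{0, 1, \<dots>, q}\<close> is represented by \<open>'q option\<close>, with \<open>None\<close> for \<open>0\<close>.\<close>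

definition min_point :: "real \<Rightarrow> 'q::finite option \<Rightarrow> real ^ 'q" where
  "min_point \<beta> i = (let q = real CARD('q); s = order_parameter TYPE('q) \<beta> in
     case i of
       None \<Rightarrow> (\<chi> k. 1 / q)
     | Some c \<Rightarrow> (\<chi> k. if k = c then (1 + (q - 1) * s) / q else (1 - s) / q))"

definition local_minimizer :: "real \<Rightarrow> real ^ 'q::finite \<Rightarrow> bool" where
  "local_minimizer \<beta> x \<longleftrightarrow>
     x \<in> prob_simplex \<and> (\<forall>\<^sub>F y in at x within prob_simplex. free_energy \<beta> x \<le> free_energy \<beta> y)"

definition beta1 :: "'q::finite itself \<Rightarrow> real" where
  "beta1 _ = Inf {\<beta>. 0 < \<beta> \<and> (\<exists>x :: real ^ 'q. local_minimizer \<beta> x \<and> x \<noteq> (\<chi> k. 1 / real CARD('q)))}"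

text \<open>Only used for \<open>\<beta> > beta1 TYPE('q)\<close>.\<close>

definition min_index :: "real \<Rightarrow> 'q::finite option set" where
  "min_index \<beta> = (if \<beta> < real CARD('q) then UNIV else range Some)"

definition meta_set :: "nat \<Rightarrow> real ^ 'q::finite \<Rightarrow> (nat \<Rightarrow> 'q) set" where
  "meta_set N m = {\<sigma>\<in>configs N. magnetization N \<sigma> = m}"

definition comm_height :: "real \<Rightarrow> real ^ 'q::finite \<Rightarrow> real ^ 'q \<Rightarrow> real" where
  "comm_height \<beta> x y =
     (INF \<gamma>\<in>{\<gamma>. path \<gamma> \<and> path_image \<gamma> \<subseteq> prob_simplex \<and> pathstart \<gamma> = x \<and> pathfinish \<gamma> = y}.
        SUP t\<in>{0..1}. free_energy \<beta> (\<gamma> t))"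

definition k1 :: "'q::finite itself \<Rightarrow> real \<Rightarrow> real" where
  "k1 _ \<beta> = \<beta> * Min {comm_height \<beta> (min_point \<beta> i) (min_point \<beta> j) - free_energy \<beta> (min_point \<beta> j)
     | i j :: 'q option. i \<in> min_index \<beta> \<and> j \<in> min_index \<beta> \<and> i \<noteq> j}"

text \<open>Here \<open>mN N i\<close> is the chosen closest lattice point to \<open>min_point \<beta> i\<close>.\<close>

definition Omega_meta ::
    "'a measure \<Rightarrow> (nat \<Rightarrow> nat \<Rightarrow> 'a \<Rightarrow> real) \<Rightarrow> (nat \<Rightarrow> 'q::finite option \<Rightarrow> real ^ 'q) \<Rightarrow>
     real \<Rightarrow> real \<Rightarrow> nat \<Rightarrow> 'a set" where
  "Omega_meta M J mN \<beta> k N = {\<omega>\<in>space M.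
     metastable_at (\<lambda>n. exp (- k * real n))
       (metropolis \<beta> (\<lambda>i j. J i j \<omega>)) (gibbs \<beta> (\<lambda>i j. J i j \<omega>)) configs
       (min_index \<beta>) (\<lambda>n i. meta_set n (mN n i)) N}"

end

theory Submission
  imports Defs "HOL-Real_Asymp.Real_Asymp" "HOL-Combinatorics.Multiset_Permutations"
begin

text \<open>Every ingredient of the metastability ratio is a capacity. For a reversible chain the escape probability
from \<open>A\<close> to \<open>B\<close>, weighted with the mass of \<open>A\<close>, is the Dirichlet form of the equilibrium potential, and
this is the smallest Dirichlet form among functions that are 0 on \<open>A\<close> and 1 on \<open>B\<close>
(\<open>prob_hits_before_dirichlet\<close>). Capacities depend monotonically on the weights of the configurations. The
disordered energy differs from the energy of the model with unit couplings by at most \<open>e N\<close>,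
simultaneously for all configurations, for all large \<open>N\<close> and almost surely (\<open>AE_close_to_mean\<close>): for one
configuration such a deviation has probability \<open>exp (- w N\<^sup>2)\<close>, and there are only \<open>q ^ N\<close>
configurations. So it suffices to find the exponential rates for unit couplings, where the weight of the
level with magnetization \<open>x\<close> is \<open>exp (- \<beta> N F x)\<close> up to subexponential factors, with \<open>F\<close> the free
energy (\<open>eventually_level_mass\<close>).

For the numerator, let \<open>c\<close> be less than the communication heights between the well \<open>j\<close> and the other
wells. Then no lattice path from \<open>j\<close> to another well stays below \<open>c\<close> (\<open>barrier\<close>). So the function that is
0 on the component of the well in the levels below \<open>c\<close> and 1 elsewhere is an admissible test function, and
its Dirichlet form is at most the weight of the levels above \<open>c\<close>, up to a polynomial factor
(\<open>escape_upper_bound\<close>).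

For the denominator one needs a lower bound for an arbitrary set \<open>X\<close> of configurations, which need not be
a union of levels. It follows from a Poincare inequality for functions that vanish on the wells
(\<open>poincare\<close>): on each level the root mean square of such a function is compared with the one on a
neighbouring level, and this comparison is iterated along a path of levels that ends in a well and climbs
at most by an arbitrarily small amount (\<open>descent_path\<close>). Such paths exist because every local minimizer
of the free energy is one of the wells (\<open>local_minimizer_min_point\<close>): at a critical point the coordinates
take at most two values, second-order conditions leave a one-parameter family for each colour, and on it a
convexity argument singles out the greatest root of the equation that defines the order parameter.
Elsewhere the free energy decreases by a uniform amount within a fixed small distance (\<open>uniform_descent\<close>).\<close>

section \<open>Continuity of the free energy, and its local minimizers\<close>

text \<open>At 0 the function agrees with its limit, because \<open>ln 0 = 0\<close>.\<close>

lemma continuous_on_x_ln_x: "continuous_on {0..} (\<lambda>x::real. x * ln x)"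
  unfolding continuous_on_def
proof
  fix x :: real assume "x \<in> {0..}"
  show "((\<lambda>x. x * ln x) \<longlongrightarrow> x * ln x) (at x within {0..})"
  proof (cases "x = 0")
    case True
    have "((\<lambda>x::real. x * ln x) \<longlongrightarrow> 0) (at_right 0)" by real_asymp
    moreover have "at (0::real) within {0..} = at_right 0"
      by (rule at_within_nhd[of _ UNIV]) auto
    ultimately show ?thesis using True by simp
  next
    case False
    then show ?thesis using \<open>x \<in> {0..}\<close> by (intro tendsto_intros) auto
  qed
qed

lemma continuous_on_free_energy: "continuous_on prob_simplex (free_energy \<beta> :: real ^ 'q::finite \<Rightarrow> real)"
proof -
  have "continuous_on prob_simplex (\<lambda>x :: real ^ 'q. x $ k * ln (x $ k))" for k
    by (rule continuous_on_compose2[OF continuous_on_x_ln_x, of _ "\<lambda>x. x $ k"])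
       (auto intro!: continuous_intros simp: prob_simplex_def)
  then have s: "continuous_on prob_simplex (\<lambda>x :: real ^ 'q. \<Sum>k\<in>UNIV. x $ k * ln (x $ k))"
    by (intro continuous_on_sum)
  show ?thesis
    unfolding free_energy_def[abs_def]
    by (rule continuous_on_add[OF _ continuous_on_mult[OF continuous_on_const s]]) (intro continuous_intros)
qed

lemma compact_prob_simplex: "compact (prob_simplex :: (real ^ 'q::finite) set)"
proof -
  have c1: "closed (\<Inter>k. {x :: real ^ 'q. 0 \<le> x $ k} \<inter> {x. x $ k \<le> 1})"
    by (intro closed_INT ballI closed_Int closed_Collect_le continuous_intros)
  have c2: "closed {x :: real ^ 'q. (\<Sum>k\<in>UNIV. x $ k) = 1}"
    by (intro closed_Collect_eq continuous_intros)
  note closed_Int[OF c1 c2]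
  also have "(\<Inter>k. {x :: real ^ 'q. 0 \<le> x $ k} \<inter> {x. x $ k \<le> 1}) \<inter> {x. (\<Sum>k\<in>UNIV. x $ k) = 1} = prob_simplex"
    by (auto simp: prob_simplex_def)
  finally have "closed (prob_simplex :: (real ^ 'q) set)" .
  moreover have "bounded (prob_simplex :: (real ^ 'q) set)"
  proof (rule boundedI)
    fix x :: "real ^ 'q" assume x: "x \<in> prob_simplex"
    have "norm x \<le> (\<Sum>k\<in>UNIV. \<bar>x $ k\<bar>)" by (rule norm_le_l1_cart)
    also have "\<dots> = 1" using x by (simp add: prob_simplex_def)
    finally show "norm x \<le> 1" .
  qed
  ultimately show ?thesis by (simp add: compact_eq_bounded_closed)
qed

lemma convex_prob_simplex: "convex (prob_simplex :: (real ^ 'q::finite) set)"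
proof (rule convexI)
  fix x y :: "real ^ 'q" and u v :: real
  assume *: "x \<in> prob_simplex" "y \<in> prob_simplex" "0 \<le> u" "0 \<le> v" "u + v = 1"
  have "u * x $ k + v * y $ k \<le> u * 1 + v * 1" for k
    using * by (intro add_mono mult_left_mono) (auto simp: prob_simplex_def)
  with * show "u *\<^sub>R x + v *\<^sub>R y \<in> prob_simplex"
    by (auto simp: prob_simplex_def sum.distrib sum_distrib_left[symmetric])
qed

definition shift_mass :: "'q \<Rightarrow> 'q \<Rightarrow> real \<Rightarrow> real ^ 'q \<Rightarrow> real ^ 'q::finite" where
  "shift_mass a b t x = x + t *\<^sub>R (axis a 1 - axis b 1)"

lemma shift_mass_nth: "a \<noteq> b \<Longrightarrow> shift_mass a b t x $ k = (if k = a then x $ a + t else if k = b then x $ b - t else x $ k)"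
  by (auto simp: shift_mass_def axis_def)

lemma shift_mass_sum:
  fixes f :: "real \<Rightarrow> real"
  assumes "a \<noteq> b"
  shows "(\<Sum>k\<in>UNIV. f (shift_mass a b t x $ k)) = (\<Sum>k\<in>UNIV. f (x $ k)) + (f (x $ a + t) - f (x $ a)) + (f (x $ b - t) - f (x $ b))"
proof -
  have s: "(\<Sum>k\<in>UNIV. g k) = g a + g b + (\<Sum>k\<in>UNIV - {a, b}. g k)" for g :: "'a \<Rightarrow> real"
  proof -
    have "(\<Sum>k\<in>UNIV. g k) = (\<Sum>k\<in>{a,b}. g k) + (\<Sum>k\<in>UNIV - {a, b}. g k)"
      by (subst sum.union_disjoint[symmetric]) (auto intro!: sum.cong)
    then show ?thesis using assms by simp
  qed
  have r: "(\<Sum>k\<in>UNIV - {a, b}. f (shift_mass a b t x $ k)) = (\<Sum>k\<in>UNIV - {a, b}. f (x $ k))"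
    by (rule sum.cong) (auto simp: shift_mass_nth[OF assms])
  show ?thesis unfolding s[of "\<lambda>k. f (shift_mass a b t x $ k)"] s[of "\<lambda>k. f (x $ k)"] r
    using assms by (simp add: shift_mass_nth)
qed

lemma shift_mass_in_simplex:
  assumes "a \<noteq> b" "x \<in> prob_simplex" "- (x $ a) \<le> t" "t \<le> x $ b"
  shows "shift_mass a b t x \<in> prob_simplex"
proof -
  have s: "(\<Sum>k\<in>UNIV. shift_mass a b t x $ k) = 1"
    using shift_mass_sum[OF assms(1), of "\<lambda>y. y" t x] assms(2) by (simp add: prob_simplex_def)
  have p: "0 \<le> shift_mass a b t x $ k" for k
    using assms by (auto simp: shift_mass_nth prob_simplex_def)
  have "shift_mass a b t x $ k \<le> (\<Sum>k\<in>UNIV. shift_mass a b t x $ k)" for k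
    by (rule member_le_sum) (auto simp: p)
  with s p show ?thesis by (auto simp: prob_simplex_def)
qed

text \<open>The free energy is a sum of one-colour terms, so moving mass between two colours changes only two of
  them.\<close>

definition site_energy :: "real \<Rightarrow> real \<Rightarrow> real" where
  "site_energy \<beta> y = - y\<^sup>2 / 2 + y * ln y / \<beta>"

lemma free_energy_eq: "free_energy \<beta> x = (\<Sum>k\<in>UNIV. site_energy \<beta> (x $ k))"
  unfolding free_energy_def site_energy_def power2_norm_eq_inner inner_vec_def
  by (simp add: sum.distrib sum_negf sum_subtractf power2_eq_square sum_divide_distrib[symmetric])

lemma free_energy_shift:
  assumes "a \<noteq> b"
  shows "free_energy \<beta> (shift_mass a b t x) - free_energy \<beta> x =
    (site_energy \<beta> (x $ a + t) - site_energy \<beta> (x $ a)) + (site_energy \<beta> (x $ b - t) - site_energy \<beta> (x $ b))"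
  unfolding free_energy_eq by (subst shift_mass_sum[OF assms]) simp


text \<open>Testing a local minimizer along curves in the simplex reduces all optimality conditions below to
  functions of one real variable.\<close>

lemma local_minimizer_curve:
  assumes "local_minimizer \<beta> x" "(\<gamma> \<longlongrightarrow> x) F" "\<forall>\<^sub>F t in F. \<gamma> t \<in> prob_simplex"
  shows "\<forall>\<^sub>F t in F. free_energy \<beta> x \<le> free_energy \<beta> (\<gamma> t)"
proof -
  obtain S where S: "open S" "x \<in> S" "\<And>y. y \<in> S \<Longrightarrow> y \<noteq> x \<Longrightarrow> y \<in> prob_simplex \<Longrightarrow> free_energy \<beta> x \<le> free_energy \<beta> y"
    using assms(1) unfolding local_minimizer_def eventually_at_topological by blast
  from topological_tendstoD[OF assms(2) S(1,2)] assms(3) show ?thesis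
    by eventually_elim (use S(3) in auto)
qed

lemma local_minimizer_shift:
  assumes "a \<noteq> b" "local_minimizer \<beta> x" "\<forall>\<^sub>F t in F. - (x $ a) \<le> t \<and> t \<le> x $ b" "((\<lambda>t. t) \<longlongrightarrow> 0) F"
  shows "\<forall>\<^sub>F t in F. 0 \<le> (site_energy \<beta> (x $ a + t) - site_energy \<beta> (x $ a)) + (site_energy \<beta> (x $ b - t) - site_energy \<beta> (x $ b))"
proof -
  have x: "x \<in> prob_simplex" using assms(2) by (simp add: local_minimizer_def)
  have "((\<lambda>t. shift_mass a b t x) \<longlongrightarrow> x + 0 *\<^sub>R (axis a 1 - axis b 1)) F"
    unfolding shift_mass_def by (intro tendsto_intros assms(4))
  then have "\<forall>\<^sub>F t in F. free_energy \<beta> x \<le> free_energy \<beta> (shift_mass a b t x)"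
    by (intro local_minimizer_curve[OF assms(2)]) (use assms(3) in \<open>auto elim!: eventually_mono intro!: shift_mass_in_simplex assms(1) x\<close>)
  then show ?thesis
    by eventually_elim (simp add: free_energy_shift[OF assms(1), symmetric])
qed

definition site_slope :: "real \<Rightarrow> real \<Rightarrow> real" where
  "site_slope \<beta> y = - y + (ln y + 1) / \<beta>"

lemma site_energy_deriv [derivative_intros]:
  assumes "0 < y" shows "(site_energy \<beta> has_real_derivative site_slope \<beta> y) (at y)"
  unfolding site_energy_def site_slope_def using assms
  unfolding divide_inverse by (auto intro!: derivative_eq_intros simp: algebra_simps)

text \<open>At an empty colour the entropy has slope \<open>-\<infinity>\<close>: giving it mass \<open>t\<close> contributes
  \<open>t ln t / \<beta>\<close>, which beats every term of order \<open>t\<close>.\<close>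

lemma local_minimizer_pos:
  assumes \<beta>: "0 < \<beta>" and lm: "local_minimizer \<beta> x"
  shows "0 < x $ (a :: 'q::finite)"
proof (rule ccontr)
  assume n: "\<not> 0 < x $ a"
  have x: "x \<in> prob_simplex" using lm by (simp add: local_minimizer_def)
  then have xa: "x $ a = 0" using n by (auto simp: prob_simplex_def order_antisym)
  obtain b where b: "0 < x $ b"
  proof (rule ccontr)
    assume "\<not> thesis"
    then have "\<not> 0 < x $ k" for k using that by blast
    then have "x $ k = 0" for k using x by (auto simp: prob_simplex_def not_less intro!: antisym)
    then show False using x by (auto simp: prob_simplex_def)
  qed
  have ab: "a \<noteq> b" using xa b by auto
  define y where "y = x $ b"
  have y: "0 < y" using b y_def by simp
  have ev: "\<forall>\<^sub>F t in at_right 0. - (x $ a) \<le> t \<and> t \<le> x $ b"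
    unfolding eventually_at_right[OF b] using xa b by auto
  have lim: "((\<lambda>t::real. t) \<longlongrightarrow> 0) (at_right 0)" by (rule tendsto_ident_at)
  from local_minimizer_shift[OF ab lm ev lim]
  have "\<forall>\<^sub>F t in at_right 0. 0 \<le> (site_energy \<beta> (x $ a + t) - site_energy \<beta> (x $ a)) + (site_energy \<beta> (x $ b - t) - site_energy \<beta> (x $ b))" .
  moreover have "\<forall>\<^sub>F t in at_right 0. 0 < t \<and> t < y"
    using y eventually_at_right by (auto simp: eventually_at_right_field)
  ultimately have "\<forall>\<^sub>F t in at_right 0. 0 \<le> (site_energy \<beta> t + (site_energy \<beta> (y - t) - site_energy \<beta> y)) / t"
    by eventually_elim (simp add: xa site_energy_def y_def)
  moreover have "\<forall>\<^sub>F t in at_right 0. (site_energy \<beta> (y - t) - site_energy \<beta> y) / t < 1 - site_slope \<beta> y"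
  proof -
    have "((\<lambda>t. site_energy \<beta> (y - t)) has_real_derivative site_slope \<beta> (y - 0) * -1) (at 0)"
      using y by (intro DERIV_chain2[OF site_energy_deriv]) (auto intro!: derivative_eq_intros)
    then have "((\<lambda>t. (site_energy \<beta> (y - t) - site_energy \<beta> y) / t) \<longlongrightarrow> - site_slope \<beta> y) (at 0)"
      by (simp add: DERIV_def)
    then have "((\<lambda>t. (site_energy \<beta> (y - t) - site_energy \<beta> y) / t) \<longlongrightarrow> - site_slope \<beta> y) (at_right 0)"
      by (rule tendsto_within_subset) simp
    from order_tendstoD(2)[OF this, of "1 - site_slope \<beta> y"] show ?thesis by simp
  qed
  moreover have "\<forall>\<^sub>F t in at_right 0. site_energy \<beta> t / t < - (1 - site_slope \<beta> y)"
  proof -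
    have "filterlim (\<lambda>t. site_energy \<beta> t / t) at_bot (at_right 0)"
      unfolding site_energy_def using \<beta> by real_asymp
    then show ?thesis by (rule filterlim_at_bot_dense[THEN iffD1, rule_format])
  qed
  ultimately have "\<forall>\<^sub>F t in at_right (0::real). False" by eventually_elim (simp add: add_divide_distrib)
  then show False by simp
qed

lemma site_energy_deriv_comp:
  assumes "(g has_real_derivative D) (at t)" "0 < g t"
  shows "((\<lambda>t. site_energy \<beta> (g t)) has_real_derivative site_slope \<beta> (g t) * D) (at t)"
  by (rule DERIV_chain2[where f="site_energy \<beta>" and g=g, OF site_energy_deriv]) (use assms in auto)

text \<open>The slope increases up to \<open>1 / \<beta>\<close> and decreases beyond it. It takes the same value at all
  coordinates of a critical point, so these coordinates have at most two values, one on each side of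
  \<open>1 / \<beta>\<close>.\<close>

lemma site_slope_less:
  assumes "0 < \<beta>" "0 < y" "y < z"
  shows "z \<le> 1 / \<beta> \<Longrightarrow> site_slope \<beta> y < site_slope \<beta> z"
    and "1 / \<beta> \<le> y \<Longrightarrow> site_slope \<beta> z < site_slope \<beta> y"
proof -
  have d: "(site_slope \<beta> has_real_derivative (- 1 + 1 / (\<beta> * t))) (at t)" if "0 < t" for t
    unfolding site_slope_def divide_inverse using that assms(1) by (auto intro!: derivative_eq_intros simp: divide_inverse)
  have c: "continuous_on {y..z} (site_slope \<beta>)"
    using assms by (intro DERIV_continuous_on[where D="\<lambda>t. - 1 + 1 / (\<beta> * t)"] DERIV_subset[OF d]) auto
  show "site_slope \<beta> y < site_slope \<beta> z" if "z \<le> 1 / \<beta>"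
  proof (rule DERIV_pos_imp_increasing_open[OF assms(3) _ c])
    fix t assume t: "y < t" "t < z"
    then have "t < 1 / \<beta>" using that by simp
    then have "\<beta> * t < 1" using assms by (simp add: field_simps)
    then show "\<exists>l. (site_slope \<beta> has_real_derivative l) (at t) \<and> 0 < l"
      using t assms by (intro exI[of _ "- 1 + 1 / (\<beta> * t)"] conjI d) (auto simp: field_simps)
  qed
  show "site_slope \<beta> z < site_slope \<beta> y" if "1 / \<beta> \<le> y"
  proof (rule DERIV_neg_imp_decreasing_open[OF assms(3) _ c])
    fix t assume t: "y < t" "t < z"
    then have "1 / \<beta> < t" using that by simp
    then have "\<beta> * t > 1" using assms by (simp add: field_simps)
    then show "\<exists>l. (site_slope \<beta> has_real_derivative l) (at t) \<and> l < 0"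
      using t assms by (intro exI[of _ "- 1 + 1 / (\<beta> * t)"] conjI d) (auto simp: field_simps)
  qed
qed

lemma local_minimizer_slope_eq:
  assumes \<beta>: "0 < \<beta>" and lm: "local_minimizer \<beta> x"
  shows "site_slope \<beta> (x $ a) = site_slope \<beta> (x $ (b :: 'q::finite))"
proof (cases "a = b")
  case ab: False
  have p: "0 < x $ a" "0 < x $ b" using local_minimizer_pos[OF assms] by auto
  let ?f = "\<lambda>t. site_energy \<beta> (x $ a + t) + site_energy \<beta> (x $ b - t)"
  have "\<forall>\<^sub>F t in nhds 0. - (x $ a) < t" "\<forall>\<^sub>F t in nhds 0. t < x $ b"
    using p by (auto intro: order_tendstoD[OF filterlim_ident])
  then have "\<forall>\<^sub>F t in nhds 0. - (x $ a) \<le> t \<and> t \<le> x $ b" by eventually_elim auto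
  from local_minimizer_shift[OF ab lm this filterlim_ident]
  obtain d where d: "0 < d" "\<And>t. dist t 0 < d \<Longrightarrow> 0 \<le> (site_energy \<beta> (x $ a + t) - site_energy \<beta> (x $ a)) + (site_energy \<beta> (x $ b - t) - site_energy \<beta> (x $ b))"
    unfolding eventually_nhds_metric by blast
  have "((\<lambda>t. site_energy \<beta> (x $ a + t)) has_real_derivative site_slope \<beta> (x $ a + 0) * 1) (at 0)"
    "((\<lambda>t. site_energy \<beta> (x $ b - t)) has_real_derivative site_slope \<beta> (x $ b - 0) * -1) (at 0)"
    by (rule site_energy_deriv_comp; use p in \<open>auto intro!: derivative_eq_intros\<close>)+
  from DERIV_add[OF this] have "(?f has_real_derivative (site_slope \<beta> (x $ a) - site_slope \<beta> (x $ b))) (at 0)" by simp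
  from DERIV_local_min[OF this d(1)] d(2) have "site_slope \<beta> (x $ a) - site_slope \<beta> (x $ b) = 0"
    by (auto simp: dist_real_def algebra_simps abs_minus_commute)
  then show ?thesis by simp
qed simp

text \<open>Beyond \<open>1 / \<beta>\<close> the one-colour energy is concave, so two equal coordinates there can be pushed
  apart with a gain of second order.\<close>

lemma local_minimizer_unique_large:
  assumes \<beta>: "0 < \<beta>" and lm: "local_minimizer \<beta> x" and ab: "a \<noteq> (b :: 'q::finite)"
  shows "\<not> (1 / \<beta> < x $ a \<and> x $ b = x $ a)"
proof
  assume *: "1 / \<beta> < x $ a \<and> x $ b = x $ a"
  define y where "y = x $ a"
  have y: "1 / \<beta> < y" "x $ a = y" "x $ b = y" using * by (auto simp: y_def)
  have \<beta>': "0 < 1 / \<beta>" using \<beta> by simp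
  let ?f = "\<lambda>t. site_energy \<beta> (y + t) + site_energy \<beta> (y - t)"
  have dec: "?f t < ?f 0" if t: "0 < t" "t < y - 1 / \<beta>" for t
  proof (rule DERIV_neg_imp_decreasing_open[OF t(1)])
    have dd: "(?f has_real_derivative (site_slope \<beta> (y + u) - site_slope \<beta> (y - u))) (at u)" if "0 \<le> u" "u \<le> t" for u
    proof -
      have "((\<lambda>t. site_energy \<beta> (y + t)) has_real_derivative site_slope \<beta> (y + u) * 1) (at u)"
        "((\<lambda>t. site_energy \<beta> (y - t)) has_real_derivative site_slope \<beta> (y - u) * -1) (at u)"
        by (rule site_energy_deriv_comp; use that t \<beta>' in \<open>auto intro!: derivative_eq_intros simp del: zero_less_divide_1_iff\<close>)+
      from DERIV_add[OF this] show ?thesis by simp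
    qed
    show "continuous_on {0..t} ?f"
      by (rule DERIV_continuous_on, rule DERIV_subset[OF dd]) auto
    fix u assume u: "0 < u" "u < t"
    have "site_slope \<beta> (y + u) < site_slope \<beta> (y - u)"
      by (rule site_slope_less(2)) (use u t \<beta> \<beta>' in linarith)+
    with dd[of u] u show "\<exists>l. (?f has_real_derivative l) (at u) \<and> l < 0" by (intro exI conjI) auto
  qed
  have yp: "0 < y" using y(1) \<beta>' by linarith
  have "\<forall>\<^sub>F t in at_right 0. - (x $ a) \<le> t \<and> t \<le> x $ b"
    unfolding eventually_at_right[OF yp] y using yp by (intro exI[of _ y]) auto
  from local_minimizer_shift[OF ab lm this tendsto_ident_at]
  have "\<forall>\<^sub>F t in at_right 0. ?f 0 \<le> ?f t" by eventually_elim (simp add: y)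
  moreover have "\<forall>\<^sub>F t in at_right 0. 0 < t \<and> t < y - 1 / \<beta>"
    using y(1) by (subst eventually_at_right[of 0 "y - 1 / \<beta>"]) (auto intro!: exI[of _ "y - 1 / \<beta>"])
  ultimately have "\<forall>\<^sub>F t in at_right (0::real). False"
    by eventually_elim (use dec in fastforce)
  then show False by simp
qed

text \<open>The segment from the uniform point (\<open>s = 0\<close>) to the vertex of colour \<open>c\<close> (\<open>s = 1\<close>).\<close>

definition ray_point :: "'q \<Rightarrow> real \<Rightarrow> real ^ 'q::finite" where
  "ray_point c s = (\<chi> k. if k = c then (1 + (real CARD('q) - 1) * s) / real CARD('q) else (1 - s) / real CARD('q))"

text \<open>Up to a positive factor, the derivative of the free energy along a ray. Its zeros are the solutions of
  the equation in \<^const>\<open>order_parameter\<close>.\<close>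

definition gap :: "real \<Rightarrow> real \<Rightarrow> real \<Rightarrow> real" where
  "gap q \<beta> s = ln (1 + (q - 1) * s) - ln (1 - s) - \<beta> * s"

text \<open>By the two conditions above a local minimizer other than the uniform point has exactly one coordinate
  beyond \<open>1 / \<beta>\<close>, and all its other coordinates agree.\<close>

lemma local_minimizer_on_ray:
  assumes \<beta>: "0 < \<beta>" and lm: "local_minimizer \<beta> (x :: real ^ 'q::finite)" and ne: "x \<noteq> (\<chi> k. 1 / real CARD('q))"
  obtains c s where "0 < s" "s < 1" "gap (real CARD('q)) \<beta> s = 0" "x = ray_point c s"
proof -
  let ?q = "real CARD('q)"
  have x: "x \<in> prob_simplex" using lm by (simp add: local_minimizer_def)
  have pos: "0 < x $ k" for k by (rule local_minimizer_pos[OF \<beta> lm])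
  have eq: "site_slope \<beta> (x $ k) = site_slope \<beta> (x $ l)" for k l by (rule local_minimizer_slope_eq[OF \<beta> lm])
  have "\<exists>a b. x $ b < x $ a"
  proof (rule ccontr)
    assume "\<not> ?thesis"
    then have e: "x $ k = x $ l" for k l by (meson not_less_iff_gr_or_eq)
    have "x $ k = 1 / ?q" for k
    proof -
      have "(\<Sum>l\<in>UNIV. x $ l) = (\<Sum>l\<in>(UNIV :: 'q set). x $ k)" by (rule sum.cong) (auto intro: e)
      then have "?q * x $ k = 1" using x by (simp add: prob_simplex_def)
      then show ?thesis by (simp add: field_simps)
    qed
    then show False using ne by (simp add: vec_eq_iff)
  qed
  then obtain a b where ab: "x $ b < x $ a" by blast
  then have anb: "a \<noteq> b" by auto
  have b1: "x $ b < 1 / \<beta>"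
    using site_slope_less(2)[OF \<beta> pos ab] eq[of a b] by force
  have a1: "1 / \<beta> < x $ a"
    using site_slope_less(1)[OF \<beta> pos ab] eq[of a b] by force
  have k: "x $ k = x $ b" if "k \<noteq> a" for k
  proof (cases "x $ k \<le> 1 / \<beta>")
    case True
    then show ?thesis
      using site_slope_less(1)[OF \<beta> pos, of k "x $ b"] site_slope_less(1)[OF \<beta> pos, of b "x $ k"] eq[of k b] b1
      by (cases "x $ k" "x $ b" rule: linorder_cases) auto
  next
    case False
    then have "x $ k = x $ a"
      using site_slope_less(2)[OF \<beta> pos, of k "x $ a"] site_slope_less(2)[OF \<beta> pos, of a "x $ k"] eq[of k a] a1
      by (cases "x $ k" "x $ a" rule: linorder_cases) auto
    then show ?thesis using local_minimizer_unique_large[OF \<beta> lm, of a k] that a1 by auto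
  qed
  define y z where "y = x $ b" and "z = x $ a"
  have "(\<Sum>k\<in>UNIV. x $ k) = x $ a + (\<Sum>k\<in>UNIV - {a}. x $ k)" by (rule sum.remove) auto
  also have "(\<Sum>k\<in>UNIV - {a}. x $ k) = (\<Sum>k\<in>UNIV - {a}. y)" by (rule sum.cong) (auto simp: k y_def)
  also have "\<dots> = (?q - 1) * y" by (simp add: card_Diff_singleton of_nat_diff Suc_leI)
  finally have sum1: "z + (?q - 1) * y = 1" using x by (simp add: prob_simplex_def z_def)
  define s where "s = 1 - ?q * y"
  have q0: "0 < ?q" by simp
  have ys: "y = (1 - s) / ?q" by (simp add: s_def)
  have zs: "z = (1 + (?q - 1) * s) / ?q" 
  proof -
    have "1 + (?q - 1) * s = ?q * (1 - (?q - 1) * y)" unfolding s_def by algebra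
    also have "1 - (?q - 1) * y = z" using sum1 by simp
    finally show ?thesis by simp
  qed
  have zy: "z - y = s" using sum1 by (simp add: s_def algebra_simps)
  have yz: "0 < y" "y < z" using pos ab by (auto simp: y_def z_def)
  have s: "0 < s" "s < 1" using yz zy q0 by (auto simp: s_def)
  have "1 + (?q - 1) * s = ?q * z" "1 - s = ?q * y" by (simp add: zs) (simp add: s_def)
  then have "ln (1 + (?q - 1) * s) = ln (?q * z)" "ln (1 - s) = ln (?q * y)" by (simp_all only:)
  then have "gap ?q \<beta> s = ln z - ln y - \<beta> * (z - y)"
    using yz q0 by (simp add: gap_def ln_mult zy)
  also have "\<dots> = \<beta> * (site_slope \<beta> z - site_slope \<beta> y)" using \<beta> by (simp add: site_slope_def field_simps)
  also have "\<dots> = 0" using eq[of a b] by (simp add: y_def z_def)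
  finally have g: "gap ?q \<beta> s = 0" .
  have "x = ray_point a s"
    using k by (auto simp: vec_eq_iff ray_point_def ys[symmetric] zs[symmetric] y_def z_def)
  then show ?thesis using that[OF s g] by blast
qed

text \<open>The numerator of the derivative of \<^term>\<open>gap q \<beta>\<close>. It is a strictly convex quadratic polynomial, and
  this is all that the root counting needs.\<close>

definition gap_slope :: "real \<Rightarrow> real \<Rightarrow> real \<Rightarrow> real" where
  "gap_slope q \<beta> s = q - \<beta> * ((1 + (q - 1) * s) * (1 - s))"

lemma gap_deriv:
  assumes "1 < q" "0 \<le> s" "s < 1"
  shows "(gap q \<beta> has_real_derivative (gap_slope q \<beta> s / ((1 + (q - 1) * s) * (1 - s)))) (at s)"
    and "0 < (1 + (q - 1) * s) * (1 - s)"
proof -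
  have p: "0 < 1 + (q - 1) * s" "0 < 1 - s" using assms by (auto intro: add_pos_nonneg)
  then show "0 < (1 + (q - 1) * s) * (1 - s)" by simp
  have "(gap q \<beta> has_real_derivative ((q - 1) / (1 + (q - 1) * s) + 1 / (1 - s) - \<beta>)) (at s)"
    unfolding gap_def using p by (auto intro!: derivative_eq_intros)
  moreover have "(q - 1) / (1 + (q - 1) * s) + 1 / (1 - s) - \<beta> = gap_slope q \<beta> s / ((1 + (q - 1) * s) * (1 - s))"
    using p unfolding gap_slope_def by (simp add: divide_simps) (simp add: algebra_simps)
  ultimately show "(gap q \<beta> has_real_derivative (gap_slope q \<beta> s / ((1 + (q - 1) * s) * (1 - s)))) (at s)" by simp
qed

lemma gap_0 [simp]: "gap q \<beta> 0 = 0" by (simp add: gap_def)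

lemma gap_cont: "1 < q \<Longrightarrow> 0 \<le> a \<Longrightarrow> b < 1 \<Longrightarrow> continuous_on {a..b} (gap q \<beta>)"
  by (rule DERIV_continuous_on, rule DERIV_subset[OF gap_deriv(1)]) auto

lemma gap_slope_convex:
  assumes "1 < q" "0 < \<beta>" "x < y" "y < z"
  shows "gap_slope q \<beta> y < max (gap_slope q \<beta> x) (gap_slope q \<beta> z)"
proof -
  let ?m = "max (gap_slope q \<beta> x) (gap_slope q \<beta> z)"
  have "gap_slope q \<beta> y * (z - x) = gap_slope q \<beta> x * (z - y) + gap_slope q \<beta> z * (y - x) - \<beta> * (q - 1) * ((y - x) * (z - y) * (z - x))"
    unfolding gap_slope_def by algebra
  also have "\<dots> < ?m * (z - y) + ?m * (y - x)"
  proof -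
    have "0 < \<beta> * (q - 1) * ((y - x) * (z - y) * (z - x))"
      using assms by (intro mult_pos_pos) auto
    moreover have "gap_slope q \<beta> x * (z - y) \<le> ?m * (z - y)" "gap_slope q \<beta> z * (y - x) \<le> ?m * (y - x)"
      using assms by (intro mult_right_mono; simp)+
    ultimately show ?thesis by linarith
  qed
  also have "\<dots> = ?m * (z - x)" by (simp add: algebra_simps)
  finally show ?thesis using assms by simp
qed

lemma gap_mvt:
  assumes "1 < q" "0 \<le> a" "a < b" "b < 1"
  obtains x where "a < x" "x < b" "0 < gap q \<beta> b - gap q \<beta> a \<longleftrightarrow> 0 < gap_slope q \<beta> x"
    "gap q \<beta> b - gap q \<beta> a < 0 \<longleftrightarrow> gap_slope q \<beta> x < 0"
proof -
  have "\<exists>x. a < x \<and> x < b \<and> gap q \<beta> b - gap q \<beta> a = (b - a) * (gap_slope q \<beta> x / ((1 + (q - 1) * x) * (1 - x)))"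
    by (rule MVT2[OF assms(3)]) (use assms in \<open>auto intro!: gap_deriv\<close>)
  then obtain x where x: "a < x" "x < b" "gap q \<beta> b - gap q \<beta> a = (b - a) * (gap_slope q \<beta> x / ((1 + (q - 1) * x) * (1 - x)))" by blast
  have "0 < (1 + (q - 1) * x) * (1 - x)" using x assms by (intro gap_deriv) auto
  then show ?thesis using x assms
    by (intro that[of x]) (simp_all add: zero_less_mult_iff mult_less_0_iff zero_less_divide_iff divide_less_0_iff)
qed

text \<open>Between the roots 0 and \<open>s\<close> there is a point with \<^const>\<open>gap_slope\<close> at most 0. By convexity
  \<^const>\<open>gap_slope\<close> is then positive to the right of \<open>s\<close>, and the gap increases.\<close>

lemma gap_root_greatest:
  assumes q: "1 < q" "0 < \<beta>" and s: "0 < s" "s < 1" "gap q \<beta> s = 0" and h: "0 \<le> gap_slope q \<beta> s" and t: "s < t" "t < 1"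
  shows "0 < gap q \<beta> t"
proof -
  obtain x where x: "0 < x" "x < s" "\<not> 0 < gap_slope q \<beta> x" 
    using gap_mvt[of q 0 s \<beta>] q s by (metis diff_self gap_0 less_irrefl order_refl)
  obtain y where y: "s < y" "y < t" "0 < gap q \<beta> t - gap q \<beta> s \<longleftrightarrow> 0 < gap_slope q \<beta> y"
    using gap_mvt[of q s t \<beta>] q s t by (metis less_imp_le)
  have "gap_slope q \<beta> s < max (gap_slope q \<beta> x) (gap_slope q \<beta> y)" using q x y by (intro gap_slope_convex) auto
  then show ?thesis using x y s h by auto
qed

text \<open>The gap tends to infinity at 1, so a negative value is followed by a root. The gap decreases somewhere
  before \<open>s'\<close> and increases somewhere between \<open>s'\<close> and the root, so by convexity the root is the last
  one.\<close>

lemma gap_negative_root: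
  assumes q: "1 < q" "0 < \<beta>" and s': "0 < s'" "s' < 1" "gap q \<beta> s' < 0"
  obtains s where "s' < s" "s < 1" "gap q \<beta> s = 0" "\<And>t. s < t \<Longrightarrow> t < 1 \<Longrightarrow> 0 < gap q \<beta> t"
proof -
  have "filterlim (\<lambda>s. gap q \<beta> s) at_top (at_left 1)"
    unfolding gap_def using q by real_asymp
  then have "\<forall>\<^sub>F s in at_left 1. 0 < gap q \<beta> s"
    by (rule filterlim_at_top_dense[THEN iffD1, rule_format])
  moreover have "\<forall>\<^sub>F s in at_left 1. s' < s \<and> s < 1"
    using s' by (subst eventually_at_left[of s']) auto
  ultimately have "\<forall>\<^sub>F s in at_left 1. 0 < gap q \<beta> s \<and> s' < s \<and> s < 1" by eventually_elim simp
  then obtain u where u: "0 < gap q \<beta> u" "s' < u" "u < 1"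
    using eventually_happens'[OF trivial_limit_at_left_real] by blast
  obtain s where s: "s' \<le> s" "s \<le> u" "gap q \<beta> s = 0"
    using IVT'[of "gap q \<beta>" s' 0 u] gap_cont[of q s' u \<beta>] u s' q by auto
  have ss: "s' < s" "s < 1" using s s' u by (auto simp: less_le)
  obtain x where x: "0 < x" "x < s'" "gap_slope q \<beta> x < 0"
    using gap_mvt[of q 0 s' \<beta>] q s' by (metis diff_zero gap_0 order_refl)
  obtain y where y: "s' < y" "y < s" "0 < gap_slope q \<beta> y"
    using gap_mvt[of q s' s \<beta>] q s' ss s by (metis diff_0 less_imp_le neg_0_less_iff_less)
  have "gap_slope q \<beta> y < max (gap_slope q \<beta> x) (gap_slope q \<beta> s)" using q x y by (intro gap_slope_convex) auto
  then have "0 \<le> gap_slope q \<beta> s" using x y by auto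
  then show ?thesis using ss s s' gap_root_greatest[OF q, of s] by (intro that[of s]) auto
qed

lemma free_energy_ray:
  "free_energy \<beta> (ray_point c s :: real ^ 'q::finite) =
    site_energy \<beta> ((1 + (real CARD('q) - 1) * s) / real CARD('q)) + (real CARD('q) - 1) * site_energy \<beta> ((1 - s) / real CARD('q))"
proof -
  let ?f = "\<lambda>k. site_energy \<beta> ((ray_point c s :: real ^ 'q) $ k)"
  have "(\<Sum>k\<in>UNIV. ?f k) = ?f c + (\<Sum>k\<in>UNIV - {c}. ?f k)" by (rule sum.remove) auto
  also have "(\<Sum>k\<in>UNIV - {c}. ?f k) = (\<Sum>k\<in>UNIV - {c}. site_energy \<beta> ((1 - s) / real CARD('q)))"
    by (rule sum.cong) (auto simp: ray_point_def)
  also have "\<dots> = (real CARD('q) - 1) * site_energy \<beta> ((1 - s) / real CARD('q))"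
    by (simp add: card_Diff_singleton of_nat_diff Suc_leI)
  finally show ?thesis unfolding free_energy_eq by (simp add: ray_point_def)
qed

lemma ray_point_simplex:
  assumes "0 \<le> s" "s \<le> 1"
  shows "(ray_point c s :: real ^ 'q::finite) \<in> prob_simplex"
proof -
  let ?r = "ray_point c s :: real ^ 'q"
  have "(\<Sum>k\<in>UNIV. ?r $ k) = ?r $ c + (\<Sum>k\<in>UNIV - {c}. ?r $ k)" by (rule sum.remove) auto
  also have "(\<Sum>k\<in>UNIV - {c}. ?r $ k) = (\<Sum>k\<in>UNIV - {c}. ((1 - s) / real CARD('q)))"
    by (rule sum.cong) (auto simp: ray_point_def)
  also have "\<dots> = (real CARD('q) - 1) * ((1 - s) / real CARD('q))"
    by (simp add: card_Diff_singleton of_nat_diff Suc_leI)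
  finally have one: "(\<Sum>k\<in>UNIV. ?r $ k) = 1" by (simp add: ray_point_def field_simps)
  have p: "0 \<le> ?r $ k" for k
    using assms by (auto simp: ray_point_def intro!: divide_nonneg_nonneg add_nonneg_nonneg mult_nonneg_nonneg)
  have "?r $ k \<le> (\<Sum>k\<in>UNIV. ?r $ k)" for k by (rule member_le_sum) (auto simp: p)
  with one p show ?thesis by (auto simp: prob_simplex_def)
qed

text \<open>Where the gap is negative, the free energy decreases along the ray.\<close>

lemma not_local_minimizer_ray:
  assumes q: "1 < real CARD('q)" and \<beta>: "0 < \<beta>" and s: "0 \<le> s" "s < d" "d < 1"
    and g: "\<And>t. s < t \<Longrightarrow> t < d \<Longrightarrow> gap (real CARD('q)) \<beta> t < 0"
  shows "\<not> local_minimizer \<beta> (ray_point c s :: real ^ 'q::finite)"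
proof
  assume lm: "local_minimizer \<beta> (ray_point c s :: real ^ 'q)"
  let ?q = "real CARD('q)"
  let ?f = "\<lambda>s. free_energy \<beta> (ray_point c s :: real ^ 'q)"
  have dd: "(?f has_real_derivative ((?q - 1) / (?q * \<beta>) * gap ?q \<beta> t)) (at t)" if "0 \<le> t" "t < 1" for t
  proof -
    let ?z = "\<lambda>t. (1 + (?q - 1) * t) / ?q" and ?y = "\<lambda>t. (1 - t) / ?q"
    have p: "0 < ?z t" "0 < ?y t" using that q by (auto intro!: divide_pos_pos add_pos_nonneg)
    have "((\<lambda>t. site_energy \<beta> (?z t)) has_real_derivative (site_slope \<beta> (?z t) * ((?q - 1) / ?q))) (at t)"
      by (rule site_energy_deriv_comp[where g="?z", OF _ p(1)]) (auto intro!: derivative_eq_intros)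
    moreover have "((\<lambda>t. site_energy \<beta> (?y t)) has_real_derivative (site_slope \<beta> (?y t) * (- 1 / ?q))) (at t)"
      by (rule site_energy_deriv_comp[where g="?y", OF _ p(2)]) (auto intro!: derivative_eq_intros)
    ultimately have "(?f has_real_derivative (site_slope \<beta> (?z t) * ((?q - 1) / ?q) + (?q - 1) * (site_slope \<beta> (?y t) * (- 1 / ?q)))) (at t)"
      unfolding free_energy_ray by (intro DERIV_add DERIV_cmult)
    moreover have "site_slope \<beta> (?z t) * ((?q - 1) / ?q) + (?q - 1) * (site_slope \<beta> (?y t) * (- 1 / ?q)) = (?q - 1) / ?q * (site_slope \<beta> (?z t) - site_slope \<beta> (?y t))"
      by (simp add: algebra_simps)
    moreover have "site_slope \<beta> (?z t) - site_slope \<beta> (?y t) = gap ?q \<beta> t / \<beta>"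
    proof -
      have "?z t - ?y t = t" using q by (simp add: field_simps)
      moreover have "ln (?z t) = ln (1 + (?q - 1) * t) - ln ?q" "ln (?y t) = ln (1 - t) - ln ?q"
        using p q by (auto simp: ln_div zero_less_divide_iff)
      moreover have "site_slope \<beta> (?z t) - site_slope \<beta> (?y t) = (ln (?z t) - ln (?y t)) / \<beta> - (?z t - ?y t)"
        by (simp only: site_slope_def diff_divide_distrib add_divide_distrib)
      ultimately have "site_slope \<beta> (?z t) - site_slope \<beta> (?y t) = (ln (1 + (?q - 1) * t) - ln (1 - t)) / \<beta> - t" by simp
      then show ?thesis using \<beta> unfolding gap_def by (simp add: diff_divide_distrib)
    qed
    ultimately show ?thesis by simp
  qed
  have dec: "?f t < ?f s" if t: "s < t" "t < d" for t
  proof (rule DERIV_neg_imp_decreasing_open[OF t(1)])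
    show "continuous_on {s..t} ?f"
      by (rule DERIV_continuous_on, rule DERIV_subset[OF dd]) (use s t in auto)
    fix u assume u: "s < u" "u < t"
    then have "(?q - 1) / (?q * \<beta>) * gap ?q \<beta> u < 0"
      using g[of u] t q \<beta> by (intro mult_pos_neg divide_pos_pos) auto
    then show "\<exists>l. (?f has_real_derivative l) (at u) \<and> l < 0"
      using dd[of u] u s t by (intro exI conjI) auto
  qed
  have "((\<lambda>t. ray_point c t :: real ^ 'q) \<longlongrightarrow> ray_point c s) (at_right s)"
    unfolding ray_point_def by (intro vec_tendstoI) (auto intro!: tendsto_eq_intros)
  moreover have ev: "\<forall>\<^sub>F t in at_right s. s < t \<and> t < d"
    using s by (subst eventually_at_right[of s d]) auto
  ultimately have "\<forall>\<^sub>F t in at_right s. ?f s \<le> ?f t"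
    by (intro local_minimizer_curve[OF lm]) (use s in \<open>auto elim!: eventually_mono intro!: ray_point_simplex\<close>)
  with ev have "\<forall>\<^sub>F t in at_right s. False" by eventually_elim (use dec in fastforce)
  then show False by simp
qed

lemma order_parameter_eqI:
  fixes dummy :: "'q::finite itself"
  assumes "0 \<le> s" "s < 1" "gap (real CARD('q)) \<beta> s = 0" "\<And>t. s < t \<Longrightarrow> t < 1 \<Longrightarrow> 0 < gap (real CARD('q)) \<beta> t"
  shows "order_parameter TYPE('q) \<beta> = s"
  unfolding order_parameter_def
proof (rule Greatest_equality)
  show "0 \<le> s \<and> s < 1 \<and> ln (1 + (real CARD('q) - 1) * s) - ln (1 - s) = \<beta> * s"
    using assms by (simp add: gap_def)
  fix t assume t: "0 \<le> t \<and> t < 1 \<and> ln (1 + (real CARD('q) - 1) * t) - ln (1 - t) = \<beta> * t"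
  then have "gap (real CARD('q)) \<beta> t = 0" by (simp add: gap_def)
  then show "t \<le> s" using assms(4)[of t] t by (cases "s < t") auto
qed

lemma min_point_Some: "min_point \<beta> (Some c) = ray_point (c :: 'q::finite) (order_parameter TYPE('q) \<beta>)"
  by (simp add: min_point_def ray_point_def Let_def vec_eq_iff)

lemma min_point_None: "min_point \<beta> None = (\<chi> k :: 'q::finite. 1 / real CARD('q))"
  by (simp add: min_point_def Let_def)

lemma ray_point_0: "ray_point (c :: 'q::finite) 0 = (\<chi> k. 1 / real CARD('q))"
  by (simp add: ray_point_def vec_eq_iff)

text \<open>At a local minimizer the gap cannot decrease through its root. Hence the root is the greatest one, which
  is the value of \<^const>\<open>order_parameter\<close>.\<close>

lemma local_minimizer_greatest_root:
  assumes q: "2 \<le> CARD('q::finite)" and \<beta>: "0 < \<beta>" and lm: "local_minimizer \<beta> (x :: real ^ 'q)" and ne: "x \<noteq> (\<chi> k. 1 / real CARD('q))"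
  obtains c where "x = min_point \<beta> (Some c)"
proof -
  let ?q = "real CARD('q)"
  have q1: "1 < ?q" using q by simp
  obtain c s where s: "0 < s" "s < 1" "gap ?q \<beta> s = 0" "x = ray_point c s"
    by (rule local_minimizer_on_ray[OF \<beta> lm ne])
  have "0 \<le> gap_slope ?q \<beta> s"
  proof (rule ccontr)
    assume h: "\<not> 0 \<le> gap_slope ?q \<beta> s"
    have "gap_slope ?q \<beta> s / ((1 + (?q - 1) * s) * (1 - s)) < 0"
      using gap_deriv(2)[OF q1, of s] s h by (intro divide_neg_pos) auto
    from DERIV_neg_dec_right[OF gap_deriv(1)[OF q1] this] s
    obtain d where d: "0 < d" "\<And>e. 0 < e \<Longrightarrow> e < d \<Longrightarrow> gap ?q \<beta> (s + e) < gap ?q \<beta> s" by auto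
    have "\<not> local_minimizer \<beta> (ray_point c s :: real ^ 'q)"
    proof (rule not_local_minimizer_ray[OF q1 \<beta>, of s "min (s + d) ((s + 1) / 2)"])
      fix t assume "s < t" "t < min (s + d) ((s + 1) / 2)"
      then show "gap ?q \<beta> t < 0" using d(2)[of "t - s"] s by simp
    qed (use s d in \<open>auto simp: min_less_iff_disj\<close>)
    then show False using lm s by simp
  qed
  from gap_root_greatest[OF q1 \<beta> s(1-3) this]
  have "order_parameter TYPE('q) \<beta> = s" using s by (intro order_parameter_eqI) auto
  then show ?thesis using s that[of c] by (simp add: min_point_Some)
qed

text \<open>For large \<open>\<beta>\<close> a vertex has lower free energy than the uniform point, so a global minimizer is not
  uniform. Therefore \<^const>\<open>beta1\<close> is the infimum of a nonempty set.\<close>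

lemma exists_ordered_local_minimizer:
  assumes q: "2 \<le> CARD('q::finite)"
  shows "\<exists>\<beta>>0. \<exists>x :: real ^ 'q. local_minimizer \<beta> x \<and> x \<noteq> (\<chi> k. 1 / real CARD('q))"
proof -
  let ?q = "real CARD('q)"
  define \<beta> where "\<beta> = 4 * ln ?q + 1"
  have lnq: "0 \<le> ln ?q" using q by simp
  then have \<beta>: "0 < \<beta>" unfolding \<beta>_def by linarith
  obtain c :: 'q where True by simp
  have ne: "(prob_simplex :: (real ^ 'q) set) \<noteq> {}" using ray_point_simplex[of 1 c] by auto
  have "\<exists>x\<in>(prob_simplex :: (real ^ 'q) set). \<forall>y\<in>(prob_simplex :: (real ^ 'q) set). free_energy \<beta> x \<le> free_energy \<beta> y"
    by (rule continuous_attains_inf[OF compact_prob_simplex ne continuous_on_free_energy])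
  then obtain x :: "real ^ 'q" where x: "x \<in> prob_simplex" "\<And>y :: real ^ 'q. y \<in> prob_simplex \<Longrightarrow> free_energy \<beta> x \<le> free_energy \<beta> y"
    by auto
  have lm: "local_minimizer \<beta> x"
    unfolding local_minimizer_def using x by (auto simp: eventually_at_filter)
  have "x \<noteq> (\<chi> k. 1 / ?q)"
  proof
    assume "x = (\<chi> k. 1 / ?q)"
    then have "free_energy \<beta> x = - 1 / (2 * ?q) - ln ?q / \<beta>"
    proof -
      assume x: "x = (\<chi> k. 1 / ?q)"
      have "free_energy \<beta> x = ?q * site_energy \<beta> (1 / ?q)" unfolding free_energy_eq x by simp
      also have "\<dots> = - 1 / (2 * ?q) - ln ?q / \<beta>"
        by (simp add: site_energy_def ln_div algebra_simps power2_eq_square)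
      finally show ?thesis .
    qed
    moreover have "free_energy \<beta> (ray_point c 1 :: real ^ 'q) = - 1 / 2"
      unfolding free_energy_ray by (simp add: site_energy_def)
    moreover have "free_energy \<beta> x \<le> free_energy \<beta> (ray_point c 1 :: real ^ 'q)"
      by (rule x(2)) (rule ray_point_simplex; simp)
    moreover have "ln ?q / \<beta> < 1 / 4"
    proof -
      have "L < 1 / 4 * (4 * L + 1)" for L :: real by simp
      then have "ln ?q < 1 / 4 * \<beta>" unfolding \<beta>_def by blast
      then show ?thesis using \<beta> by (simp only: pos_divide_less_eq)
    qed
    moreover have "1 / (2 * ?q) \<le> 1 / 4" using q by (simp add: field_simps)
    ultimately show False by simp
  qed
  then show ?thesis using \<beta> lm by blast
qed

text \<open>The gap is strictly decreasing in \<open>\<beta>\<close>: where it vanishes at some smaller inverse temperature with an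
  ordered local minimizer, it is negative at \<open>\<beta>\<close>.\<close>

lemma beta1_less:
  assumes q: "2 \<le> CARD('q::finite)" and b: "beta1 TYPE('q) < \<beta>"
  obtains s where "0 < s" "s < 1" "gap (real CARD('q)) \<beta> s < 0" "0 < \<beta>"
proof -
  let ?B = "{\<beta>. 0 < \<beta> \<and> (\<exists>x :: real ^ 'q. local_minimizer \<beta> x \<and> x \<noteq> (\<chi> k. 1 / real CARD('q)))}"
  have "?B \<noteq> {}" using exists_ordered_local_minimizer[OF q] by blast
  then obtain \<beta>' where b': "\<beta>' \<in> ?B" "\<beta>' < \<beta>" using b unfolding beta1_def by (rule cInf_lessD[elim_format]) blast
  then obtain x :: "real ^ 'q" where x: "0 < \<beta>'" "local_minimizer \<beta>' x" "x \<noteq> (\<chi> k. 1 / real CARD('q))" by blast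
  from local_minimizer_on_ray[OF x] obtain s where s: "0 < s" "s < 1" "gap (real CARD('q)) \<beta>' s = 0" by blast
  have "gap (real CARD('q)) \<beta> s = - (\<beta> - \<beta>') * s" using s(3) by (simp add: gap_def algebra_simps)
  also have "\<dots> < 0" using s b' by (simp add: mult_less_0_iff)
  finally show ?thesis using that s x b' by force
qed

lemma order_parameter_bounds:
  assumes q: "2 \<le> CARD('q::finite)" and b: "beta1 TYPE('q) < \<beta>"
  shows "0 < order_parameter TYPE('q) \<beta>" "order_parameter TYPE('q) \<beta> < 1"
proof -
  have q1: "1 < real CARD('q)" using q by simp
  obtain s' where s': "0 < s'" "s' < 1" "gap (real CARD('q)) \<beta> s' < 0" and \<beta>: "0 < \<beta>" by (rule beta1_less[OF assms])
  obtain s where s: "s' < s" "s < 1" "gap (real CARD('q)) \<beta> s = 0" "\<And>t. s < t \<Longrightarrow> t < 1 \<Longrightarrow> 0 < gap (real CARD('q)) \<beta> t"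
    using gap_negative_root[OF q1 \<beta> s'] by blast
  have "order_parameter TYPE('q) \<beta> = s" using s s' by (intro order_parameter_eqI) auto
  then show "0 < order_parameter TYPE('q) \<beta>" "order_parameter TYPE('q) \<beta> < 1" using s s' by auto
qed

text \<open>It remains to exclude the uniform point for \<open>\<beta> \<ge> q\<close>. There \<^const>\<open>gap_slope\<close> is at most 0 at the
  origin and negative further to the right; by convexity it is negative in between, so the gap is negative
  near 0.\<close>

lemma local_minimizer_min_point:
  assumes q: "2 \<le> CARD('q::finite)" and b: "beta1 TYPE('q) < \<beta>" and lm: "local_minimizer \<beta> (x :: real ^ 'q)"
  shows "x \<in> min_point \<beta> ` min_index \<beta>"
proof (cases "x = (\<chi> k. 1 / real CARD('q))")
  case False
  obtain s' where \<beta>: "0 < \<beta>" by (rule beta1_less[OF q b])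
  obtain c where "x = min_point \<beta> (Some c)" by (rule local_minimizer_greatest_root[OF q \<beta> lm False])
  then show ?thesis by (auto simp: min_index_def)
next
  case True
  have q1: "1 < real CARD('q)" using q by simp
  obtain s' where s': "0 < s'" "s' < 1" "gap (real CARD('q)) \<beta> s' < 0" and \<beta>: "0 < \<beta>" by (rule beta1_less[OF q b])
  have "\<beta> < real CARD('q)"
  proof (rule ccontr)
    assume n: "\<not> \<beta> < real CARD('q)"
    obtain u where u': "0 < u" "u < s'" "gap (real CARD('q)) \<beta> s' - gap (real CARD('q)) \<beta> 0 < 0 \<longleftrightarrow> gap_slope (real CARD('q)) \<beta> u < 0"
      by (rule gap_mvt[of "real CARD('q)" 0 s' \<beta>]) (use q1 s' in auto)
    then have u: "0 < u" "u < s'" "gap_slope (real CARD('q)) \<beta> u < 0" using s' by auto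
    have h0: "gap_slope (real CARD('q)) \<beta> 0 \<le> 0" using n by (simp add: gap_slope_def)
    have g: "gap (real CARD('q)) \<beta> t < 0" if t: "0 < t" "t < u" for t
    proof -
      obtain y where y: "0 < y" "y < t" "gap (real CARD('q)) \<beta> t - gap (real CARD('q)) \<beta> 0 < 0 \<longleftrightarrow> gap_slope (real CARD('q)) \<beta> y < 0"
        by (rule gap_mvt[of "real CARD('q)" 0 t \<beta>]) (use q1 t u s' in auto)
      have "gap_slope (real CARD('q)) \<beta> y < max (gap_slope (real CARD('q)) \<beta> 0) (gap_slope (real CARD('q)) \<beta> u)"
        using y t q1 \<beta> by (intro gap_slope_convex) auto
      then show ?thesis using y h0 u by auto
    qed
    obtain c :: 'q where True by simp
    have "\<not> local_minimizer \<beta> (ray_point c 0 :: real ^ 'q)"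
      by (rule not_local_minimizer_ray[OF q1 \<beta> _ u(1)]) (use u s' g in auto)
    then show False using lm True by (simp add: ray_point_0)
  qed
  then show ?thesis using True by (auto simp: min_index_def min_point_None intro!: image_eqI[of _ _ None])
qed

lemma min_point_inj:
  assumes q: "2 \<le> CARD('q::finite)" and b: "beta1 TYPE('q) < \<beta>"
  shows "inj (min_point \<beta> :: 'q option \<Rightarrow> real ^ 'q)"
proof (rule injI)
  fix i j :: "'q option" assume e: "min_point \<beta> i = min_point \<beta> j"
  let ?s = "order_parameter TYPE('q) \<beta>" and ?q = "real CARD('q)"
  have s: "0 < ?s" "?s < 1" using order_parameter_bounds[OF q b] by auto
  have q1: "1 < ?q" using q by simp
  have big: "1 / ?q < (1 + (?q - 1) * ?s) / ?q" using q1 s by (simp add: divide_strict_right_mono)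
  have small: "(1 - ?s) / ?q < 1 / ?q" using q1 s by (simp add: divide_strict_right_mono)
  have val: "min_point \<beta> i $ k = (case i of None \<Rightarrow> 1 / ?q | Some c \<Rightarrow> if k = c then (1 + (?q - 1) * ?s) / ?q else (1 - ?s) / ?q)" for i and k :: 'q
    by (simp add: min_point_def Let_def split: option.split)
  have ev: "(case i of None \<Rightarrow> 1 / ?q | Some c \<Rightarrow> if k = c then (1 + (?q - 1) * ?s) / ?q else (1 - ?s) / ?q)
    = (case j of None \<Rightarrow> 1 / ?q | Some c \<Rightarrow> if k = c then (1 + (?q - 1) * ?s) / ?q else (1 - ?s) / ?q)" for k
    using e val[of i k] val[of j k] by simp
  show "i = j"
  proof (cases i; cases j)
    fix c d assume *: "i = Some c" "j = Some d"
    show ?thesis using ev[of c] big small * by (auto split: if_splits)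
  next
    fix c assume *: "i = Some c" "j = None"
    show ?thesis using ev[of c] big * by auto
  next
    fix c assume *: "i = None" "j = Some c"
    show ?thesis using ev[of c] big * by auto
  qed simp
qed

lemma min_point_bounds:
  assumes q: "2 \<le> CARD('q::finite)" and b: "beta1 TYPE('q) < \<beta>"
  shows "min_point \<beta> (i :: 'q option) \<in> prob_simplex" "min_point \<beta> i $ k < 1"
proof -
  let ?s = "order_parameter TYPE('q) \<beta>" and ?q = "real CARD('q)"
  have s: "0 < ?s" "?s < 1" using order_parameter_bounds[OF q b] by auto
  have q1: "1 < ?q" using q by simp
  obtain c :: 'q where True by simp
  show "min_point \<beta> i \<in> prob_simplex"
  proof (cases i)
    case None then show ?thesis using ray_point_simplex[of 0 c] by (simp add: min_point_None ray_point_0)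
  next
    case (Some c) then show ?thesis using ray_point_simplex[of ?s c] s by (simp add: min_point_Some)
  qed
  have "(?q - 1) * ?s < (?q - 1) * 1" using q1 s by (intro mult_strict_left_mono) auto
  then have "1 + (?q - 1) * ?s < ?q" by (simp add: algebra_simps)
  then have "(1 + (?q - 1) * ?s) / ?q < 1" using q1 by simp
  moreover have "(1 - ?s) / ?q < 1" using q1 s by simp
  moreover have "1 / ?q < 1" using q1 by simp
  ultimately show "min_point \<beta> i $ k < 1"
    by (auto simp: min_point_def Let_def split: option.split)
qed

section \<open>Lattice paths in the simplex\<close>

definition compositions :: "nat \<Rightarrow> ('q::finite \<Rightarrow> nat) set" where
  "compositions N = {n. (\<Sum>k\<in>UNIV. n k) = N}"

definition lattice_point :: "nat \<Rightarrow> ('q::finite \<Rightarrow> nat) \<Rightarrow> real ^ 'q" where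
  "lattice_point N n = (\<chi> k. real (n k) / real N)"

definition move_unit :: "'q \<Rightarrow> 'q \<Rightarrow> ('q \<Rightarrow> nat) \<Rightarrow> 'q \<Rightarrow> nat" where
  "move_unit a b n = n(a := n a - 1, b := n b + 1)"

definition unit_moves :: "('q::finite \<Rightarrow> nat) rel" where
  "unit_moves = {(n, move_unit a b n) | n a b. a \<noteq> b \<and> 0 < n a}"

lemma compositions_le: "n \<in> compositions N \<Longrightarrow> n k \<le> N"
  unfolding compositions_def using member_le_sum[of k UNIV n] by auto

lemma finite_compositions: "finite (compositions N :: ('q::finite \<Rightarrow> nat) set)"
  and card_compositions: "card (compositions N :: ('q \<Rightarrow> nat) set) \<le> (N + 1) ^ CARD('q)"
proof -
  have sub: "compositions N \<subseteq> (UNIV :: 'q set) \<rightarrow>\<^sub>E {0..N}"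
    by (auto simp: compositions_le)
  have fin: "finite ((UNIV :: 'q set) \<rightarrow>\<^sub>E {0..N})" by (intro finite_PiE) auto
  show "finite (compositions N :: ('q \<Rightarrow> nat) set)" by (rule finite_subset[OF sub fin])
  have "card (compositions N :: ('q \<Rightarrow> nat) set) \<le> card ((UNIV :: 'q set) \<rightarrow>\<^sub>E {0..N})" by (rule card_mono[OF fin sub])
  also have "\<dots> = (N + 1) ^ CARD('q)" by (simp add: card_PiE)
  finally show "card (compositions N :: ('q \<Rightarrow> nat) set) \<le> (N + 1) ^ CARD('q)" .
qed

lemma lattice_point_simplex:
  assumes "1 \<le> N" "n \<in> compositions N" shows "lattice_point N n \<in> prob_simplex"
proof -
  have "(\<Sum>k\<in>UNIV. real (n k) / real N) = real (\<Sum>k\<in>UNIV. n k) / real N" by (simp add: sum_divide_distrib)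
  also have "\<dots> = 1" using assms by (simp add: compositions_def)
  finally show ?thesis using assms compositions_le[OF assms(2)] by (auto simp: prob_simplex_def lattice_point_def)
qed

lemma lattice_point_inj: "1 \<le> N \<Longrightarrow> lattice_point N n = lattice_point N m \<longleftrightarrow> n = m"
  by (auto simp: lattice_point_def vec_eq_iff fun_eq_iff)

lemma lattice_simplex_eq:
  assumes "1 \<le> N" shows "lattice_simplex N = lattice_point N ` compositions N"
proof (intro set_eqI iffI)
  fix x :: "real ^ 'a" assume "x \<in> lattice_simplex N"
  then have x: "x \<in> prob_simplex" "\<forall>k. \<exists>n::nat. x $ k = real n / real N" by (auto simp: lattice_simplex_def)
  from x(2) obtain n where n: "\<And>k. x $ k = real (n k) / real N" by metis
  have "real (\<Sum>k\<in>UNIV. n k) / real N = 1" using x(1) n by (simp add: prob_simplex_def sum_divide_distrib)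
  then have "n \<in> compositions N" using assms by (simp add: compositions_def) (metis of_nat_eq_iff of_nat_sum)
  moreover have "x = lattice_point N n" using n by (simp add: lattice_point_def vec_eq_iff)
  ultimately show "x \<in> lattice_point N ` compositions N" by blast
next
  fix x :: "real ^ 'a" assume "x \<in> lattice_point N ` compositions N"
  then obtain n where n: "n \<in> compositions N" "x = lattice_point N n" by blast
  then show "x \<in> lattice_simplex N" using lattice_point_simplex[OF assms n(1)] by (auto simp: lattice_simplex_def lattice_point_def)
qed

lemma move_unit_compositions:
  assumes "a \<noteq> b" "0 < n a" "n \<in> compositions N" shows "move_unit a b n \<in> compositions N"
proof -
  have s: "(\<Sum>k\<in>UNIV. f k) = f a + f b + (\<Sum>k\<in>UNIV - {a, b}. f k)" for f :: "'a \<Rightarrow> nat"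
  proof -
    have "(\<Sum>k\<in>UNIV. f k) = (\<Sum>k\<in>{a,b}. f k) + (\<Sum>k\<in>UNIV - {a, b}. f k)"
      by (subst sum.union_disjoint[symmetric]) (auto intro!: sum.cong)
    then show ?thesis using assms by simp
  qed
  have r: "(\<Sum>k\<in>UNIV - {a, b}. move_unit a b n k) = (\<Sum>k\<in>UNIV - {a, b}. n k)"
    by (rule sum.cong) (auto simp: move_unit_def)
  have "(\<Sum>k\<in>UNIV. move_unit a b n k) = (\<Sum>k\<in>UNIV. n k)"
    unfolding s[of "move_unit a b n"] s[of n] r using assms by (simp add: move_unit_def)
  then show ?thesis using assms by (simp add: compositions_def)
qed

text \<open>Moving units from colours with a surplus to colours with a deficit keeps every coordinate between its
  initial and its final value.\<close>

lemma unit_moves_between: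
  assumes "n \<in> compositions N" "m \<in> compositions N"
    and G: "\<And>p. p \<in> compositions N \<Longrightarrow> (\<And>k. min (n k) (m k) \<le> p k \<and> p k \<le> max (n k) (m k)) \<Longrightarrow> p \<in> G"
  shows "(n, m) \<in> (unit_moves \<inter> G \<times> G)\<^sup>*"
  using assms
proof (induction "\<Sum>k\<in>UNIV. n k - m k" arbitrary: n rule: less_induct)
  case less
  show ?case
  proof (cases "n = m")
    case False
    have sums: "(\<Sum>k\<in>UNIV. n k) = (\<Sum>k\<in>UNIV. m k)" using less.prems by (simp add: compositions_def)
    have "\<exists>a. m a < n a"
    proof (rule ccontr)
      assume "\<not> ?thesis"
      then have le: "n k \<le> m k" for k by (simp add: not_less)
      obtain k where "n k \<noteq> m k" using False by auto
      then have "n k < m k" using le[of k] by simp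
      then have "(\<Sum>k\<in>UNIV. n k) < (\<Sum>k\<in>UNIV. m k)" using le by (intro sum_strict_mono_ex1) auto
      with sums show False by simp
    qed
    then obtain a where a: "m a < n a" by blast
    have "\<exists>b. n b < m b"
    proof (rule ccontr)
      assume "\<not> ?thesis"
      then have "m k \<le> n k" for k by (simp add: not_less)
      then have "(\<Sum>k\<in>UNIV. m k) < (\<Sum>k\<in>UNIV. n k)" using a by (intro sum_strict_mono_ex1) auto
      with sums show False by simp
    qed
    then obtain b where b: "n b < m b" by blast
    have ab: "a \<noteq> b" using a b by auto
    let ?n = "move_unit a b n"
    have c: "?n \<in> compositions N" using a less.prems by (intro move_unit_compositions ab) auto
    have btw: "min (n k) (m k) \<le> ?n k \<and> ?n k \<le> max (n k) (m k)" for k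
      using a b by (auto simp: move_unit_def)
    have "(\<Sum>k\<in>UNIV. ?n k - m k) < (\<Sum>k\<in>UNIV. n k - m k)"
      using a b by (intro sum_strict_mono_ex1) (auto simp: move_unit_def)
    moreover have "p \<in> G" if "p \<in> compositions N" "\<And>k. min (?n k) (m k) \<le> p k \<and> p k \<le> max (?n k) (m k)" for p
    proof (rule less.prems(3)[OF that(1)])
      fix k show "min (n k) (m k) \<le> p k \<and> p k \<le> max (n k) (m k)" using that(2)[of k] btw[of k] by auto
    qed
    ultimately have "(?n, m) \<in> (unit_moves \<inter> G \<times> G)\<^sup>*" using c less.prems by (intro less.hyps) auto
    moreover have "(n, ?n) \<in> unit_moves \<inter> G \<times> G"
    proof -
      have "(n, ?n) \<in> unit_moves" unfolding unit_moves_def using a ab by force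
      moreover have "n \<in> G" "?n \<in> G" using less.prems(1) c btw by (auto intro!: less.prems(3))
      ultimately show ?thesis by blast
    qed
    ultimately show ?thesis by (rule converse_rtrancl_into_rtrancl[rotated])
  qed simp
qed

lemma between_norm:
  assumes "\<And>k. min (n k) (m k) \<le> p k \<and> p k \<le> max (n k) (m k)"
  shows "dist (lattice_point N n) (lattice_point N p) \<le> dist (lattice_point N n) (lattice_point N m)"
  unfolding dist_norm
proof (rule norm_le_componentwise_cart)
  fix k
  have "\<bar>real (n k) - real (p k)\<bar> \<le> \<bar>real (n k) - real (m k)\<bar>" using assms[of k] by auto
  then show "norm ((lattice_point N n - lattice_point N p) $ k) \<le> norm ((lattice_point N n - lattice_point N m) $ k)"
    by (simp add: lattice_point_def diff_divide_distrib[symmetric] divide_right_mono)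
qed

text \<open>Round every coordinate down and give the missing units, at most one per colour, to a single colour.\<close>

lemma exists_lattice_point_near:
  assumes "1 \<le> N" "x \<in> (prob_simplex :: (real ^ 'q::finite) set)"
  obtains n where "n \<in> compositions N" "dist (lattice_point N n) x \<le> 2 * (real CARD('q))\<^sup>2 / real N"
proof -
  define f where "f k = nat \<lfloor>real N * x $ k\<rfloor>" for k
  have x0: "0 \<le> x $ k" for k using assms by (auto simp: prob_simplex_def)
  have f: "real (f k) \<le> real N * x $ k" "real N * x $ k < real (f k) + 1" for k
    using x0[of k] unfolding f_def by (auto simp: of_nat_nat)
  have sx: "(\<Sum>k\<in>UNIV. real N * x $ k) = real N" using assms by (simp add: prob_simplex_def sum_distrib_left[symmetric])
  have "real (\<Sum>k\<in>UNIV. f k) \<le> real N" using sum_mono[of UNIV "\<lambda>k. real (f k)" "\<lambda>k. real N * x $ k"] f(1) sx by simp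
  then have le: "(\<Sum>k\<in>UNIV. f k) \<le> N" by (simp only: of_nat_le_iff)
  define r where "r = N - (\<Sum>k\<in>UNIV. f k)"
  have "(\<Sum>k\<in>UNIV. real N * x $ k) \<le> (\<Sum>k\<in>UNIV. real (f k) + 1)" by (rule sum_mono) (use f(2) in \<open>simp add: less_imp_le\<close>)
  then have r: "real r \<le> real CARD('q)" using le sx by (simp add: r_def of_nat_diff sum.distrib)
  obtain c :: 'q where True by simp
  define n where "n = f(c := f c + r)"
  have "(\<Sum>k\<in>UNIV. n k) = n c + (\<Sum>k\<in>UNIV - {c}. n k)" by (rule sum.remove) auto
  also have "(\<Sum>k\<in>UNIV - {c}. n k) = (\<Sum>k\<in>UNIV - {c}. f k)" by (rule sum.cong) (auto simp: n_def)
  also have "n c + \<dots> = r + (\<Sum>k\<in>UNIV. f k)" by (simp add: n_def sum.remove[of UNIV c f])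
  also have "\<dots> = N" using le by (simp add: r_def)
  finally have n: "n \<in> compositions N" by (simp add: compositions_def)
  have q: "1 \<le> real CARD('q)" by (simp add: Suc_leI)
  have d: "\<bar>real (n k) - real N * x $ k\<bar> \<le> 2 * real CARD('q)" for k
  proof -
    have *: "\<bar>u + w - v\<bar> \<le> 2 * Q" if "u \<le> v" "v < u + 1" "0 \<le> w" "w \<le> Q" "1 \<le> Q" for u v w Q :: real
      using that by linarith
    have "real (n k) = real (f k) + (if k = c then real r else 0)" by (simp add: n_def)
    then show ?thesis using *[OF f[of k] _ _ q, of "if k = c then real r else 0"] r by simp
  qed
  have "dist (lattice_point N n) x \<le> (\<Sum>k\<in>UNIV. \<bar>(lattice_point N n - x) $ k\<bar>)" unfolding dist_norm by (rule norm_le_l1_cart)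
  also have "\<dots> \<le> (\<Sum>k\<in>(UNIV :: 'q set). 2 * real CARD('q) / real N)"
  proof (rule sum_mono)
    fix k
    have "\<bar>(lattice_point N n - x) $ k\<bar> = \<bar>real (n k) - real N * x $ k\<bar> / real N"
      using assms(1) by (simp add: lattice_point_def field_simps)
    also have "\<dots> \<le> 2 * real CARD('q) / real N" by (rule divide_right_mono[OF d]) simp
    finally show "\<bar>(lattice_point N n - x) $ k\<bar> \<le> 2 * real CARD('q) / real N" .
  qed
  also have "\<dots> = 2 * (real CARD('q))\<^sup>2 / real N" by (simp add: power2_eq_square)
  finally show ?thesis using that n by blast
qed

lemma eventually_lattice_point_near:
  assumes "0 < e"
  shows "\<forall>\<^sub>F N in sequentially. \<forall>x \<in> (prob_simplex :: (real ^ 'q::finite) set). \<exists>n\<in>compositions N. dist (lattice_point N n) x < e"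
proof -
  have "(\<lambda>N. 2 * (real CARD('q))\<^sup>2 / real N) \<longlonglongrightarrow> 0" by (rule real_tendsto_divide_at_top[OF tendsto_const filterlim_real_sequentially])
  from order_tendstoD(2)[OF this assms] eventually_ge_at_top[of 1] show ?thesis
  proof eventually_elim
    case (elim N)
    show ?case
    proof
      fix x :: "real ^ 'q" assume "x \<in> prob_simplex"
      from exists_lattice_point_near[OF elim(2) this] obtain n where "n \<in> compositions N" "dist (lattice_point N n) x \<le> 2 * (real CARD('q))\<^sup>2 / real N" .
      with elim(1) show "\<exists>n\<in>compositions N. dist (lattice_point N n) x < e" by (intro bexI[of _ n]) auto
    qed
  qed
qed

lemma free_energy_uniformly:
  assumes "0 < e"
  obtains d where "0 < d" "\<And>x y :: real ^ 'q::finite. x \<in> prob_simplex \<Longrightarrow> y \<in> prob_simplex \<Longrightarrow> dist x y < d \<Longrightarrow> \<bar>free_energy \<beta> x - free_energy \<beta> y\<bar> < e"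
proof -
  have "uniformly_continuous_on prob_simplex (free_energy \<beta> :: real ^ 'q \<Rightarrow> real)"
    by (intro compact_uniformly_continuous continuous_on_free_energy compact_prob_simplex)
  from this[unfolded uniformly_continuous_on_def, rule_format, OF assms]
  obtain d where "0 < d" "\<And>x y :: real ^ 'q. x \<in> prob_simplex \<Longrightarrow> y \<in> prob_simplex \<Longrightarrow> dist y x < d \<Longrightarrow> dist (free_energy \<beta> y) (free_energy \<beta> x) < e" by blast
  then show ?thesis by (intro that[of d]) (auto simp: dist_real_def)
qed

text \<open>Otherwise some points \<open>x n\<close> of \<open>S\<close> admit no descent by more than \<open>1 / (n + 1)\<close> within distance
  \<open>d\<close>, and every accumulation point of them is a local minimizer in \<open>S\<close>.\<close>

lemma uniform_descent:
  fixes S :: "(real ^ 'q::finite) set"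
  assumes S: "compact S" "S \<subseteq> prob_simplex" and nlm: "\<And>x. x \<in> S \<Longrightarrow> \<not> local_minimizer \<beta> x" and d: "0 < d"
  obtains (descent) \<kappa> where "0 < \<kappa>" "\<And>x. x \<in> S \<Longrightarrow> \<exists>y\<in>prob_simplex. dist x y < d \<and> free_energy \<beta> y < free_energy \<beta> x - \<kappa>"
proof (rule ccontr)
  assume nt: "\<not> thesis"
  have "\<exists>x. x \<in> S \<and> (\<forall>y\<in>prob_simplex. dist x y < d \<longrightarrow> free_energy \<beta> x - 1 / real (Suc n) \<le> free_energy \<beta> y)" for n
  proof (rule ccontr)
    assume c: "\<not> ?thesis"
    have "\<exists>y\<in>prob_simplex. dist x y < d \<and> free_energy \<beta> y < free_energy \<beta> x - 1 / real (Suc n)" if "x \<in> S" for x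
      using c that by (meson not_less)
    then show False using nt descent[of "1 / real (Suc n)"] by simp
  qed
  then obtain x where x: "\<And>n. x n \<in> S" "\<And>n y. y \<in> prob_simplex \<Longrightarrow> dist (x n) y < d \<Longrightarrow> free_energy \<beta> (x n) - 1 / real (Suc n) \<le> free_energy \<beta> y"
    by metis
  obtain l r where l: "l \<in> S" "strict_mono r" "(x \<circ> r) \<longlonglongrightarrow> l"
    using S(1) x(1) unfolding compact_def by metis
  have lim: "(\<lambda>n. free_energy \<beta> (x (r n)) - 1 / real (Suc (r n))) \<longlonglongrightarrow> free_energy \<beta> l - 0"
  proof (intro tendsto_diff)
    show "(\<lambda>n. free_energy \<beta> (x (r n))) \<longlonglongrightarrow> free_energy \<beta> l"
      by (rule continuous_on_tendsto_compose[OF continuous_on_free_energy l(3)[unfolded comp_def]])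
        (use l(1) x(1) S(2) in \<open>auto simp: subset_iff\<close>)
    have "(\<lambda>n. 1 / real (Suc n)) \<longlonglongrightarrow> 0" by (rule LIMSEQ_Suc[OF lim_1_over_n])
    from LIMSEQ_subseq_LIMSEQ[OF this l(2)] show "(\<lambda>n. 1 / real (Suc (r n))) \<longlonglongrightarrow> 0" by (simp add: comp_def)
  qed
  have "free_energy \<beta> l \<le> free_energy \<beta> y" if y: "y \<in> prob_simplex" "dist y l < d" for y
  proof (rule tendsto_upperbound[OF lim[simplified]])
    have "(\<lambda>n. dist (x (r n)) y) \<longlonglongrightarrow> dist l y" using l(3) by (intro tendsto_intros) (simp add: comp_def)
    from order_tendstoD(2)[OF this] y(2) have "\<forall>\<^sub>F n in sequentially. dist (x (r n)) y < d" by (simp add: dist_commute)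
    then show "\<forall>\<^sub>F n in sequentially. free_energy \<beta> (x (r n)) - 1 / (1 + real (r n)) \<le> free_energy \<beta> y"
      by eventually_elim (use x(2)[OF y(1)] in force)
  qed simp
  then have "local_minimizer \<beta> l"
    unfolding local_minimizer_def eventually_at using l(1) S(2) d by blast
  then show False using nlm l(1) by blast
qed

definition sublevel :: "real \<Rightarrow> nat \<Rightarrow> real \<Rightarrow> ('q::finite \<Rightarrow> nat) set" where
  "sublevel \<beta> N c = {p\<in>compositions N. free_energy \<beta> (lattice_point N p) \<le> c}"

text \<open>From every lattice point one reaches a well while climbing at most \<open>e\<close>. Away from the wells
  \<open>uniform_descent\<close> gives a nearby lattice point of lower free energy, and close to a well one walks
  straight into it; these walks are so short that uniform continuity bounds the climb. The iteration is an
  induction on the number of lattice points of lower free energy.\<close>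

lemma descent_path:
  fixes a :: "nat \<Rightarrow> 'q::finite option \<Rightarrow> 'q \<Rightarrow> nat"
  assumes q: "2 \<le> CARD('q)" and b: "beta1 TYPE('q) < \<beta>" and e: "0 < e"
    and a: "\<And>N i. 1 \<le> N \<Longrightarrow> i \<in> min_index \<beta> \<Longrightarrow> a N i \<in> compositions N"
    and lim: "\<And>i. i \<in> min_index \<beta> \<Longrightarrow> (\<lambda>N. lattice_point N (a N i)) \<longlonglongrightarrow> min_point \<beta> i"
  shows "\<forall>\<^sub>F N in sequentially. \<forall>n\<in>compositions N. \<exists>i\<in>min_index \<beta>.
    (n, a N i) \<in> (unit_moves \<inter> sublevel \<beta> N (free_energy \<beta> (lattice_point N n) + e) \<times> sublevel \<beta> N (free_energy \<beta> (lattice_point N n) + e))\<^sup>*"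
proof -
  let ?F = "free_energy \<beta> :: real ^ 'q \<Rightarrow> real"
  let ?m = "min_point \<beta> :: 'q option \<Rightarrow> real ^ 'q"
  obtain d where d: "0 < d" "\<And>x y :: real ^ 'q. x \<in> prob_simplex \<Longrightarrow> y \<in> prob_simplex \<Longrightarrow> dist x y < d \<Longrightarrow> \<bar>?F x - ?F y\<bar> < e"
    by (rule free_energy_uniformly[OF e, where \<beta>=\<beta> and 'q='q]) blast
  define S where "S = prob_simplex - (\<Union>i\<in>min_index \<beta>. ball (?m i) (d / 2))"
  have S: "compact S" "S \<subseteq> prob_simplex"
    unfolding S_def by (intro compact_diff compact_prob_simplex open_UN) auto
  have nlm: "\<not> local_minimizer \<beta> x" if "x \<in> S" for x
  proof
    assume "local_minimizer \<beta> x"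
    then obtain i where "i \<in> min_index \<beta>" "x = ?m i" using local_minimizer_min_point[OF q b] by blast
    then have "x \<in> (\<Union>i\<in>min_index \<beta>. ball (?m i) (d / 2))" using d(1) by (intro UN_I[of i]) auto
    then show False using that by (simp add: S_def)
  qed
  have d2: "0 < d / 2" using d by simp
  obtain \<kappa> where \<kappa>: "0 < \<kappa>" "\<And>x. x \<in> S \<Longrightarrow> \<exists>y\<in>prob_simplex. dist x y < d / 2 \<and> ?F y < ?F x - \<kappa>"
    using uniform_descent[OF S nlm d2] by (metis (no_types, lifting))
  obtain d' where d': "0 < d'" "\<And>x y :: real ^ 'q. x \<in> prob_simplex \<Longrightarrow> y \<in> prob_simplex \<Longrightarrow> dist x y < d' \<Longrightarrow> \<bar>?F x - ?F y\<bar> < \<kappa>"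
    by (rule free_energy_uniformly[OF \<kappa>(1), where \<beta>=\<beta> and 'q='q]) blast
  have "0 < min (d / 2) d'" using d d' by simp
  then have ev1: "\<forall>\<^sub>F N in sequentially. \<forall>x \<in> (prob_simplex :: (real ^ 'q) set). \<exists>n\<in>compositions N. dist (lattice_point N n) x < min (d / 2) d'"
    by (rule eventually_lattice_point_near)
  have ev2: "\<forall>\<^sub>F N in sequentially. \<forall>i\<in>min_index \<beta>. dist (lattice_point N (a N i)) (?m i) < d / 2"
    using tendstoD[OF lim d2] by (intro eventually_ball_finite) auto
  from ev1 ev2 eventually_ge_at_top[of 1] show ?thesis
  proof eventually_elim
    case (elim N)
    let ?s = "\<lambda>c. sublevel \<beta> N c :: ('q \<Rightarrow> nat) set"
    have simp: "lattice_point N n \<in> prob_simplex" if "n \<in> compositions N" for n :: "'q \<Rightarrow> nat" by (rule lattice_point_simplex[OF elim(3) that])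
    have near: "(n, n') \<in> (unit_moves \<inter> ?s (?F (lattice_point N n) + e) \<times> ?s (?F (lattice_point N n) + e))\<^sup>*"
      if n: "n \<in> compositions N" "n' \<in> compositions N" "dist (lattice_point N n) (lattice_point N n') < d" for n n' :: "'q \<Rightarrow> nat"
    proof (rule unit_moves_between[OF n(1,2)])
      fix p assume p: "p \<in> compositions N" "\<And>k. min (n k) (n' k) \<le> p k \<and> p k \<le> max (n k) (n' k)"
      have "dist (lattice_point N n) (lattice_point N p) < d" using between_norm[of n n' p N, OF p(2)] n(3) by simp
      from d(2)[OF simp[OF n(1)] simp[OF p(1)] this] show "p \<in> ?s (?F (lattice_point N n) + e)"
        using p(1) by (simp add: sublevel_def)
    qed
    show ?case
    proof
      fix n :: "'q \<Rightarrow> nat" assume "n \<in> compositions N"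
      then show "\<exists>i\<in>min_index \<beta>. (n, a N i) \<in> (unit_moves \<inter> ?s (?F (lattice_point N n) + e) \<times> ?s (?F (lattice_point N n) + e))\<^sup>*"
      proof (induction "card {p \<in> compositions N. ?F (lattice_point N p) < ?F (lattice_point N n)}" arbitrary: n rule: less_induct)
        case less
        show ?case
        proof (cases "lattice_point N n \<in> S")
          case False
          then obtain i where i: "i \<in> min_index \<beta>" "dist (?m i) (lattice_point N n) < d / 2"
            using simp[OF less.prems] by (auto simp: S_def)
          have "dist (lattice_point N n) (lattice_point N (a N i)) < d"
            using dist_triangle_half_l[of "lattice_point N n" "?m i" d "lattice_point N (a N i)"] i elim(2) by (simp add: dist_commute)
          from near[OF less.prems a[OF elim(3) i(1)] this] show ?thesis using i(1) by blast
        next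
          case True
          from \<kappa>(2)[OF True] obtain y where y: "y \<in> prob_simplex" "dist (lattice_point N n) y < d / 2" "?F y < ?F (lattice_point N n) - \<kappa>" by blast
          from elim(1) y(1) obtain n' where n': "n' \<in> compositions N" "dist (lattice_point N n') y < min (d / 2) d'" by blast
          have "\<bar>?F (lattice_point N n') - ?F y\<bar> < \<kappa>" using d'(2)[OF simp[OF n'(1)] y(1)] n'(2) by simp
          then have lt: "?F (lattice_point N n') < ?F (lattice_point N n)" using y(3) by linarith
          have "dist (lattice_point N n) (lattice_point N n') < d"
            using dist_triangle_half_l[of "lattice_point N n" y d "lattice_point N n'"] y(2) n'(2) by (simp add: dist_commute)
          from near[OF less.prems n'(1) this]
          have p1: "(n, n') \<in> (unit_moves \<inter> ?s (?F (lattice_point N n) + e) \<times> ?s (?F (lattice_point N n) + e))\<^sup>*" .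
          have "card {p \<in> compositions N. ?F (lattice_point N p) < ?F (lattice_point N n')} < card {p \<in> compositions N. ?F (lattice_point N p) < ?F (lattice_point N n)}"
          proof (rule psubset_card_mono)
            show "finite {p \<in> compositions N. ?F (lattice_point N p) < ?F (lattice_point N n)}" by (simp add: finite_compositions)
            have "n' \<in> {p \<in> compositions N. ?F (lattice_point N p) < ?F (lattice_point N n)}" using n'(1) lt by simp
            then show "{p \<in> compositions N. ?F (lattice_point N p) < ?F (lattice_point N n')} \<subset> {p \<in> compositions N. ?F (lattice_point N p) < ?F (lattice_point N n)}"
              using lt by (auto simp: psubset_eq)
          qed
          from less.hyps[OF this n'(1)] obtain i where i: "i \<in> min_index \<beta>"
            "(n', a N i) \<in> (unit_moves \<inter> ?s (?F (lattice_point N n') + e) \<times> ?s (?F (lattice_point N n') + e))\<^sup>*" by blast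
          have "?s (?F (lattice_point N n') + e) \<subseteq> ?s (?F (lattice_point N n) + e)" using lt by (auto simp: sublevel_def)
          then have "(unit_moves \<inter> ?s (?F (lattice_point N n') + e) \<times> ?s (?F (lattice_point N n') + e))\<^sup>* \<subseteq> (unit_moves \<inter> ?s (?F (lattice_point N n) + e) \<times> ?s (?F (lattice_point N n) + e))\<^sup>*"
            by (intro rtrancl_mono) auto
          with i p1 show ?thesis by (meson rtrancl_trans subsetD)
        qed
      qed
    qed
  qed
qed

lemma free_energy_bounded:
  obtains B C where "\<And>x :: real ^ 'q::finite. x \<in> prob_simplex \<Longrightarrow> B \<le> free_energy \<beta> x \<and> free_energy \<beta> x \<le> C"
proof -
  have "bounded (free_energy \<beta> ` (prob_simplex :: (real ^ 'q) set))"
    by (intro compact_imp_bounded compact_continuous_image continuous_on_free_energy compact_prob_simplex)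
  then obtain a where "\<forall>x\<in>free_energy \<beta> ` (prob_simplex :: (real ^ 'q) set). norm x \<le> a" unfolding bounded_iff by blast
  then have a: "\<bar>free_energy \<beta> x\<bar> \<le> a" if "x \<in> prob_simplex" for x :: "real ^ 'q" using that by force
  have "- a \<le> free_energy \<beta> x \<and> free_energy \<beta> x \<le> a" if "x \<in> prob_simplex" for x :: "real ^ 'q" 
    using a[OF that] by linarith
  then show ?thesis using that by blast
qed

lemma comm_height_le:
  fixes x y :: "real ^ 'q::finite"
  assumes "path_component {z\<in>prob_simplex. free_energy \<beta> z \<le> c} x y"
  shows "comm_height \<beta> x y \<le> c"
proof -
  let ?F = "free_energy \<beta> :: real ^ 'q \<Rightarrow> real"
  let ?G = "{\<gamma>. path \<gamma> \<and> path_image \<gamma> \<subseteq> prob_simplex \<and> pathstart \<gamma> = x \<and> pathfinish \<gamma> = y}"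
  obtain B C where BC: "\<And>x. x \<in> prob_simplex \<Longrightarrow> B \<le> ?F x \<and> ?F x \<le> C" using free_energy_bounded[where 'q='q and \<beta>=\<beta>] by metis
  have "B \<le> (SUP t\<in>{0..1}. ?F (\<gamma> t))" if "\<gamma> \<in> ?G" for \<gamma>
  proof -
    have im: "\<gamma> t \<in> prob_simplex" if "t \<in> {0..1}" for t using \<open>\<gamma> \<in> ?G\<close> that by (auto simp: path_image_def)
    have "?F (\<gamma> 0) \<le> (SUP t\<in>{0..1}. ?F (\<gamma> t))"
      using BC im by (intro cSUP_upper bdd_aboveI2[where M=C]) auto
    moreover have "B \<le> ?F (\<gamma> 0)" using BC im[of 0] by auto
    ultimately show ?thesis by linarith
  qed
  then have bdd: "bdd_below ((\<lambda>\<gamma>. SUP t\<in>{0..1}. ?F (\<gamma> t)) ` ?G)" by (intro bdd_belowI2[where m=B]) auto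
  obtain \<gamma> where \<gamma>: "path \<gamma>" "path_image \<gamma> \<subseteq> {z\<in>prob_simplex. ?F z \<le> c}" "pathstart \<gamma> = x" "pathfinish \<gamma> = y"
    using assms unfolding path_component_def by blast
  have "(SUP t\<in>{0..1}. ?F (\<gamma> t)) \<le> c" 
  proof (rule cSUP_least)
    fix t :: real assume "t \<in> {0..1}"
    then have "\<gamma> t \<in> path_image \<gamma>" by (simp add: path_image_def)
    with \<gamma>(2) show "?F (\<gamma> t) \<le> c" by blast
  qed simp
  moreover have "\<gamma> \<in> ?G" using \<gamma> by blast
  ultimately show ?thesis unfolding comm_height_def by (intro cINF_lower2[OF bdd]) auto
qed

lemma path_component_segment:
  fixes x y :: "real ^ 'q::finite"
  assumes xy: "x \<in> prob_simplex" "y \<in> prob_simplex" "dist x y < d" and c: "free_energy \<beta> x + e \<le> c"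
    and d: "\<And>x y :: real ^ 'q. x \<in> prob_simplex \<Longrightarrow> y \<in> prob_simplex \<Longrightarrow> dist x y < d \<Longrightarrow> \<bar>free_energy \<beta> x - free_energy \<beta> y\<bar> < e"
  shows "path_component {z\<in>prob_simplex. free_energy \<beta> z \<le> c} x y"
proof -
  have "closed_segment x y \<subseteq> {z\<in>prob_simplex. free_energy \<beta> z \<le> c}"
  proof
    fix z assume z: "z \<in> closed_segment x y"
    have zp: "z \<in> prob_simplex" using closed_segment_subset[OF xy(1,2) convex_prob_simplex] z by blast
    have "dist x z \<le> dist x y" using dist_in_closed_segment[OF z] by (simp add: dist_commute)
    then have "\<bar>free_energy \<beta> x - free_energy \<beta> z\<bar> < e" using xy zp by (intro d) auto
    with zp c show "z \<in> {z\<in>prob_simplex. free_energy \<beta> z \<le> c}" by simp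
  qed
  then show ?thesis unfolding path_component_def
    by (intro exI[of _ "linepath x y"]) auto
qed

lemma dist_move:
  assumes "1 \<le> N" "0 < n a" "a \<noteq> b"
  shows "dist (lattice_point N n) (lattice_point N (move_unit a b n)) \<le> 2 / real N"
proof -
  have "dist (lattice_point N n) (lattice_point N (move_unit a b n)) \<le> (\<Sum>k\<in>UNIV. \<bar>(lattice_point N n - lattice_point N (move_unit a b n)) $ k\<bar>)"
    unfolding dist_norm by (rule norm_le_l1_cart)
  also have "\<dots> \<le> (\<Sum>k\<in>UNIV. (if k = a then 1 / real N else 0) + (if k = b then 1 / real N else 0))"
    using assms by (intro sum_mono) (auto simp: lattice_point_def move_unit_def diff_divide_distrib[symmetric] of_nat_diff)
  also have "\<dots> = 2 / real N" by (simp add: sum.distrib)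
  finally show ?thesis .
qed

text \<open>A lattice path below \<open>c\<close> could be interpolated to a continuous path that stays below the communication
  height, because the moves have length at most \<open>2 / N\<close>.\<close>

lemma barrier:
  fixes a :: "nat \<Rightarrow> 'q::finite option \<Rightarrow> 'q \<Rightarrow> nat"
  assumes c: "c < comm_height \<beta> (min_point \<beta> i) (min_point \<beta> j)"
    and m: "min_point \<beta> i \<in> prob_simplex" "min_point \<beta> j \<in> prob_simplex"
    and a: "\<And>N. 1 \<le> N \<Longrightarrow> a N i \<in> compositions N" "\<And>N. 1 \<le> N \<Longrightarrow> a N j \<in> compositions N"
    and lim: "(\<lambda>N. lattice_point N (a N i)) \<longlonglongrightarrow> min_point \<beta> i" "(\<lambda>N. lattice_point N (a N j)) \<longlonglongrightarrow> min_point \<beta> j"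
  shows "\<forall>\<^sub>F N in sequentially. a N j \<in> sublevel \<beta> N c \<longrightarrow> (a N j, a N i) \<notin> (unit_moves \<inter> sublevel \<beta> N c \<times> sublevel \<beta> N c)\<^sup>*"
proof -
  let ?F = "free_energy \<beta> :: real ^ 'q \<Rightarrow> real"
  let ?m = "min_point \<beta> :: 'q option \<Rightarrow> real ^ 'q"
  define e where "e = (comm_height \<beta> (?m i) (?m j) - c) / 2"
  have e: "0 < e" using c by (simp add: e_def)
  define c' where "c' = c + e"
  have c': "c' < comm_height \<beta> (?m i) (?m j)" using c by (simp add: c'_def e_def field_simps)
  let ?U = "{z\<in>prob_simplex. ?F z \<le> c'}"
  obtain d where d: "0 < d" "\<And>x y :: real ^ 'q. x \<in> prob_simplex \<Longrightarrow> y \<in> prob_simplex \<Longrightarrow> dist x y < d \<Longrightarrow> \<bar>?F x - ?F y\<bar> < e"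
    by (rule free_energy_uniformly[OF e, where \<beta>=\<beta> and 'q='q]) blast
  have "(\<lambda>N. 2 / real N) \<longlonglongrightarrow> 0" by (rule real_tendsto_divide_at_top[OF tendsto_const filterlim_real_sequentially])
  from order_tendstoD(2)[OF this d(1)] tendstoD[OF lim(1) d(1)] tendstoD[OF lim(2) d(1)] eventually_ge_at_top[of 1]
  show ?thesis
  proof eventually_elim
    case (elim N)
    show ?case
    proof (intro impI notI)
      assume aj: "a N j \<in> sublevel \<beta> N c" and p: "(a N j, a N i) \<in> (unit_moves \<inter> sublevel \<beta> N c \<times> sublevel \<beta> N c)\<^sup>*"
      have sp: "lattice_point N n \<in> prob_simplex" if "n \<in> compositions N" for n :: "'q \<Rightarrow> nat" by (rule lattice_point_simplex[OF elim(4) that])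
      from p have "path_component ?U (lattice_point N (a N j)) (lattice_point N (a N i)) \<and> a N i \<in> sublevel \<beta> N c"
      proof (induction rule: rtrancl_induct)
        case base
        have "lattice_point N (a N j) \<in> ?U" using aj e sp by (auto simp: sublevel_def c'_def)
        then show ?case using aj by (simp add: path_component_refl)
      next
        case (step n n')
        then have n: "n \<in> compositions N" "n' \<in> compositions N" "?F (lattice_point N n) \<le> c" by (auto simp: sublevel_def)
        have "dist (lattice_point N n) (lattice_point N n') \<le> 2 / real N"
          using step(2) by (auto simp: unit_moves_def intro!: dist_move[OF elim(4)])
        then have "path_component ?U (lattice_point N n) (lattice_point N n')"
          using elim(1) n by (intro path_component_segment[OF _ _ _ _ d(2)] sp) (auto simp: c'_def)
        then show ?case using step path_component_trans by blast
      qed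
      moreover have "path_component ?U (lattice_point N (a N j)) (?m j)"
        using elim(3) aj a(2)[OF elim(4)] m by (intro path_component_segment[OF _ _ _ _ d(2)] sp) (auto simp: c'_def sublevel_def)
      moreover have "path_component ?U (lattice_point N (a N i)) (?m i)" if "a N i \<in> sublevel \<beta> N c"
        using elim(2) that a(1)[OF elim(4)] m by (intro path_component_segment[OF _ _ _ _ d(2)] sp) (auto simp: c'_def sublevel_def)
      ultimately have "path_component ?U (?m i) (?m j)" by (meson path_component_sym path_component_trans)
      from comm_height_le[OF this] c' show False by simp
    qed
  qed
qed

section \<open>Boltzmann weight of a magnetization level\<close>

definition colour_count :: "nat \<Rightarrow> (nat \<Rightarrow> 'q) \<Rightarrow> 'q \<Rightarrow> nat" where
  "colour_count N \<sigma> k = card {i\<in>{1..N}. \<sigma> i = k}"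

definition level :: "nat \<Rightarrow> ('q::finite \<Rightarrow> nat) \<Rightarrow> (nat \<Rightarrow> 'q) set" where
  "level N n = {\<sigma>\<in>configs N. colour_count N \<sigma> = n}"

lemma finite_configs: "finite (configs N :: (nat \<Rightarrow> 'q::finite) set)"
  unfolding configs_def by (intro finite_PiE) auto

lemma card_configs: "card (configs N :: (nat \<Rightarrow> 'q::finite) set) = CARD('q) ^ N"
  unfolding configs_def by (simp add: card_PiE)

lemma magnetization_eq: "magnetization N \<sigma> = lattice_point N (colour_count N \<sigma>)"
proof -
  have "(\<Sum>i\<in>{1..N}. of_bool (\<sigma> i = k)) = real (colour_count N \<sigma> k)" for k
  proof -
    have "(\<Sum>i\<in>{1..N}. of_bool (\<sigma> i = k)) = (\<Sum>i\<in>{i\<in>{1..N}. \<sigma> i = k}. 1 :: real)"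
      by (rule sum.mono_neutral_cong_right) auto
    then show ?thesis by (simp add: colour_count_def)
  qed
  then show ?thesis by (simp add: magnetization_def lattice_point_def vec_eq_iff)
qed

lemma colour_count_compositions: "colour_count N (\<sigma> :: nat \<Rightarrow> 'q::finite) \<in> compositions N"
proof -
  have "(\<Sum>k\<in>UNIV. card {i\<in>{1..N}. \<sigma> i = k}) = card (\<Union>k\<in>UNIV. {i\<in>{1..N}. \<sigma> i = k})"
    by (rule card_UN_disjoint[symmetric]) auto
  also have "(\<Union>k\<in>UNIV. {i\<in>{1..N}. \<sigma> i = k}) = {1..N}" by auto
  finally show ?thesis by (simp add: compositions_def colour_count_def)
qed

lemma meta_set_eq: "1 \<le> N \<Longrightarrow> meta_set N (lattice_point N n) = level N n"
  by (auto simp: meta_set_def level_def magnetization_eq lattice_point_inj)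

lemma level_disjoint: "n \<noteq> m \<Longrightarrow> level N n \<inter> level N m = {}"
  by (auto simp: level_def)

lemma finite_level: "finite (level N n)"
  using finite_subset[OF _ finite_configs, of "level N n"] by (auto simp: level_def)

lemma configs_levels: "configs N = (\<Union>n\<in>compositions N. level N n)"
  by (auto simp: level_def colour_count_compositions)

text \<open>Read as words of length \<open>N\<close>, the configurations of a level are the arrangements of a multiset.\<close>

lemma card_level:
  fixes n :: "'q::finite \<Rightarrow> nat"
  assumes "n \<in> compositions N"
  shows "real (card (level N n)) = fact N / (\<Prod>k\<in>UNIV. fact (n k))"
proof -
  define A where "A = (\<Sum>k\<in>UNIV. replicate_mset (n k) k)"
  have cA: "count A k = n k" for k
    by (simp add: A_def count_sum)
  have sA: "size A = N" using assms by (simp add: A_def size_multiset_sum compositions_def)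
  have "bij_betw (\<lambda>\<sigma>. map \<sigma> [1..<Suc N]) (level N n) (permutations_of_multiset A)"
  proof (rule bij_betwI[where g="\<lambda>xs i. if i \<in> {1..N} then xs ! (i - 1) else undefined"])
    have cnt: "count (mset (map \<sigma> [1..<Suc N])) k = colour_count N \<sigma> k" for \<sigma> :: "nat \<Rightarrow> 'q" and k
    proof -
      have c: "count (mset xs) k = length (filter ((=) k) xs)" for xs :: "'q list"
        by (induction xs) auto
      have "count (mset (map \<sigma> [1..<Suc N])) k = length (filter (\<lambda>i. k = \<sigma> i) [1..<Suc N])"
        by (simp only: c filter_map length_map comp_def)
      also have "\<dots> = card {i\<in>{1..N}. \<sigma> i = k}"
        by (subst distinct_length_filter) (auto intro!: arg_cong[where f=card])
      finally show ?thesis by (simp add: colour_count_def)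
    qed
    show "(\<lambda>\<sigma>. map \<sigma> [1..<Suc N]) \<in> level N n \<rightarrow> permutations_of_multiset A"
    proof
      fix \<sigma> assume "\<sigma> \<in> level N n"
      then have "count (mset (map \<sigma> [1..<Suc N])) k = count A k" for k
        unfolding cnt cA by (simp add: level_def)
      then have "mset (map \<sigma> [1..<Suc N]) = A" by (rule multiset_eqI)
      then show "map \<sigma> [1..<Suc N] \<in> permutations_of_multiset A" unfolding permutations_of_multiset_def by blast
    qed
    show "(\<lambda>xs i. if i \<in> {1..N} then xs ! (i - 1) else undefined) \<in> permutations_of_multiset A \<rightarrow> level N n"
    proof
      fix xs assume "xs \<in> permutations_of_multiset A"
      then have xs: "mset xs = A" by (simp add: permutations_of_multiset_def)
      then have len: "length xs = N" using sA by (metis size_mset)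
      let ?s = "\<lambda>i. if i \<in> {1..N} then xs ! (i - 1) else undefined"
      have "map ?s [1..<Suc N] = xs" using len by (intro nth_equalityI) (auto simp del: upt_Suc)
      then have "colour_count N ?s k = n k" for k using cnt[of ?s k] cA[of k] xs by simp
      then show "?s \<in> level N n" by (auto simp: level_def configs_def)
    qed
    show "(\<lambda>i. if i \<in> {1..N} then map \<sigma> [1..<Suc N] ! (i - 1) else undefined) = \<sigma>" if "\<sigma> \<in> level N n" for \<sigma>
      using that by (auto simp: fun_eq_iff level_def configs_def PiE_def extensional_def simp del: upt_Suc)
    show "map (\<lambda>i. if i \<in> {1..N} then xs ! (i - 1) else undefined) [1..<Suc N] = xs" if "xs \<in> permutations_of_multiset A" for xs
    proof -
      have "length xs = N" using that sA by (metis permutations_of_multisetD size_mset)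
      then show ?thesis by (intro nth_equalityI) (auto simp del: upt_Suc)
    qed
  qed
  then have "card (level N n) = card (permutations_of_multiset A)" by (rule bij_betw_same_card)
  moreover have "card (permutations_of_multiset A) * (\<Prod>x\<in>set_mset A. fact (count A x)) = fact (size A)"
    by (rule card_permutations_of_multiset_aux)
  moreover have "(\<Prod>x\<in>set_mset A. fact (count A x)) = (\<Prod>k\<in>UNIV. fact (n k) :: nat)"
    by (rule prod.mono_neutral_cong_left) (auto simp: cA[symmetric] not_in_iff)
  ultimately have "card (level N n) * (\<Prod>k\<in>UNIV. fact (n k)) = (fact N :: nat)" using sA by simp
  then have "real (card (level N n) * (\<Prod>k\<in>UNIV. fact (n k))) = real (fact N)" by (simp only:)
  then have "real (card (level N n)) * (\<Prod>k\<in>UNIV. fact (n k)) = fact N"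
    by (simp only: of_nat_mult of_nat_prod of_nat_fact)
  moreover have "(\<Prod>k\<in>UNIV. fact (n k) :: real) \<noteq> 0" by simp
  ultimately show ?thesis by (simp add: field_simps)
qed

text \<open>A weak form of Stirling's formula: errors of logarithmic order are harmless on the exponential scale.\<close>

lemma ln_fact_bounds:
  "real n * ln n - n \<le> ln (fact n)" "ln (fact n) \<le> real n * ln n - n + (1 + 2 * ln (real n + 1))"
proof (induction n)
  case (Suc n)
  have f: "ln (fact (Suc n) :: real) = ln (fact n) + ln (real n + 1)"
    by (simp add: ln_mult add.commute)
  have a: "real n * (ln (real n + 1) - ln (real n)) \<le> 1"
  proof (cases "n = 0")
    case False
    have "1 + 1 / real n = (real n + 1) / real n" using False by (simp add: field_simps)
    then have "ln (real n + 1) - ln (real n) = ln (1 + 1 / real n)" using False by (simp add: ln_div)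
    also have "\<dots> \<le> 1 / real n" by (rule ln_add_one_self_le_self) simp
    finally show ?thesis using False by (simp add: field_simps)
  qed simp
  have b: "1 \<le> real n * (ln (real n + 1) - ln (real n)) + 2 * (ln (real n + 2) - ln (real n + 1)) \<or> n = 0"
  proof (cases "n = 0")
    case False
    have l: "1 / (x + 1) \<le> ln (x + 1) - ln x" if "0 < x" for x :: real
    proof -
      have "ln x - ln (x + 1) = ln (x / (x + 1))" using that by (simp add: ln_div)
      also have "\<dots> \<le> x / (x + 1) - 1" using that by (intro ln_le_minus_one) simp
      also have "\<dots> = - (1 / (x + 1))" using that by (simp add: field_simps)
      finally show ?thesis by simp
    qed
    have "1 / (real n + 1) \<le> ln (real n + 1) - ln (real n)" using l[of "real n"] False by simp
    from mult_left_mono[OF this, of "real n"]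
    have "real n / (real n + 1) \<le> real n * (ln (real n + 1) - ln (real n))" by simp
    moreover have "1 / (real n + 2) \<le> ln (real n + 2) - ln (real n + 1)"
      using l[of "real n + 1"] by (simp add: add.commute)
    moreover have "1 \<le> real n / (real n + 1) + 2 * (1 / (real n + 2))" by (simp add: divide_simps) (simp add: algebra_simps)
    moreover have "1 \<le> X + 2 * Y" if "x \<le> X" "y \<le> Y" "1 \<le> x + 2 * y" for x y X Y :: real using that by linarith
    ultimately show ?thesis by blast
  qed simp
  { case 1 show ?case using Suc.IH(1) a f by (simp add: algebra_simps) 
  next
    case 2 show ?case
    proof (cases "n = 0")
      case True then show ?thesis by simp
    next
      case False then show ?thesis using Suc.IH(2) b f by (simp add: algebra_simps)
    qed }
qed simp_all

text \<open>The exponent is \<open>- \<beta>\<close> times the energy for unit couplings, which by \<open>hamiltonian_one\<close> is constant on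
  the level.\<close>

definition level_mass :: "real \<Rightarrow> nat \<Rightarrow> ('q::finite \<Rightarrow> nat) \<Rightarrow> real" where
  "level_mass \<beta> N n = real (card (level N n)) * exp (\<beta> * (real N / 2 * (norm (lattice_point N n))\<^sup>2 - 1 / 2))"

lemma hamiltonian_one:
  assumes "1 \<le> N" "\<sigma> \<in> level N n"
  shows "hamiltonian (\<lambda>_ _. 1) N \<sigma> = 1 / 2 - real N / 2 * (norm (lattice_point N n))\<^sup>2"
proof -
  let ?P = "{(i, j). 1 \<le> i \<and> i < j \<and> j \<le> N}" and ?Q = "{(i, j). 1 \<le> j \<and> j < i \<and> i \<le> N}"
  let ?b = "\<lambda>(i, j). of_bool (\<sigma> i = \<sigma> j) :: real"
  have fin: "finite ?P" "finite ?Q"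
    by (rule finite_subset[of _ "{1..N} \<times> {1..N}"]; auto)+
  have n: "card {i\<in>{1..N}. \<sigma> i = k} = n k" for k
    using assms(2) by (auto simp: level_def colour_count_def fun_eq_iff)
  have QP: "(\<Sum>x\<in>?Q. ?b x) = (\<Sum>x\<in>?P. ?b x)"
    by (rule sum.reindex_bij_witness[of _ prod.swap prod.swap]) auto
  have D: "(\<Sum>x\<in>(\<lambda>i. (i, i)) ` {1..N}. ?b x) = real N"
    by (subst sum.reindex) (auto simp: inj_on_def)
  \<comment> \<open>The ordered pairs of equally coloured sites are those in \<open>?P\<close>, their mirror images and the diagonal; counted colour by colour they number the sum of the squares of \<open>n k\<close>.\<close>
  have "{1..N} \<times> {1..N} = (?P \<union> ?Q) \<union> (\<lambda>i. (i, i)) ` {1..N}" by auto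
  then have "(\<Sum>x\<in>{1..N} \<times> {1..N}. ?b x) = (\<Sum>x\<in>(?P \<union> ?Q) \<union> (\<lambda>i. (i, i)) ` {1..N}. ?b x)" by simp
  also have "\<dots> = (\<Sum>x\<in>?P \<union> ?Q. ?b x) + real N"
    unfolding D[symmetric] by (rule sum.union_disjoint) (use fin in auto)
  also have "(\<Sum>x\<in>?P \<union> ?Q. ?b x) = (\<Sum>x\<in>?P. ?b x) + (\<Sum>x\<in>?Q. ?b x)"
    by (rule sum.union_disjoint) (use fin in auto)
  finally have tot: "(\<Sum>x\<in>{1..N} \<times> {1..N}. ?b x) = 2 * (\<Sum>x\<in>?P. ?b x) + real N" using QP by simp
  have "(\<Sum>x\<in>{1..N} \<times> {1..N}. ?b x) = (\<Sum>i\<in>{1..N}. \<Sum>j\<in>{1..N}. of_bool (\<sigma> i = \<sigma> j))"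
    by (rule sum.cartesian_product[symmetric])
  also have "\<dots> = (\<Sum>i\<in>{1..N}. real (n (\<sigma> i)))"
  proof (rule sum.cong)
    fix i
    have "(\<Sum>j\<in>{1..N}. of_bool (\<sigma> i = \<sigma> j)) = (\<Sum>j\<in>{j\<in>{1..N}. \<sigma> j = \<sigma> i}. 1 :: real)"
      by (rule sum.mono_neutral_cong_right) auto
    also have "\<dots> = real (card {j\<in>{1..N}. \<sigma> j = \<sigma> i})" by simp
    finally show "(\<Sum>j\<in>{1..N}. of_bool (\<sigma> i = \<sigma> j)) = real (n (\<sigma> i))" by (simp only: n)
  qed simp
  also have "\<dots> = (\<Sum>k\<in>UNIV. \<Sum>i\<in>{i\<in>{1..N}. \<sigma> i = k}. real (n (\<sigma> i)))"
    by (rule sum.group[symmetric]) auto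
  also have "\<dots> = (\<Sum>k\<in>UNIV. (real (n k))\<^sup>2)"
  proof (rule sum.cong)
    fix k
    have "(\<Sum>i\<in>{i\<in>{1..N}. \<sigma> i = k}. real (n (\<sigma> i))) = (\<Sum>i\<in>{i\<in>{1..N}. \<sigma> i = k}. real (n k))"
      by (rule sum.cong) auto
    also have "\<dots> = real (card {i\<in>{1..N}. \<sigma> i = k}) * real (n k)" by simp
    finally show "(\<Sum>i\<in>{i\<in>{1..N}. \<sigma> i = k}. real (n (\<sigma> i))) = (real (n k))\<^sup>2"
      by (simp only: n power2_eq_square)
  qed simp
  also have "\<dots> = (real N)\<^sup>2 * (norm (lattice_point N n))\<^sup>2"
    using assms(1) unfolding power2_norm_eq_inner inner_vec_def
    by (simp add: lattice_point_def sum_distrib_left power2_eq_square)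
  finally have "2 * (\<Sum>x\<in>?P. ?b x) = (real N)\<^sup>2 * (norm (lattice_point N n))\<^sup>2 - real N" using tot by simp
  then have P: "(\<Sum>x\<in>?P. ?b x) = ((real N)\<^sup>2 * (norm (lattice_point N n))\<^sup>2 - real N) / 2" by simp
  have "hamiltonian (\<lambda>_ _. 1) N \<sigma> = - (1 / real N) * (\<Sum>x\<in>?P. ?b x)"
    unfolding hamiltonian_def by (simp add: case_prod_beta)
  also have "\<dots> = - (1 / real N) * (real N * (real N * (norm (lattice_point N n))\<^sup>2 - 1) / 2)"
    unfolding P by (simp only: power2_eq_square right_diff_distrib mult.assoc mult_1_right)
  also have "\<dots> = 1 / 2 - real N / 2 * (norm (lattice_point N n))\<^sup>2" using assms(1) by (simp add: diff_divide_distrib)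
  finally show ?thesis .
qed

lemma level_nonempty:
  assumes "n \<in> compositions N" shows "0 < card (level N n)"
proof -
  have "0 < real (card (level N n))" unfolding card_level[OF assms] by (intro divide_pos_pos prod_pos) auto
  then show ?thesis by simp
qed

lemma level_mass_bounds:
  fixes n :: "'q::finite \<Rightarrow> nat"
  assumes N: "1 \<le> N" and n: "n \<in> compositions N" and \<beta>: "0 < \<beta>"
  shows "\<bar>ln (level_mass \<beta> N n) + \<beta> * real N * free_energy \<beta> (lattice_point N n)\<bar> \<le> \<beta> + real CARD('q) * (1 + 2 * ln (real N + 1))"
proof -
  define th where "th m = ln (fact m :: real) - (real m * ln (real m) - real m)" for m :: nat
  have th: "0 \<le> th m" "th m \<le> 1 + 2 * ln (real m + 1)" for m
    unfolding th_def using ln_fact_bounds[of m] by (simp_all add: algebra_simps)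
  have th': "th (n k) \<le> 1 + 2 * ln (real N + 1)" for k
    using th(2)[of "n k"] compositions_le[OF n, of k] by (smt (verit) ln_le_cancel_iff of_nat_0_le_iff of_nat_mono)
  have lc: "ln (real (card (level N n))) = ln (fact N) - (\<Sum>k\<in>UNIV. ln (fact (n k)))"
    unfolding card_level[OF n] by (simp add: ln_div prod_pos ln_prod)
  have sN: "(\<Sum>k\<in>UNIV. real (n k)) = real N" using n by (simp add: compositions_def flip: of_nat_sum)
  have "(\<Sum>k\<in>UNIV. ln (fact (n k))) = (\<Sum>k\<in>UNIV. th (n k)) + (\<Sum>k\<in>UNIV. real (n k) * ln (real (n k))) - real N"
    unfolding th_def sum.distrib[symmetric] sN[symmetric] sum_subtractf[symmetric] by (rule sum.cong) auto
  moreover have "ln (fact N) = th N + real N * ln (real N) - real N" by (simp add: th_def)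
  ultimately have lc': "ln (real (card (level N n))) = th N - (\<Sum>k\<in>UNIV. th (n k)) + real N * ln (real N) - (\<Sum>k\<in>UNIV. real (n k) * ln (real (n k)))"
    using lc by simp
  have "real N * (\<Sum>k\<in>UNIV. lattice_point N n $ k * ln (lattice_point N n $ k)) = (\<Sum>k\<in>UNIV. real (n k) * ln (real (n k)) - real (n k) * ln (real N))"
    unfolding sum_distrib_left
  proof (rule sum.cong)
    fix k
    show "real N * (lattice_point N n $ k * ln (lattice_point N n $ k)) = real (n k) * ln (real (n k)) - real (n k) * ln (real N)"
      using N by (cases "n k = 0") (simp_all add: lattice_point_def ln_div algebra_simps)
  qed simp
  also have "\<dots> = (\<Sum>k\<in>UNIV. real (n k) * ln (real (n k))) - real N * ln (real N)"
    by (simp add: sum_subtractf sum_distrib_right[symmetric] sN)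
  finally have ent: "real N * (\<Sum>k\<in>UNIV. lattice_point N n $ k * ln (lattice_point N n $ k)) = (\<Sum>k\<in>UNIV. real (n k) * ln (real (n k))) - real N * ln (real N)" .
  have "\<beta> * real N * free_energy \<beta> (lattice_point N n) = - (\<beta> * (real N / 2 * (norm (lattice_point N n))\<^sup>2)) + real N * (\<Sum>k\<in>UNIV. lattice_point N n $ k * ln (lattice_point N n $ k))"
    using \<beta> by (simp add: free_energy_def algebra_simps)
  moreover have "ln (level_mass \<beta> N n) = ln (real (card (level N n))) + \<beta> * (real N / 2 * (norm (lattice_point N n))\<^sup>2 - 1 / 2)"
    unfolding level_mass_def using level_nonempty[OF n] by (simp add: ln_mult)
  ultimately have eq: "ln (level_mass \<beta> N n) + \<beta> * real N * free_energy \<beta> (lattice_point N n) = th N - (\<Sum>k\<in>UNIV. th (n k)) - \<beta> / 2"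
    using ent lc' by (simp add: algebra_simps)
  have "(\<Sum>k\<in>UNIV. th (n k)) \<le> (\<Sum>k\<in>(UNIV :: 'q set). 1 + 2 * ln (real N + 1))" by (rule sum_mono) (rule th')
  then have s1: "(\<Sum>k\<in>UNIV. th (n k)) \<le> real CARD('q) * (1 + 2 * ln (real N + 1))" by simp
  have s0: "0 \<le> (\<Sum>k\<in>UNIV. th (n k))" by (intro sum_nonneg th)
  have "1 * (1 + 2 * ln (real N + 1)) \<le> real CARD('q) * (1 + 2 * ln (real N + 1))"
    by (rule mult_right_mono) (auto simp: Suc_leI)
  then have s2: "th N \<le> real CARD('q) * (1 + 2 * ln (real N + 1))" using th(2)[of N] by simp
  show ?thesis unfolding eq using s0 s1 s2 th(1)[of N] \<beta> by (simp only: abs_le_iff) linarith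
qed

text \<open>Energy and entropy combine to the free energy, uniformly over the levels.\<close>

lemma eventually_level_mass:
  assumes \<beta>: "0 < \<beta>" and e: "0 < e"
  shows "\<forall>\<^sub>F N in sequentially. \<forall>n\<in>(compositions N :: ('q::finite \<Rightarrow> nat) set).
    exp (- real N * (\<beta> * free_energy \<beta> (lattice_point N n) + e)) \<le> level_mass \<beta> N n \<and> level_mass \<beta> N n \<le> exp (- real N * (\<beta> * free_energy \<beta> (lattice_point N n) - e))"
proof -
  define Q where "Q = real CARD('q)"
  have "((\<lambda>x. (\<beta> + Q * (1 + 2 * ln (x + 1))) / x) \<longlongrightarrow> 0) at_top" by real_asymp
  from filterlim_compose[OF this filterlim_real_sequentially]
  have "(\<lambda>N. (\<beta> + Q * (1 + 2 * ln (real N + 1))) / real N) \<longlonglongrightarrow> 0" .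
  from order_tendstoD(2)[OF this e] eventually_ge_at_top[of 1] show ?thesis
  proof eventually_elim
    case (elim N)
    show ?case
    proof
      fix n :: "'q \<Rightarrow> nat" assume n: "n \<in> compositions N"
      have "\<beta> + Q * (1 + 2 * ln (real N + 1)) < e * real N" using elim by (simp add: divide_simps split: if_splits)
      then have b: "\<bar>ln (level_mass \<beta> N n) + \<beta> * real N * free_energy \<beta> (lattice_point N n)\<bar> < e * real N"
        using level_mass_bounds[OF elim(2) n \<beta>] by (simp add: Q_def)
      have p: "0 < level_mass \<beta> N n" unfolding level_mass_def using level_nonempty[OF n] by simp
      have "- real N * (\<beta> * free_energy \<beta> (lattice_point N n) + e) \<le> ln (level_mass \<beta> N n)" "ln (level_mass \<beta> N n) \<le> - real N * (\<beta> * free_energy \<beta> (lattice_point N n) - e)"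
        using b by (simp_all add: algebra_simps abs_less_iff)
      then show "exp (- real N * (\<beta> * free_energy \<beta> (lattice_point N n) + e)) \<le> level_mass \<beta> N n \<and> level_mass \<beta> N n \<le> exp (- real N * (\<beta> * free_energy \<beta> (lattice_point N n) - e))"
        using p by (simp add: ln_ge_iff) (metis exp_le_cancel_iff exp_ln)
    qed
  qed
qed

section \<open>Hitting probabilities as capacities\<close>

lemma nn_integral_markov_law_restrict:
  assumes f: "f \<in> borel_measurable (PiM {0..<n} (\<lambda>_. count_space UNIV))"
  shows "(\<integral>\<^sup>+w. f (restrict w {0..<n}) \<partial>markov_law \<nu> K) =
    (\<integral>\<^sup>+w. f w \<partial>markov.C \<nu> K 0 n (\<lambda>_. undefined))"
proof -
  have up: "markov.up_to {0..<n} = n"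
    using markov.up_to_iff_Ico[of "{0..<n}"] by (metis atLeastLessThan_empty_iff2 atLeastLessThan_subset_iff finite_atLeastLessThan le_antisym le_refl nle_le subset_refl zero_le)
  have x0: "(\<lambda>_. undefined) \<in> space (PiM {0..<0} (\<lambda>_::nat. count_space UNIV))"
    by (simp add: space_PiM)
  have r: "(\<lambda>w. restrict w {0..<n}) \<in> markov_law \<nu> K \<rightarrow>\<^sub>M PiM {0..<n} (\<lambda>_. count_space UNIV)"
    unfolding markov_law_def by (subst measurable_cong_sets[OF markov.PF.sets_lim refl]) simp
  have r2: "(\<lambda>w. restrict w {0..<n}) \<in> markov.C \<nu> K 0 n (\<lambda>_. undefined) \<rightarrow>\<^sub>M PiM {0..<n} (\<lambda>_. count_space UNIV)"
    by (subst measurable_cong_sets[OF markov.sets_C[OF x0] refl]) simp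
  have "(\<integral>\<^sup>+w. f (restrict w {0..<n}) \<partial>markov_law \<nu> K)
     = (\<integral>\<^sup>+w. f w \<partial>distr (markov_law \<nu> K) (PiM {0..<n} (\<lambda>_. count_space UNIV)) (\<lambda>w. restrict w {0..<n}))"
    by (rule nn_integral_distr[OF r, symmetric]) (simp add: f)
  also have "\<dots> = (\<integral>\<^sup>+w. f w \<partial>markov.CI \<nu> K {0..<n})"
    unfolding markov_law_def by (subst markov.distr_lim) auto
  also have "\<dots> = (\<integral>\<^sup>+w. f (restrict w {0..<n}) \<partial>markov.C \<nu> K 0 n (\<lambda>_. undefined))"
    unfolding markov.CI_def up by (rule nn_integral_distr[OF r2]) (simp add: f)
  also have "\<dots> = (\<integral>\<^sup>+w. f w \<partial>markov.C \<nu> K 0 n (\<lambda>_. undefined))"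
    by (rule nn_integral_cong) (simp add: markov.space_C[OF x0] space_PiM PiE_iff extensional_restrict)
  finally show ?thesis .
qed

text \<open>The Markov property at time \<open>n\<close>, on which every computation with the path measure rests.\<close>

lemma nn_integral_markov_law_Suc:
  assumes f: "f \<in> borel_measurable (PiM {0..<n} (\<lambda>_. count_space UNIV))"
  shows "(\<integral>\<^sup>+w. f (restrict w {0..<n}) * u (w n) \<partial>markov_law \<nu> K) =
    (\<integral>\<^sup>+w. f (restrict w {0..<n}) * (\<integral>\<^sup>+y. u y \<partial>measure_pmf (if n = 0 then \<nu> else K (w (n - 1)))) \<partial>markov_law \<nu> K)"
proof -
  let ?M = "\<lambda>n. PiM {0..<n} (\<lambda>_::nat. count_space UNIV)"
  have x0: "(\<lambda>_. undefined) \<in> space (?M 0)"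
    by (simp add: space_PiM)
  let ?C = "\<lambda>n. markov.C \<nu> K 0 n (\<lambda>_. undefined)"
  define g where "g w = f (restrict w {0..<n}) * u (w n)" for w
  have res: "(\<lambda>w. restrict w {0..<n}) \<in> ?M (Suc n) \<rightarrow>\<^sub>M ?M n"
    by (rule measurable_restrict_subset) auto
  have cmp: "(\<lambda>w. w n) \<in> ?M (Suc n) \<rightarrow>\<^sub>M count_space UNIV"
    by (rule measurable_component_singleton) simp
  have u: "u \<in> borel_measurable (count_space UNIV)" by simp
  have g: "g \<in> borel_measurable (?M (Suc n))"
    unfolding g_def
    using measurable_compose[OF res f] measurable_compose[OF cmp u] by simp
  define h where "h w = f w * (\<integral>\<^sup>+y. u y \<partial>measure_pmf (if n = 0 then \<nu> else K (w (n - 1))))" for w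
  have h: "h \<in> borel_measurable (?M n)"
  proof (cases "n = 0")
    case False
    then have c: "(\<lambda>w. w (n - 1)) \<in> ?M n \<rightarrow>\<^sub>M count_space UNIV"
      by (intro measurable_component_singleton) auto
    have k: "(\<lambda>s. \<integral>\<^sup>+y. u y \<partial>measure_pmf (K s)) \<in> borel_measurable (count_space UNIV)" by simp
    show ?thesis unfolding h_def using False f measurable_compose[OF c k] by simp
  qed (use f in \<open>simp add: h_def[abs_def]\<close>)
  have "(\<integral>\<^sup>+w. f (restrict w {0..<n}) * u (w n) \<partial>markov_law \<nu> K) = (\<integral>\<^sup>+w. g (restrict w {0..<Suc n}) \<partial>markov_law \<nu> K)"
    by (rule nn_integral_cong) (simp add: g_def Int_absorb1 Int_absorb2 del: restrict_apply, simp)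
  also have "\<dots> = (\<integral>\<^sup>+w. g w \<partial>?C (Suc n))" by (rule nn_integral_markov_law_restrict[OF g])
  also have "\<dots> = (\<integral>\<^sup>+w. \<integral>\<^sup>+v. g v \<partial>markov.eP \<nu> K n w \<partial>?C n)"
  proof -
    have m: "markov.eP \<nu> K n \<in> ?C n \<rightarrow>\<^sub>M subprob_algebra (?M (Suc n))"
      by (subst measurable_cong_sets[OF markov.sets_C[OF x0] refl]) (simp add: markov.measurable_eP)
    show ?thesis by (simp only: markov.C.simps(2) add_0) (rule nn_integral_bind[OF g m])
  qed
  also have "\<dots> = (\<integral>\<^sup>+w. h w \<partial>?C n)"
  proof (rule nn_integral_cong)
    fix w assume "w \<in> space (?C n)"
    then have w: "w \<in> space (?M n)" by (simp add: markov.space_C[OF x0])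
    have e: "restrict (w(n := x)) {0..<n} = w" for x
      using w by (auto simp: space_PiM PiE_iff extensional_def)
    have "(\<integral>\<^sup>+v. g v \<partial>markov.eP \<nu> K n w) = (\<integral>\<^sup>+x. g (w(n := x)) \<partial>markov_step \<nu> K n w)"
      by (rule markov.nn_integral_eP[OF w g])
    also have "\<dots> = h w"
      unfolding g_def h_def e markov_step_def by (simp add: nn_integral_cmult)
    finally show "(\<integral>\<^sup>+v. g v \<partial>markov.eP \<nu> K n w) = h w" .
  qed
  also have "\<dots> = (\<integral>\<^sup>+w. h (restrict w {0..<n}) \<partial>markov_law \<nu> K)"
    by (rule nn_integral_markov_law_restrict[OF h, symmetric])
  also have "\<dots> = (\<integral>\<^sup>+w. f (restrict w {0..<n}) * (\<integral>\<^sup>+y. u y \<partial>measure_pmf (if n = 0 then \<nu> else K (w (n - 1)))) \<partial>markov_law \<nu> K)"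
    by (rule nn_integral_cong) (auto simp: h_def)
  finally show ?thesis .
qed

definition transition_op :: "('s \<Rightarrow> 's pmf) \<Rightarrow> ('s \<Rightarrow> ennreal) \<Rightarrow> 's \<Rightarrow> ennreal" where
  "transition_op K u s = (\<integral>\<^sup>+y. u y \<partial>measure_pmf (K s))"

text \<open>The transition operator of the chain killed outside \<open>D\<close>.\<close>

definition killed_op :: "('s \<Rightarrow> 's pmf) \<Rightarrow> 's set \<Rightarrow> ('s \<Rightarrow> ennreal) \<Rightarrow> 's \<Rightarrow> ennreal" where
  "killed_op K D u s = indicator D s * transition_op K u s"

lemma nn_integral_first_passage:
  "(\<integral>\<^sup>+w. (\<Prod>t\<in>{1..m}. indicator D (w t)) * u (w (Suc m)) \<partial>markov_law \<nu> K) =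
   (\<integral>\<^sup>+s. transition_op K ((killed_op K D ^^ m) u) s \<partial>measure_pmf \<nu>)"
proof (induction m arbitrary: u)
  case 0
  have one: "emeasure (markov_law \<nu> K) (space (markov_law \<nu> K)) = 1"
    using nn_integral_markov_law_restrict[where f="\<lambda>_. 1" and n=0 and \<nu>=\<nu> and K=K] by (simp add: space_PiM PiM_empty)
  have "(\<integral>\<^sup>+w. u (w (Suc 0)) \<partial>markov_law \<nu> K) = (\<integral>\<^sup>+w. transition_op K u (w 0) \<partial>markov_law \<nu> K)"
    using nn_integral_markov_law_Suc[where f="\<lambda>_. 1" and n="Suc 0" and u=u and \<nu>=\<nu> and K=K] by (simp add: transition_op_def)
  also have "\<dots> = (\<integral>\<^sup>+s. transition_op K u s \<partial>measure_pmf \<nu>)"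
    using nn_integral_markov_law_Suc[where f="\<lambda>_. 1" and n=0 and u="transition_op K u" and \<nu>=\<nu> and K=K] one by simp
  finally show ?case by simp
next
  case (Suc m)
  define f where "f w = (\<Prod>t\<in>{1..Suc m}. indicator D (w t) :: ennreal)" for w :: "nat \<Rightarrow> 'a"
  have f: "f \<in> borel_measurable (PiM {0..<Suc (Suc m)} (\<lambda>_. count_space UNIV))"
    unfolding f_def
  proof (rule borel_measurable_prod_ennreal)
    fix t assume "t \<in> {1..Suc m}"
    then have "(\<lambda>w. w t) \<in> PiM {0..<Suc (Suc m)} (\<lambda>_. count_space UNIV) \<rightarrow>\<^sub>M count_space UNIV"
      by (intro measurable_component_singleton) auto
    from measurable_compose[OF this, of "indicator D" borel]
    show "(\<lambda>w. indicator D (w t) :: ennreal) \<in> borel_measurable (PiM {0..<Suc (Suc m)} (\<lambda>_. count_space UNIV))" by simp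
  qed
  have fr: "f (restrict w {0..<Suc (Suc m)}) = f w" for w
    unfolding f_def by (rule prod.cong) auto
  have "(\<integral>\<^sup>+w. f w * u (w (Suc (Suc m))) \<partial>markov_law \<nu> K) = (\<integral>\<^sup>+w. f w * transition_op K u (w (Suc m)) \<partial>markov_law \<nu> K)"
    using nn_integral_markov_law_Suc[OF f, where u=u and \<nu>=\<nu> and K=K] unfolding fr by (simp add: transition_op_def)
  also have "\<dots> = (\<integral>\<^sup>+w. (\<Prod>t\<in>{1..m}. indicator D (w t)) * killed_op K D u (w (Suc m)) \<partial>markov_law \<nu> K)"
    unfolding f_def killed_op_def by (rule nn_integral_cong) (simp add: mult.assoc)
  also have "\<dots> = (\<integral>\<^sup>+s. transition_op K ((killed_op K D ^^ Suc m) u) s \<partial>measure_pmf \<nu>)"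
    unfolding Suc.IH by (simp add: funpow_swap1)
  finally show ?case unfolding f_def .
qed


lemma hitting_less_iff:
  assumes "A \<inter> B = {}"
  shows "hitting B w < hitting A w \<longleftrightarrow> (\<exists>m. w (Suc m) \<in> B \<and> (\<forall>t\<in>{1..m}. w t \<notin> A \<union> B))"
proof
  assume "hitting B w < hitting A w"
  then obtain t where t: "0 < t" "w t \<in> B" "enat t < hitting A w"
    unfolding hitting_def[of B] by (auto simp: Inf_less_iff)
  define P where "P m \<longleftrightarrow> w (Suc m) \<in> B" for m
  have "P (t - 1)" using t by (simp add: P_def)
  then have P: "P (LEAST m. P m)" and le: "(LEAST m. P m) \<le> t - 1" by (rule LeastI, rule Least_le)
  let ?m = "LEAST m. P m"
  have "w s \<notin> A \<union> B" if s: "s \<in> {1..?m}" for s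
  proof
    assume "w s \<in> A \<union> B"
    then consider "w s \<in> A" | "P (s - 1)" using s by (auto simp: P_def)
    then show False
    proof cases
      case 1
      then have "hitting A w \<le> enat s" unfolding hitting_def using s by (intro Inf_lower) auto
      moreover have "enat s < enat t" using s le t(1) by auto
      ultimately show False using t(3) by (meson less_trans not_less)
    next
      case 2
      have "s - 1 < ?m" using s by auto
      from not_less_Least[OF this] 2 show False by contradiction
    qed
  qed
  with P show "\<exists>m. w (Suc m) \<in> B \<and> (\<forall>t\<in>{1..m}. w t \<notin> A \<union> B)" unfolding P_def by blast
next
  assume "\<exists>m. w (Suc m) \<in> B \<and> (\<forall>t\<in>{1..m}. w t \<notin> A \<union> B)"
  then obtain m where m: "w (Suc m) \<in> B" "\<And>t. t \<in> {1..m} \<Longrightarrow> w t \<notin> A \<union> B" by blast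
  have "hitting B w \<le> enat (Suc m)" unfolding hitting_def using m by (intro Inf_lower) auto
  also have "\<dots> < enat (Suc (Suc m))" by simp
  also have "\<dots> \<le> hitting A w"
    unfolding hitting_def
  proof (rule Inf_greatest)
    fix x assume "x \<in> {enat t |t. 0 < t \<and> w t \<in> A}"
    then obtain t where t: "x = enat t" "0 < t" "w t \<in> A" by auto
    have "t \<notin> {1..m}" using m(2)[of t] t by auto
    moreover have "t \<noteq> Suc m" using t m assms by auto
    ultimately show "enat (Suc (Suc m)) \<le> x" using t by auto
  qed
  finally show "hitting B w < hitting A w" .
qed

text \<open>The probability of visiting \<open>B\<close> before \<open>A\<close>, time 0 included, as a sum over the time of that visit.\<close>

definition exit_prob :: "('s \<Rightarrow> 's pmf) \<Rightarrow> 's set \<Rightarrow> 's set \<Rightarrow> 's \<Rightarrow> ennreal" where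
  "exit_prob K A B s = (\<Sum>m. (killed_op K (- (A \<union> B)) ^^ m) (indicator B) s)"

lemma transition_op_suminf: "transition_op K (\<lambda>s. \<Sum>m. u m s) s = (\<Sum>m. transition_op K (u m) s)"
  unfolding transition_op_def by (rule nn_integral_suminf) simp

lemma exit_prob_step:
  "exit_prob K A B s = indicator B s + indicator (- (A \<union> B)) s * transition_op K (exit_prob K A B) s"
proof -
  let ?k = "killed_op K (- (A \<union> B))"
  have "exit_prob K A B s = (\<Sum>m. (?k ^^ (m + 1)) (indicator B) s) + (\<Sum>m<1. (?k ^^ m) (indicator B) s)"
    unfolding exit_prob_def by (rule suminf_offset) (rule summableI)
  also have "(\<Sum>m. (?k ^^ (m + 1)) (indicator B) s) = (\<Sum>m. indicator (- (A \<union> B)) s * transition_op K ((?k ^^ m) (indicator B)) s)"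
    by (simp add: killed_op_def)
  also have "\<dots> = indicator (- (A \<union> B)) s * (\<Sum>m. transition_op K ((?k ^^ m) (indicator B)) s)"
    by (rule ennreal_suminf_cmult)
  also have "(\<Sum>m. transition_op K ((?k ^^ m) (indicator B)) s) = transition_op K (exit_prob K A B) s"
    unfolding exit_prob_def[abs_def] by (rule transition_op_suminf[symmetric])
  finally show ?thesis by (simp add: add.commute)
qed

lemma exit_prob_le_1: "exit_prob K A B s \<le> 1"
proof -
  let ?k = "killed_op K (- (A \<union> B))"
  have "(\<Sum>m<n. (?k ^^ m) (indicator B) s) \<le> 1" for n
  proof (induction n arbitrary: s)
    case (Suc n)
    have "(\<Sum>m<Suc n. (?k ^^ m) (indicator B) s) = indicator B s + (\<Sum>m<n. (?k ^^ Suc m) (indicator B) s)"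
      by (subst sum.lessThan_Suc_shift) simp
    also have "(\<Sum>m<n. (?k ^^ Suc m) (indicator B) s) = indicator (- (A \<union> B)) s * (\<Sum>m<n. transition_op K ((?k ^^ m) (indicator B)) s)"
      by (simp add: killed_op_def sum_distrib_left)
    also have "(\<Sum>m<n. transition_op K ((?k ^^ m) (indicator B)) s) = (\<integral>\<^sup>+y. (\<Sum>m<n. (?k ^^ m) (indicator B) y) \<partial>measure_pmf (K s))"
      unfolding transition_op_def by (rule nn_integral_sum[symmetric]) simp
    also have "\<dots> \<le> (\<integral>\<^sup>+y. 1 \<partial>measure_pmf (K s))"
      by (rule nn_integral_mono) (rule Suc.IH)
    also have "\<dots> = 1" by simp
    finally have "(\<Sum>m<Suc n. (?k ^^ m) (indicator B) s) \<le> indicator B s + indicator (- (A \<union> B)) s * 1"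
      by (simp add: mult_left_mono add_left_mono del: Compl_Un)
    also have "\<dots> \<le> 1" by (auto split: split_indicator)
    finally show ?case .
  qed simp
  then show ?thesis unfolding exit_prob_def by (intro suminf_le_const summableI)
qed

text \<open>The event is decomposed according to the time of the first visit to \<open>B\<close>.\<close>

lemma emeasure_hits_before:
  assumes "A \<inter> B = {}"
  shows "emeasure (markov_law \<nu> K) {w. hitting B w < hitting A w} = (\<integral>\<^sup>+s. transition_op K (exit_prob K A B) s \<partial>measure_pmf \<nu>)"
proof -
  let ?D = "- (A \<union> B)"
  let ?f = "\<lambda>m w. (\<Prod>t\<in>{1..m}. indicator ?D (w t)) * indicator B (w (Suc m)) :: ennreal"
  let ?E = "{w. hitting B w < hitting A w}"
  have sets: "sets (markov_law \<nu> K) = sets (PiM UNIV (\<lambda>_. count_space UNIV))"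
    unfolding markov_law_def by simp
  have cmp: "(\<lambda>w. indicator X (w n) :: ennreal) \<in> borel_measurable (markov_law \<nu> K)" for X :: "'a set" and n :: nat
  proof (subst measurable_cong_sets[OF sets refl])
    have "(\<lambda>w. w n) \<in> PiM UNIV (\<lambda>_::nat. count_space (UNIV :: 'a set)) \<rightarrow>\<^sub>M count_space UNIV"
      by (rule measurable_component_singleton) simp
    from measurable_compose[OF this, of "indicator X" borel]
    show "(\<lambda>w. indicator X (w n) :: ennreal) \<in> borel_measurable (PiM UNIV (\<lambda>_. count_space UNIV))" by simp
  qed
  have fm: "?f m \<in> borel_measurable (markov_law \<nu> K)" for m
    using cmp by (intro borel_measurable_times_ennreal borel_measurable_prod_ennreal) auto
  have f01: "?f m w = (if w (Suc m) \<in> B \<and> (\<forall>t\<in>{1..m}. w t \<notin> A \<union> B) then 1 else 0)" for m w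
  proof (cases "\<forall>t\<in>{1..m}. w t \<notin> A \<union> B")
    case True
    then have "(\<Prod>t\<in>{1..m}. indicator ?D (w t)) = (1::ennreal)" by (intro prod.neutral) auto
    with True show ?thesis by (auto split: split_indicator)
  next
    case False
    then obtain t where "t \<in> {1..m}" "indicator ?D (w t) = (0::ennreal)" by auto
    then have "(\<Prod>t\<in>{1..m}. indicator ?D (w t)) = (0::ennreal)" by (intro prod_zero) auto
    with False show ?thesis by auto
  qed
  have ind: "indicator ?E w = (\<Sum>m. ?f m w)" for w
  proof (cases "w \<in> ?E")
    case True
    then obtain m where m: "w (Suc m) \<in> B" "\<forall>t\<in>{1..m}. w t \<notin> A \<union> B"
      using hitting_less_iff[OF assms] by auto
    have "?f n w = 0" if "n \<noteq> m" for n
    proof (rule ccontr)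
      assume "?f n w \<noteq> 0"
      then have n: "w (Suc n) \<in> B" "\<forall>t\<in>{1..n}. w t \<notin> A \<union> B" unfolding f01 by (auto split: if_splits)
      show False
      proof (cases "n < m")
        case True then show False using m(2) n(1) by auto
      next
        case False then show False using that m(1) n(2) by auto
      qed
    qed
    then have "(\<Sum>m. ?f m w) = (\<Sum>n\<in>{m}. ?f n w)" by (intro suminf_finite) auto
    also have "\<dots> = 1" unfolding f01 using m by simp
    finally show ?thesis using True by simp
  next
    case False
    then have "?f m w = 0" for m unfolding f01 using hitting_less_iff[OF assms, of w] by auto
    then have "(\<Sum>m. ?f m w) = 0" by (simp only: suminf_zero)
    then show ?thesis using False by simp
  qed
  have "(\<lambda>w. indicator ?E w :: ennreal) \<in> borel_measurable (markov_law \<nu> K)"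
    unfolding ind using fm by (intro borel_measurable_suminf_order) auto
  then have E: "?E \<inter> space (markov_law \<nu> K) \<in> sets (markov_law \<nu> K)"
    by (simp add: borel_measurable_indicator_iff)
  have sp: "space (markov_law \<nu> K) = UNIV"
    unfolding markov_law_def by (simp add: space_PiM)
  have "emeasure (markov_law \<nu> K) ?E = (\<integral>\<^sup>+w. indicator ?E w \<partial>markov_law \<nu> K)"
    using E sp by simp
  also have "\<dots> = (\<Sum>m. \<integral>\<^sup>+w. ?f m w \<partial>markov_law \<nu> K)"
    unfolding ind by (rule nn_integral_suminf[OF fm])
  also have "\<dots> = (\<Sum>m. \<integral>\<^sup>+s. transition_op K ((killed_op K ?D ^^ m) (indicator B)) s \<partial>measure_pmf \<nu>)"
    by (simp only: nn_integral_first_passage)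
  also have "\<dots> = (\<integral>\<^sup>+s. (\<Sum>m. transition_op K ((killed_op K ?D ^^ m) (indicator B)) s) \<partial>measure_pmf \<nu>)"
    by (rule nn_integral_suminf[symmetric]) simp
  also have "\<dots> = (\<integral>\<^sup>+s. transition_op K (exit_prob K A B) s \<partial>measure_pmf \<nu>)"
    unfolding exit_prob_def[abs_def] by (simp add: transition_op_suminf)
  finally show ?thesis .
qed

lemma nn_integral_pmf_finite:
  assumes "finite S" "set_pmf p \<subseteq> S"
  shows "(\<integral>\<^sup>+x. u x \<partial>measure_pmf p) = (\<Sum>x\<in>S. ennreal (pmf p x) * u x)"
proof -
  have "(\<integral>\<^sup>+x. u x \<partial>measure_pmf p) = (\<Sum>x\<in>set_pmf p. u x * ennreal (pmf p x))"
    by (rule nn_integral_measure_pmf_finite) (use assms finite_subset in auto)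
  also have "\<dots> = (\<Sum>x\<in>S. ennreal (pmf p x) * u x)"
    by (rule sum.mono_neutral_cong_left) (use assms in \<open>auto simp: mult.commute set_pmf_iff\<close>)
  finally show ?thesis .
qed

lemma prob_hits_before_eq:
  assumes S: "finite S" "\<And>s. s \<in> S \<Longrightarrow> set_pmf (K s) \<subseteq> S" "set_pmf \<nu> \<subseteq> S" and AB: "A \<inter> B = {}"
  shows "prob_hits_before K \<nu> B A = (\<Sum>s\<in>S. pmf \<nu> s * (\<Sum>y\<in>S. pmf (K s) y * enn2real (exit_prob K A B y)))"
proof -
  let ?h = "\<lambda>y. enn2real (exit_prob K A B y)"
  have h: "exit_prob K A B y = ennreal (?h y)" for y
    using exit_prob_le_1[of K A B y] by (metis ennreal_enn2real ennreal_one_less_top le_less_trans)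
  have p: "transition_op K (exit_prob K A B) s = ennreal (\<Sum>y\<in>S. pmf (K s) y * ?h y)" if "s \<in> S" for s
  proof -
    have "transition_op K (exit_prob K A B) s = (\<Sum>y\<in>S. ennreal (pmf (K s) y) * exit_prob K A B y)"
      unfolding transition_op_def by (rule nn_integral_pmf_finite[OF S(1) S(2)[OF that]])
    also have "\<dots> = (\<Sum>y\<in>S. ennreal (pmf (K s) y * ?h y))"
      by (subst h) (simp add: ennreal_mult')
    finally show ?thesis by (simp add: sum_ennreal)
  qed
  have "emeasure (markov_law \<nu> K) {w. hitting B w < hitting A w} = (\<Sum>s\<in>S. ennreal (pmf \<nu> s) * transition_op K (exit_prob K A B) s)"
    unfolding emeasure_hits_before[OF AB] by (rule nn_integral_pmf_finite[OF S(1,3)])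
  also have "\<dots> = (\<Sum>s\<in>S. ennreal (pmf \<nu> s * (\<Sum>y\<in>S. pmf (K s) y * ?h y)))"
    by (rule sum.cong) (simp_all add: p ennreal_mult')
  also have "\<dots> = ennreal (\<Sum>s\<in>S. pmf \<nu> s * (\<Sum>y\<in>S. pmf (K s) y * ?h y))"
    by (rule sum_ennreal) (simp add: sum_nonneg)
  finally show ?thesis
    unfolding prob_hits_before_def measure_def
    by (simp add: sum_nonneg)
qed

definition dirichlet :: "'s set \<Rightarrow> ('s \<Rightarrow> 's \<Rightarrow> real) \<Rightarrow> ('s \<Rightarrow> real) \<Rightarrow> real" where
  "dirichlet S c f = (\<Sum>s\<in>S. \<Sum>t\<in>S. c s t * (f s - f t)\<^sup>2) / 2"

lemma green:
  assumes c: "\<And>s t. s \<in> S \<Longrightarrow> t \<in> S \<Longrightarrow> c s t = c t s"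
  shows "(\<Sum>s\<in>S. \<Sum>t\<in>S. c s t * ((f s - f t) * (g s - g t))) = 2 * (\<Sum>s\<in>S. f s * (\<Sum>t\<in>S. c s t * (g s - g t :: real)))"
proof -
  have "(\<Sum>s\<in>S. \<Sum>t\<in>S. c s t * ((f s - f t) * (g s - g t)))
    = (\<Sum>s\<in>S. \<Sum>t\<in>S. f s * (c s t * (g s - g t))) + (\<Sum>s\<in>S. \<Sum>t\<in>S. f t * (c s t * (g t - g s)))"
    unfolding sum.distrib[symmetric] by (intro sum.cong refl) (simp add: algebra_simps)
  also have "(\<Sum>s\<in>S. \<Sum>t\<in>S. f t * (c s t * (g t - g s))) = (\<Sum>t\<in>S. \<Sum>s\<in>S. f t * (c s t * (g t - g s)))"
    by (rule sum.swap)
  also have "\<dots> = (\<Sum>t\<in>S. \<Sum>s\<in>S. f t * (c t s * (g t - g s)))"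
    by (intro sum.cong refl) (simp add: c)
  finally show ?thesis by (simp add: sum_distrib_left)
qed

text \<open>The function \<open>h\<close> is harmonic off \<open>A \<union> B\<close>. By Green's formula its Dirichlet form is therefore a flow
  out of \<open>A\<close>, and \<open>h\<close> is orthogonal to every function that vanishes on \<open>A \<union> B\<close>, such as
  \<open>f - h\<close>.\<close>

lemma dirichlet_equilibrium:
  fixes c :: "'s \<Rightarrow> 's \<Rightarrow> real"
  assumes S: "finite S" "A \<subseteq> S" "B \<subseteq> S" "A \<inter> B = {}"
    and c: "\<And>s t. s \<in> S \<Longrightarrow> t \<in> S \<Longrightarrow> c s t = c t s" "\<And>s t. s \<in> S \<Longrightarrow> t \<in> S \<Longrightarrow> 0 \<le> c s t"
    and h: "\<And>s. s \<in> A \<Longrightarrow> h s = 0" "\<And>s. s \<in> B \<Longrightarrow> h s = 1"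
      "\<And>s. s \<in> S - (A \<union> B) \<Longrightarrow> (\<Sum>t\<in>S. c s t * (h s - h t)) = 0"
  shows "dirichlet S c h = (\<Sum>s\<in>A. \<Sum>t\<in>S. c s t * h t)"
    and "(\<And>s. s \<in> A \<Longrightarrow> f s = 0) \<Longrightarrow> (\<And>s. s \<in> B \<Longrightarrow> f s = 1) \<Longrightarrow> dirichlet S c h \<le> dirichlet S c f"
proof -
  define L where "L s = (\<Sum>t\<in>S. c s t * (h s - h t))" for s
  have fin: "finite A" "finite B" using S(2,3) finite_subset[OF _ S(1)] by blast+
  have S3: "(\<Sum>s\<in>S. u s * L s) = (\<Sum>s\<in>A. u s * L s) + (\<Sum>s\<in>B. u s * L s)" for u
  proof -
    have "(\<Sum>s\<in>S. u s * L s) = (\<Sum>s\<in>A \<union> B. u s * L s)"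
      by (rule sum.mono_neutral_right) (use S h(3) in \<open>auto simp: L_def\<close>)
    then show ?thesis using fin S(4) by (simp add: sum.union_disjoint)
  qed
  have "0 = (\<Sum>s\<in>S. \<Sum>t\<in>S. c s t * ((1 - 1) * (h s - h t)))" by simp
  also have "\<dots> = 2 * (\<Sum>s\<in>S. 1 * L s)"
    using green[of S c "\<lambda>_. 1" h, OF c(1)] by (simp add: L_def)
  finally have tot: "(\<Sum>s\<in>A. L s) + (\<Sum>s\<in>B. L s) = 0" using S3[of "\<lambda>_. 1"] by simp
  have "dirichlet S c h = (\<Sum>s\<in>S. h s * L s)"
    using green[of S c h h, OF c(1)] by (simp add: dirichlet_def L_def power2_eq_square)
  also have "\<dots> = (\<Sum>s\<in>B. L s)" unfolding S3 by (simp add: h)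
  also have "\<dots> = - (\<Sum>s\<in>A. L s)" using tot by simp
  also have "\<dots> = (\<Sum>s\<in>A. \<Sum>t\<in>S. c s t * h t)"
    by (simp add: L_def h sum_negf)
  finally show "dirichlet S c h = (\<Sum>s\<in>A. \<Sum>t\<in>S. c s t * h t)" .
  assume f: "\<And>s. s \<in> A \<Longrightarrow> f s = 0" "\<And>s. s \<in> B \<Longrightarrow> f s = 1"
  have cross: "(\<Sum>s\<in>S. \<Sum>t\<in>S. c s t * (((f s - h s) - (f t - h t)) * (h s - h t))) = 0"
  proof -
    have "(\<Sum>s\<in>S. \<Sum>t\<in>S. c s t * (((f s - h s) - (f t - h t)) * (h s - h t))) = 2 * (\<Sum>s\<in>S. (f s - h s) * L s)"
      using green[of S c "\<lambda>s. f s - h s" h, OF c(1)] by (simp add: L_def)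
    also have "\<dots> = 0" unfolding S3 using f h by simp
    finally show ?thesis .
  qed
  have "2 * dirichlet S c f = (\<Sum>s\<in>S. \<Sum>t\<in>S. c s t * (h s - h t)\<^sup>2 + 2 * (c s t * (((f s - h s) - (f t - h t)) * (h s - h t)))
      + c s t * ((f s - h s) - (f t - h t))\<^sup>2)"
    unfolding dirichlet_def by (simp, intro sum.cong refl) (simp add: power2_eq_square algebra_simps)
  also have "\<dots> = 2 * dirichlet S c h + 2 * (\<Sum>s\<in>S. \<Sum>t\<in>S. c s t * (((f s - h s) - (f t - h t)) * (h s - h t)))
      + (\<Sum>s\<in>S. \<Sum>t\<in>S. c s t * ((f s - h s) - (f t - h t))\<^sup>2)"
    unfolding dirichlet_def sum.distrib sum_distrib_left[symmetric] by simp
  also note cross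
  finally have eq: "2 * dirichlet S c f = 2 * dirichlet S c h + 2 * 0 + (\<Sum>s\<in>S. \<Sum>t\<in>S. c s t * ((f s - h s) - (f t - h t))\<^sup>2)" .
  have "(\<Sum>s\<in>S. \<Sum>t\<in>S. c s t * ((f s - h s) - (f t - h t))\<^sup>2) \<ge> 0"
    using c(2) by (intro sum_nonneg mult_nonneg_nonneg) auto
  with eq show "dirichlet S c h \<le> dirichlet S c f" by simp
qed

text \<open>For a reversible chain the escape probability from \<open>A\<close> to \<open>B\<close>, weighted with the mass of \<open>A\<close>, is the
  capacity between \<open>A\<close> and \<open>B\<close>, since \<^const>\<open>exit_prob\<close> is harmonic off \<open>A \<union> B\<close>. The minimality of
  \<open>h\<close> yields upper bounds from test functions; lower bounds come from estimates for \<open>h\<close> itself.\<close>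

lemma prob_hits_before_dirichlet:
  fixes K :: "'s \<Rightarrow> 's pmf" and mu :: "'s pmf"
  assumes S: "finite S" "A \<subseteq> S" "B \<subseteq> S" "A \<inter> B = {}" and mu: "set_pmf mu \<subseteq> S" "set_pmf mu \<inter> A \<noteq> {}"
    and K: "\<And>s. s \<in> S \<Longrightarrow> set_pmf (K s) \<subseteq> S"
    and rev: "\<And>s t. s \<in> S \<Longrightarrow> t \<in> S \<Longrightarrow> pmf mu s * pmf (K s) t = pmf mu t * pmf (K t) s"
  obtains h where "\<And>s. s \<in> A \<Longrightarrow> h s = 0" "\<And>s. s \<in> B \<Longrightarrow> h s = 1"
    "(\<Sum>s\<in>A. pmf mu s) * prob_hits_before K (cond_pmf mu A) B A = dirichlet S (\<lambda>s t. pmf mu s * pmf (K s) t) h"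
    "\<And>f. (\<And>s. s \<in> A \<Longrightarrow> f s = 0) \<Longrightarrow> (\<And>s. s \<in> B \<Longrightarrow> f s = 1) \<Longrightarrow>
      dirichlet S (\<lambda>s t. pmf mu s * pmf (K s) t) h \<le> dirichlet S (\<lambda>s t. pmf mu s * pmf (K s) t) f"
proof -
  define h where "h s = enn2real (exit_prob K A B s)" for s
  have hA: "h s = 0" if "s \<in> A" for s
    using that S(4) unfolding h_def by (subst exit_prob_step) (auto split: split_indicator)
  have hB: "h s = 1" if "s \<in> B" for s
    using that S(4) unfolding h_def by (subst exit_prob_step) (auto split: split_indicator)
  have e: "exit_prob K A B y = ennreal (h y)" for y
    unfolding h_def using exit_prob_le_1[of K A B y] by (metis ennreal_enn2real ennreal_one_less_top le_less_trans)
  have h0: "0 \<le> h y" for y unfolding h_def by simp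
  have harm: "h s = (\<Sum>t\<in>S. pmf (K s) t * h t)" if s: "s \<in> S - (A \<union> B)" for s
  proof -
    have "exit_prob K A B s = transition_op K (exit_prob K A B) s"
      using s by (subst exit_prob_step) simp
    also have "\<dots> = (\<Sum>t\<in>S. ennreal (pmf (K s) t) * exit_prob K A B t)"
      unfolding transition_op_def using s K by (intro nn_integral_pmf_finite[OF S(1)]) auto
    also have "\<dots> = ennreal (\<Sum>t\<in>S. pmf (K s) t * h t)"
      unfolding e by (simp add: ennreal_mult'[symmetric] sum_ennreal h0)
    finally show ?thesis unfolding h_def by (simp add: sum_nonneg)
  qed
  have one: "(\<Sum>t\<in>S. pmf (K s) t) = 1" if "s \<in> S" for s
    using sum_pmf_eq_1[OF S(1) K[OF that]] .
  have harm': "(\<Sum>t\<in>S. pmf mu s * pmf (K s) t * (h s - h t)) = 0" if s: "s \<in> S - (A \<union> B)" for s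
  proof -
    have "(\<Sum>t\<in>S. pmf mu s * pmf (K s) t * (h s - h t)) = pmf mu s * (h s * (\<Sum>t\<in>S. pmf (K s) t) - (\<Sum>t\<in>S. pmf (K s) t * h t))"
      by (simp add: sum_distrib_left sum_subtractf algebra_simps)
    then show ?thesis using one s harm[OF s] by simp
  qed
  note eq = dirichlet_equilibrium[where c="\<lambda>s t. pmf mu s * pmf (K s) t" and h=h, OF S rev _ hA hB harm']
  have mA: "measure mu A = (\<Sum>s\<in>A. pmf mu s)" 
    using finite_subset[OF S(2,1)] by (rule measure_measure_pmf_finite)
  have mA0: "measure mu A \<noteq> 0" using mu(2) measure_pmf_zero_iff[of mu A] by auto
  have cs: "set_pmf (cond_pmf mu A) \<subseteq> S" using mu by (auto simp: set_cond_pmf)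
  have "(\<Sum>s\<in>A. pmf mu s) * prob_hits_before K (cond_pmf mu A) B A
     = measure mu A * (\<Sum>s\<in>S. pmf (cond_pmf mu A) s * (\<Sum>y\<in>S. pmf (K s) y * h y))"
    unfolding mA h_def by (subst prob_hits_before_eq[where K=K, OF S(1) K cs S(4)]) simp_all
  also have "(\<Sum>s\<in>S. pmf (cond_pmf mu A) s * (\<Sum>y\<in>S. pmf (K s) y * h y)) =
      (\<Sum>s\<in>A. pmf mu s / measure mu A * (\<Sum>y\<in>S. pmf (K s) y * h y))"
    by (rule sum.mono_neutral_cong_right) (use S mu in \<open>auto simp: pmf_cond\<close>)
  also have "measure mu A * \<dots> = (\<Sum>s\<in>A. \<Sum>t\<in>S. pmf mu s * pmf (K s) t * h t)"
    using mA0 by (simp add: sum_distrib_left mult.assoc)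
  also have "\<dots> = dirichlet S (\<lambda>s t. pmf mu s * pmf (K s) t) h" using eq(1) by simp
  finally show ?thesis using eq(2) hA hB by (intro that[of h]) auto
qed

section \<open>A Poincare inequality on configurations\<close>

definition adjacent :: "nat \<Rightarrow> (nat \<Rightarrow> 'q) \<Rightarrow> (nat \<Rightarrow> 'q) \<Rightarrow> bool" where
  "adjacent N \<sigma> \<eta> \<longleftrightarrow> card {i\<in>{1..N}. \<sigma> i \<noteq> \<eta> i} = 1"

definition conductance :: "nat \<Rightarrow> ((nat \<Rightarrow> 'q::finite) \<Rightarrow> real) \<Rightarrow> (nat \<Rightarrow> 'q) \<Rightarrow> (nat \<Rightarrow> 'q) \<Rightarrow> real" where
  "conductance N w \<sigma> \<eta> = (if adjacent N \<sigma> \<eta> then min (w \<sigma>) (w \<eta>) else 0)"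

definition boltzmann :: "real \<Rightarrow> (nat \<Rightarrow> nat \<Rightarrow> real) \<Rightarrow> nat \<Rightarrow> (nat \<Rightarrow> 'q::finite) \<Rightarrow> real" where
  "boltzmann \<beta> g N \<sigma> = exp (- \<beta> * hamiltonian g N \<sigma>)"

abbreviation boltzmann1 :: "real \<Rightarrow> nat \<Rightarrow> (nat \<Rightarrow> 'q::finite) \<Rightarrow> real" where
  "boltzmann1 \<beta> \<equiv> boltzmann \<beta> (\<lambda>_ _. 1)"

definition level_weight :: "real \<Rightarrow> nat \<Rightarrow> ('q::finite \<Rightarrow> nat) \<Rightarrow> real" where
  "level_weight \<beta> N n = exp (\<beta> * (real N / 2 * (norm (lattice_point N n))\<^sup>2 - 1 / 2))"

lemma boltzmann_pos [simp]: "0 < boltzmann \<beta> g N \<sigma>" "0 \<le> boltzmann \<beta> g N \<sigma>"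
  by (simp_all add: boltzmann_def)

lemma boltzmann1_level: "1 \<le> N \<Longrightarrow> \<sigma> \<in> level N n \<Longrightarrow> boltzmann1 \<beta> N \<sigma> = level_weight \<beta> N n"
  by (simp add: boltzmann_def level_weight_def hamiltonian_one[of N \<sigma> n] algebra_simps)

lemma level_mass_eq: "level_mass \<beta> N n = real (card (level N n)) * level_weight \<beta> N n"
  by (simp add: level_mass_def level_weight_def)

text \<open>A pair \<open>(\<sigma>, i)\<close> stands for the flips of site \<open>i\<close> away from colour \<open>a\<close>. By \<open>sites_move\<close> the
  flips from one level to a neighbouring one can be indexed from either end, and by \<open>sum_sites\<close> both
  ends of a uniformly chosen flip are uniform on their levels.\<close>

definition sites :: "nat \<Rightarrow> ('q::finite \<Rightarrow> nat) \<Rightarrow> 'q \<Rightarrow> ((nat \<Rightarrow> 'q) \<times> nat) set" where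
  "sites N n a = (SIGMA \<sigma>:level N n. {i\<in>{1..N}. \<sigma> i = a})"

lemma sum_sites: "(\<Sum>(\<sigma>, i)\<in>sites N n a. f \<sigma>) = real (n a) * (\<Sum>\<sigma>\<in>level N n. f \<sigma> :: real)"
proof -
  have "(\<Sum>(\<sigma>, i)\<in>sites N n a. f \<sigma>) = (\<Sum>\<sigma>\<in>level N n. \<Sum>i\<in>{i\<in>{1..N}. \<sigma> i = a}. f \<sigma>)"
    unfolding sites_def by (rule sum.Sigma[symmetric]) (auto simp: finite_level)
  also have "\<dots> = (\<Sum>\<sigma>\<in>level N n. real (n a) * f \<sigma>)"
    by (rule sum.cong) (auto simp: level_def colour_count_def)
  finally show ?thesis by (simp add: sum_distrib_left)
qed

lemma flip_level:
  assumes "a \<noteq> b" "\<sigma> \<in> level N n" "i \<in> {1..N}" "\<sigma> i = a"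
  shows "\<sigma>(i := b) \<in> level N (move_unit a b n)"
proof -
  have s: "colour_count N \<sigma> = n" "\<sigma> \<in> configs N" using assms by (auto simp: level_def)
  have "colour_count N (\<sigma>(i := b)) k = move_unit a b n k" for k
  proof -
    have A: "{j\<in>{1..N}. \<sigma> j = a} = insert i {j\<in>{1..N}. (\<sigma>(i := b)) j = a}" using assms by auto
    have B: "{j\<in>{1..N}. (\<sigma>(i := b)) j = b} = insert i {j\<in>{1..N}. \<sigma> j = b}" using assms by auto
    have nk: "n l = card {j\<in>{1..N}. \<sigma> j = l}" for l using s(1) by (auto simp: colour_count_def)
    have "card (insert i {j\<in>{1..N}. (\<sigma>(i := b)) j = a}) = Suc (card {j\<in>{1..N}. (\<sigma>(i := b)) j = a})"
      by (rule card_insert_disjoint) (use assms(1) in auto)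
    then have ca: "n a = Suc (colour_count N (\<sigma>(i := b)) a)" unfolding nk A colour_count_def .
    have "card (insert i {j\<in>{1..N}. \<sigma> j = b}) = Suc (card {j\<in>{1..N}. \<sigma> j = b})"
      by (rule card_insert_disjoint) (use assms(1,4) in auto)
    then have cb: "colour_count N (\<sigma>(i := b)) b = Suc (n b)" unfolding nk B[symmetric] colour_count_def .
    have "{j\<in>{1..N}. (\<sigma>(i := b)) j = k} = {j\<in>{1..N}. \<sigma> j = k}" if "k \<noteq> a" "k \<noteq> b"
      using that assms by auto
    then have "colour_count N (\<sigma>(i := b)) k = n k" if "k \<noteq> a" "k \<noteq> b"
      unfolding nk colour_count_def using that by simp
    with ca cb show ?thesis by (auto simp: move_unit_def)
  qed
  moreover have "\<sigma>(i := b) \<in> configs N" using s(2) assms(3) by (auto simp: configs_def PiE_def extensional_def)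
  ultimately show ?thesis by (auto simp: level_def)
qed

lemma sites_move:
  assumes "a \<noteq> b" "0 < n a"
  shows "bij_betw (\<lambda>(\<sigma>, i). (\<sigma>(i := b), i)) (sites N n a) (sites N (move_unit a b n) b)"
proof (rule bij_betwI[where g="\<lambda>(\<sigma>, i). (\<sigma>(i := a), i)"])
  have mm: "move_unit b a (move_unit a b n) = n" using assms by (auto simp: move_unit_def fun_eq_iff)
  show "(\<lambda>(\<sigma>, i). (\<sigma>(i := b), i)) \<in> sites N n a \<rightarrow> sites N (move_unit a b n) b"
    using flip_level[OF assms(1)] by (auto simp: sites_def)
  show "(\<lambda>(\<sigma>, i). (\<sigma>(i := a), i)) \<in> sites N (move_unit a b n) b \<rightarrow> sites N n a"
    using flip_level[OF assms(1)[symmetric], of _ N "move_unit a b n"] by (auto simp: sites_def mm)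
qed (auto simp: sites_def)

lemma dirichlet_level_edges:
  assumes ab: "a \<noteq> b" and n: "0 < n a" and w: "\<And>\<sigma>. 0 \<le> w \<sigma>"
    and W: "\<And>\<sigma>. \<sigma> \<in> level N n \<union> level N (move_unit a b n) \<Longrightarrow> W \<le> w \<sigma>"
  shows "W * (\<Sum>(\<sigma>, i)\<in>sites N n a. (u \<sigma> - u (\<sigma>(i := b)))\<^sup>2) \<le> 2 * dirichlet (configs N) (conductance N w) (u :: (nat \<Rightarrow> 'q::finite) \<Rightarrow> real)"
proof -
  let ?f = "\<lambda>(\<sigma>, \<eta>). conductance N w \<sigma> \<eta> * (u \<sigma> - u \<eta>)\<^sup>2" and ?g = "\<lambda>(\<sigma> :: nat \<Rightarrow> 'q, i). (\<sigma>, \<sigma>(i := b))"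
  have f0: "0 \<le> ?f x" for x using w by (cases x) (auto simp: conductance_def)
  have inj: "inj_on ?g (sites N n a)"
  proof (rule inj_onI, clarsimp simp: sites_def)
    fix \<sigma> i j assume *: "\<sigma>(i := b) = \<sigma>(j := b)" "a = \<sigma> i" "\<sigma> j = \<sigma> i"
    show "i = j"
    proof (rule ccontr)
      assume "i \<noteq> j"
      then have "(\<sigma>(i := b)) i = b" "(\<sigma>(j := b)) i = \<sigma> i" by auto
      with * ab show False by simp
    qed
  qed
  have sub: "?g ` sites N n a \<subseteq> configs N \<times> configs N"
    using flip_level[OF ab] by (fastforce simp: sites_def level_def)
  have "W * (\<Sum>(\<sigma>, i)\<in>sites N n a. (u \<sigma> - u (\<sigma>(i := b)))\<^sup>2) = (\<Sum>(\<sigma>, i)\<in>sites N n a. W * (u \<sigma> - u (\<sigma>(i := b)))\<^sup>2)"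
    by (simp add: sum_distrib_left case_prod_beta)
  also have "\<dots> \<le> (\<Sum>x\<in>sites N n a. ?f (?g x))"
  proof (rule sum_mono)
    fix x assume x: "x \<in> sites N n a"
    obtain \<sigma> i where xi: "x = (\<sigma>, i)" by (cases x)
    with x have s: "\<sigma> \<in> level N n" "i \<in> {1..N}" "\<sigma> i = a" by (auto simp: sites_def)
    have "{j\<in>{1..N}. \<sigma> j \<noteq> (\<sigma>(i := b)) j} = {i}" using s ab by auto
    then have "adjacent N \<sigma> (\<sigma>(i := b))" by (simp add: adjacent_def)
    then have "W \<le> conductance N w \<sigma> (\<sigma>(i := b))" using s flip_level[OF ab s] W by (auto simp: conductance_def)
    then show "(case x of (\<sigma>, i) \<Rightarrow> W * (u \<sigma> - u (\<sigma>(i := b)))\<^sup>2) \<le> ?f (?g x)" by (simp add: xi mult_right_mono)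
  qed
  also have "\<dots> = (\<Sum>x\<in>?g ` sites N n a. ?f x)" by (rule sum.reindex[OF inj, symmetric, unfolded comp_def])
  also have "\<dots> \<le> (\<Sum>x\<in>configs N \<times> configs N. ?f x)"
    by (rule sum_mono2[OF _ sub]) (use finite_configs f0 in auto)
  also have "\<dots> = 2 * dirichlet (configs N) (conductance N w) u"
    unfolding dirichlet_def by (simp add: sum.cartesian_product)
  finally show ?thesis .
qed

definition rms :: "nat \<Rightarrow> ((nat \<Rightarrow> 'q::finite) \<Rightarrow> real) \<Rightarrow> ('q \<Rightarrow> nat) \<Rightarrow> real" where
  "rms N u n = sqrt ((\<Sum>\<sigma>\<in>level N n. (u \<sigma>)\<^sup>2) / real (card (level N n)))"

text \<open>The triangle inequality in the space of square-summable functions on the flips between two neighbouring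
  levels. There are at least as many flips as configurations in either level, so the mean square of the
  differences is at most \<open>2 / V\<close> times the Dirichlet form.\<close>

lemma rms_step:
  fixes u :: "(nat \<Rightarrow> 'q::finite) \<Rightarrow> real"
  assumes N: "1 \<le> N" and ab: "a \<noteq> b" and na: "0 < n a" and n: "n \<in> compositions N" and V: "0 < V" "V \<le> level_mass \<beta> N n" "V \<le> level_mass \<beta> N (move_unit a b n)"
  shows "rms N u n \<le> rms N u (move_unit a b n) + sqrt (2 * dirichlet (configs N) (conductance N (boltzmann1 \<beta> N)) u / V)"
proof -
  let ?m = "move_unit a b n"
  let ?E = "sites N n a"
  let ?D = "dirichlet (configs N) (conductance N (boltzmann1 \<beta> N)) u"
  have m: "?m \<in> compositions N" by (rule move_unit_compositions[OF ab na n])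
  have mb: "0 < ?m b" by (simp add: move_unit_def)
  have cn: "0 < card (level N n)" "0 < card (level N ?m)" using level_nonempty n m by auto
  have E1: "real (card ?E) = real (n a) * real (card (level N n))"
    using sum_sites[of "\<lambda>_. 1" N n a] by (simp add: case_prod_beta)
  have bij: "bij_betw (\<lambda>(\<sigma>, i). (\<sigma>(i := b), i)) ?E (sites N ?m b)" by (rule sites_move[where n=n, OF ab na])
  have E2: "real (card ?E) = real (?m b) * real (card (level N ?m))"
    using sum_sites[of "\<lambda>_. 1" N ?m b] bij_betw_same_card[OF bij] by (simp add: case_prod_beta)
  have Epos: "0 < real (card ?E)" unfolding E1 using cn na by simp
  have r1: "rms N u n = sqrt ((\<Sum>(\<sigma>, i)\<in>?E. (u \<sigma>)\<^sup>2) / real (card ?E))"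
    unfolding rms_def sum_sites E1 using na by simp
  have "(\<Sum>(\<sigma>, i)\<in>?E. (u (\<sigma>(i := b)))\<^sup>2) = (\<Sum>(\<sigma>, i)\<in>sites N ?m b. (u \<sigma>)\<^sup>2)"
    using sum.reindex_bij_betw[OF bij, of "\<lambda>(\<sigma>, i). (u \<sigma>)\<^sup>2"] by (simp add: case_prod_beta)
  then have r2: "rms N u ?m = sqrt ((\<Sum>(\<sigma>, i)\<in>?E. (u (\<sigma>(i := b)))\<^sup>2) / real (card ?E))"
    unfolding rms_def sum_sites E2 using mb by simp
  define L where "L f = L2_set f ?E" for f :: "(nat \<Rightarrow> 'q) \<times> nat \<Rightarrow> real"
  have "L (\<lambda>x. u (fst x)) = L (\<lambda>x. u ((fst x)(snd x := b)) + (u (fst x) - u ((fst x)(snd x := b))))" by simp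
  also have "\<dots> \<le> L (\<lambda>x. u ((fst x)(snd x := b))) + L (\<lambda>x. u (fst x) - u ((fst x)(snd x := b)))"
    unfolding L_def by (rule L2_set_triangle_ineq)
  finally have tri: "L (\<lambda>x. u (fst x)) \<le> L (\<lambda>x. u ((fst x)(snd x := b))) + L (\<lambda>x. u (fst x) - u ((fst x)(snd x := b)))" .
  define W where "W = min (level_weight \<beta> N n) (level_weight \<beta> N ?m)"
  have W0: "0 < W" by (simp add: W_def level_weight_def)
  have "W * (\<Sum>(\<sigma>, i)\<in>?E. (u \<sigma> - u (\<sigma>(i := b)))\<^sup>2) \<le> 2 * ?D"
    by (rule dirichlet_level_edges[where n=n, OF ab na]) (auto simp: finite_configs W_def boltzmann1_level[OF N])
  then have s1: "(\<Sum>(\<sigma>, i)\<in>?E. (u \<sigma> - u (\<sigma>(i := b)))\<^sup>2) \<le> 2 * ?D / W" using W0 by (simp add: field_simps)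
  have "V \<le> real (card ?E) * W"
  proof -
    have "real (card (level N n)) \<le> real (card ?E)"
      unfolding E1 using mult_right_mono[of 1 "real (n a)" "real (card (level N n))"] na by simp
    then have "level_mass \<beta> N n \<le> real (card ?E) * level_weight \<beta> N n" unfolding level_mass_eq by (rule mult_right_mono) (simp add: level_weight_def)
    moreover have "real (card (level N ?m)) \<le> real (card ?E)"
      unfolding E2 using mult_right_mono[of 1 "real (?m b)" "real (card (level N ?m))"] mb by simp
    then have "level_mass \<beta> N ?m \<le> real (card ?E) * level_weight \<beta> N ?m" unfolding level_mass_eq by (rule mult_right_mono) (simp add: level_weight_def)
    ultimately show ?thesis using V by (auto simp: W_def min_def)
  qed
  moreover have D0: "0 \<le> ?D" unfolding dirichlet_def conductance_def boltzmann_def by (auto intro!: sum_nonneg)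
  ultimately have "2 * ?D / W / real (card ?E) \<le> 2 * ?D / V"
    using V(1) by (simp add: divide_left_mono mult.commute)
  moreover have "(\<Sum>(\<sigma>, i)\<in>?E. (u \<sigma> - u (\<sigma>(i := b)))\<^sup>2) / real (card ?E) \<le> 2 * ?D / W / real (card ?E)"
    by (rule divide_right_mono[OF s1]) simp
  ultimately have s2: "(\<Sum>(\<sigma>, i)\<in>?E. (u \<sigma> - u (\<sigma>(i := b)))\<^sup>2) / real (card ?E) \<le> 2 * ?D / V" by linarith
  have "rms N u n = L (\<lambda>x. u (fst x)) / sqrt (real (card ?E))"
    unfolding r1 L_def L2_set_def by (simp add: case_prod_beta real_sqrt_divide)
  also have "\<dots> \<le> (L (\<lambda>x. u ((fst x)(snd x := b))) + L (\<lambda>x. u (fst x) - u ((fst x)(snd x := b)))) / sqrt (real (card ?E))"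
    by (rule divide_right_mono[OF tri]) simp
  also have "\<dots> = rms N u ?m + sqrt ((\<Sum>(\<sigma>, i)\<in>?E. (u \<sigma> - u (\<sigma>(i := b)))\<^sup>2) / real (card ?E))"
    unfolding r2 L_def L2_set_def by (simp add: case_prod_beta real_sqrt_divide add_divide_distrib)
  also have "\<dots> \<le> rms N u ?m + sqrt (2 * ?D / V)" using s2 by simp
  finally show ?thesis .
qed

text \<open>The path can be chosen with at most as many steps as there are pairs of lattice points.\<close>

lemma rms_path:
  fixes u :: "(nat \<Rightarrow> 'q::finite) \<Rightarrow> real"
  assumes N: "1 \<le> N" and V: "0 < V" "\<And>p. p \<in> G \<Longrightarrow> V \<le> level_mass \<beta> N p" and G: "G \<subseteq> compositions N"
    and path: "(n, m) \<in> (unit_moves \<inter> G \<times> G)\<^sup>*"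
  shows "rms N u n \<le> rms N u m + (real (card (compositions N :: ('q \<Rightarrow> nat) set)))\<^sup>2 * sqrt (2 * dirichlet (configs N) (conductance N (boltzmann1 \<beta> N)) u / V)"
proof -
  let ?R = "unit_moves \<inter> G \<times> G" and ?C = "compositions N :: ('q \<Rightarrow> nat) set"
  let ?s = "sqrt (2 * dirichlet (configs N) (conductance N (boltzmann1 \<beta> N)) u / V)"
  have "finite (?C \<times> ?C)" using finite_compositions by auto
  then have fin: "finite ?R" by (rule finite_subset[rotated]) (use G in auto)
  have cR: "card ?R \<le> card ?C * card ?C"
    unfolding card_cartesian_product[symmetric] by (rule card_mono) (use G finite_compositions in auto)
  obtain k where k: "k \<le> card ?R" "(n, m) \<in> ?R ^^ k" using path rtrancl_finite_eq_relpow[OF fin] by auto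
  have "(n, m) \<in> ?R ^^ k \<Longrightarrow> rms N u n \<le> rms N u m + real k * ?s" for k
  proof (induction k arbitrary: m)
    case (Suc k)
    then obtain p where p: "(n, p) \<in> ?R ^^ k" "(p, m) \<in> ?R" by auto
    then obtain a b where ab: "a \<noteq> b" "0 < p a" "m = move_unit a b p" by (auto simp: unit_moves_def)
    have "rms N u p \<le> rms N u m + ?s" unfolding ab(3)
      by (rule rms_step[where n=p, OF N ab(1,2) _ V(1)]) (use p V(2) G ab(3) in auto)
    then show ?case using Suc.IH[OF p(1)] by (simp add: algebra_simps)
  qed simp
  from this[OF k(2)] have "rms N u n \<le> rms N u m + real k * ?s" .
  also have "\<dots> \<le> rms N u m + (real (card ?C))\<^sup>2 * ?s"
  proof -
    have "real k \<le> real (card ?C * card ?C)" using k(1) cR by (simp only: of_nat_le_iff)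
    then have "real k \<le> (real (card ?C))\<^sup>2" by (simp add: power2_eq_square)
    moreover have "0 \<le> ?s" using V(1) by (auto simp: dirichlet_def conductance_def boltzmann_def intro!: sum_nonneg divide_nonneg_nonneg)
    ultimately show ?thesis by (simp add: mult_right_mono)
  qed
  finally show ?thesis .
qed

text \<open>By \<open>descent_path\<close> every level is joined to a well, where \<open>u\<close> vanishes, through levels whose mass is
  not exponentially smaller than its own. So \<open>rms_path\<close> controls the mass of \<open>u\<^sup>2\<close> on this level, and
  there are only polynomially many levels.\<close>

lemma poincare:
  fixes a :: "nat \<Rightarrow> 'q::finite option \<Rightarrow> 'q \<Rightarrow> nat"
  assumes q: "2 \<le> CARD('q)" and b: "beta1 TYPE('q) < \<beta>" and \<beta>: "0 < \<beta>" and e: "0 < e"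
    and a: "\<And>N i. 1 \<le> N \<Longrightarrow> i \<in> min_index \<beta> \<Longrightarrow> a N i \<in> compositions N"
    and lim: "\<And>i. i \<in> min_index \<beta> \<Longrightarrow> (\<lambda>N. lattice_point N (a N i)) \<longlonglongrightarrow> min_point \<beta> i"
  shows "\<forall>\<^sub>F N in sequentially. \<forall>u :: (nat \<Rightarrow> 'q) \<Rightarrow> real. (\<forall>i\<in>min_index \<beta>. \<forall>\<sigma>\<in>level N (a N i). u \<sigma> = 0) \<longrightarrow>
    (\<Sum>\<sigma>\<in>configs N. boltzmann1 \<beta> N \<sigma> * (u \<sigma>)\<^sup>2) \<le> exp (e * real N) * dirichlet (configs N) (conductance N (boltzmann1 \<beta> N)) u"
proof -
  let ?F = "free_energy \<beta> :: real ^ 'q \<Rightarrow> real"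
  define Q where "Q = CARD('q)"
  \<comment> \<open>The climb costs \<open>\<beta> * e1\<close> and the two comparisons of level masses cost \<open>e1\<close> each.\<close>
  define e1 where "e1 = e / (3 * \<beta> + 3)"
  have e1: "0 < e1" using e \<beta> by (simp add: e1_def)
  have e1e: "\<beta> * e1 + 2 * e1 < e"
  proof -
    have "\<beta> * e1 + 2 * e1 = e * (\<beta> + 2) / (3 * \<beta> + 3)" by (simp add: e1_def algebra_simps add_divide_distrib)
    also have "\<dots> < e"
    proof -
      have "e * (\<beta> + 2) < e * (3 * \<beta> + 3)" using e \<beta> by (intro mult_strict_left_mono) auto
      then show ?thesis using \<beta> by (subst pos_divide_less_eq) auto
    qed
    finally show ?thesis .
  qed
  define e2 where "e2 = e - (\<beta> * e1 + 2 * e1)"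
  have e2: "0 < e2" using e1e by (simp add: e2_def)
  have "((\<lambda>x. 2 * (x + 1) ^ (5 * Q) / exp (e2 * x)) \<longlongrightarrow> 0) at_top" using e2 by real_asymp
  from filterlim_compose[OF this filterlim_real_sequentially]
  have "(\<lambda>N. 2 * (real N + 1) ^ (5 * Q) / exp (e2 * real N)) \<longlonglongrightarrow> 0" .
  from order_tendstoD(2)[OF this, of 1]
  have pol: "\<forall>\<^sub>F N in sequentially. 2 * (real N + 1) ^ (5 * Q) / exp (e2 * real N) < 1" by simp
  have dp: "\<forall>\<^sub>F N in sequentially. \<forall>n\<in>compositions N. \<exists>i\<in>min_index \<beta>.
    (n, a N i) \<in> (unit_moves \<inter> sublevel \<beta> N (?F (lattice_point N n) + e1) \<times> sublevel \<beta> N (?F (lattice_point N n) + e1))\<^sup>*"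
    by (rule descent_path[where a=a, OF q b e1]) (use a lim in auto)
  from pol eventually_level_mass[where 'q='q, OF \<beta> e1] dp eventually_ge_at_top[of 1]
  show ?thesis
  proof eventually_elim
    case (elim N)
    show ?case
    proof (intro allI impI)
      fix u :: "(nat \<Rightarrow> 'q) \<Rightarrow> real"
      assume u: "\<forall>i\<in>min_index \<beta>. \<forall>\<sigma>\<in>level N (a N i). u \<sigma> = 0"
      let ?D = "dirichlet (configs N) (conductance N (boltzmann1 \<beta> N)) u" and ?C = "compositions N :: ('q \<Rightarrow> nat) set"
      have D0: "0 \<le> ?D" unfolding dirichlet_def conductance_def boltzmann_def by (auto intro!: sum_nonneg)
      let ?c = "real (card ?C)"
      have lev: "(\<Sum>\<sigma>\<in>level N n. boltzmann1 \<beta> N \<sigma> * (u \<sigma>)\<^sup>2) \<le> 2 * ?c ^ 4 * exp (real N * (\<beta> * e1 + 2 * e1)) * ?D" if n: "n \<in> compositions N" for n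
      proof -
        let ?G = "sublevel \<beta> N (?F (lattice_point N n) + e1) :: ('q \<Rightarrow> nat) set"
        from elim(3) n obtain i where i: "i \<in> min_index \<beta>" "(n, a N i) \<in> (unit_moves \<inter> ?G \<times> ?G)\<^sup>*" by blast
        define V where "V = exp (- real N * (\<beta> * (?F (lattice_point N n) + e1) + e1))"
        have V0: "0 < V" by (simp add: V_def)
        have V: "V \<le> level_mass \<beta> N p" if p: "p \<in> ?G" for p
        proof -
          have "\<beta> * ?F (lattice_point N p) \<le> \<beta> * (?F (lattice_point N n) + e1)" using p \<beta> by (intro mult_left_mono) (auto simp: sublevel_def)
          then have "V \<le> exp (- real N * (\<beta> * ?F (lattice_point N p) + e1))" unfolding V_def by (auto intro!: mult_left_mono)
          also have "\<dots> \<le> level_mass \<beta> N p" using elim(2) p by (auto simp: sublevel_def)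
          finally show ?thesis .
        qed
        have Gs: "?G \<subseteq> compositions N" by (auto simp: sublevel_def)
        have "rms N u (a N i) = 0" using u i(1) by (simp add: rms_def)
        then have "rms N u n \<le> ?c\<^sup>2 * sqrt (2 * ?D / V)"
          using rms_path[OF elim(4) V0 V Gs i(2), of u] by simp
        moreover have "0 \<le> rms N u n" by (auto simp: rms_def intro!: sum_nonneg divide_nonneg_nonneg)
        ultimately have "(rms N u n)\<^sup>2 \<le> (?c\<^sup>2 * sqrt (2 * ?D / V))\<^sup>2" by (intro power_mono)
        also have "\<dots> = ?c ^ 4 * (2 * ?D / V)" using D0 V0 by (simp add: power_mult_distrib)
        finally have r: "(rms N u n)\<^sup>2 \<le> ?c ^ 4 * (2 * ?D / V)" .
        have "(\<Sum>\<sigma>\<in>level N n. boltzmann1 \<beta> N \<sigma> * (u \<sigma>)\<^sup>2) = (\<Sum>\<sigma>\<in>level N n. level_weight \<beta> N n * (u \<sigma>)\<^sup>2)"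
          by (rule sum.cong) (simp_all add: boltzmann1_level[OF elim(4)])
        also have "\<dots> = level_mass \<beta> N n * (rms N u n)\<^sup>2"
          unfolding rms_def level_mass_eq using level_nonempty[OF n] by (simp add: sum_nonneg sum_distrib_left[symmetric])
        also have "\<dots> \<le> exp (- real N * (\<beta> * ?F (lattice_point N n) - e1)) * (?c ^ 4 * (2 * ?D / V))"
          using elim(2) n r by (intro mult_mono) auto
        also have "\<dots> = 2 * ?c ^ 4 * (exp (- real N * (\<beta> * ?F (lattice_point N n) - e1)) / V) * ?D" by simp
        also have "exp (- real N * (\<beta> * ?F (lattice_point N n) - e1)) / V = exp (real N * (\<beta> * e1 + 2 * e1))"
          unfolding V_def exp_diff[symmetric] by (simp add: algebra_simps)
        finally show ?thesis .
      qed
      have "(\<Sum>\<sigma>\<in>configs N. boltzmann1 \<beta> N \<sigma> * (u \<sigma>)\<^sup>2) = (\<Sum>n\<in>?C. \<Sum>\<sigma>\<in>level N n. boltzmann1 \<beta> N \<sigma> * (u \<sigma>)\<^sup>2)"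
        unfolding configs_levels by (rule sum.UNION_disjoint) (auto simp: finite_compositions finite_level level_disjoint)
      also have "\<dots> \<le> (\<Sum>n\<in>?C. 2 * ?c ^ 4 * exp (real N * (\<beta> * e1 + 2 * e1)) * ?D)" by (rule sum_mono) (rule lev)
      also have "\<dots> = 2 * ?c ^ 5 * exp (real N * (\<beta> * e1 + 2 * e1)) * ?D" by (simp add: power_numeral_reduce)
      also have "\<dots> \<le> exp (e2 * real N) * exp (real N * (\<beta> * e1 + 2 * e1)) * ?D"
      proof -
        have "?c \<le> (real N + 1) ^ Q" using card_compositions[where 'q='q, of N] unfolding Q_def by (metis of_nat_1 of_nat_add of_nat_le_iff of_nat_power)
        then have "?c ^ 5 \<le> ((real N + 1) ^ Q) ^ 5" by (intro power_mono) auto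
        also have "\<dots> = (real N + 1) ^ (5 * Q)" by (simp add: power_mult[symmetric] mult.commute)
        finally have "2 * ?c ^ 5 \<le> exp (e2 * real N)" using elim(1) by simp
        then show ?thesis using D0 by (intro mult_right_mono) auto
      qed
      also have "\<dots> = exp (e * real N) * ?D" unfolding exp_add[symmetric] by (simp add: e2_def algebra_simps)
      finally show "(\<Sum>\<sigma>\<in>configs N. boltzmann1 \<beta> N \<sigma> * (u \<sigma>)\<^sup>2) \<le> exp (e * real N) * ?D" .
    qed
  qed
qed

section \<open>Escape probabilities of the Metropolis chain\<close>

lemma pmf_embed_pmf_finite:
  assumes "finite S" "\<And>x. 0 \<le> f x" "\<And>x. x \<notin> S \<Longrightarrow> f x = 0" "(\<Sum>x\<in>S. f x) = 1"
  shows "pmf (embed_pmf f) x = f x"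
proof (rule pmf_embed_pmf)
  have "(\<integral>\<^sup>+x. ennreal (f x) \<partial>count_space UNIV) = (\<Sum>x\<in>S. ennreal (f x))"
    by (rule nn_integral_count_space') (use assms in auto)
  also have "\<dots> = ennreal (\<Sum>x\<in>S. f x)" by (rule sum_ennreal) (use assms in auto)
  finally show "(\<integral>\<^sup>+x. ennreal (f x) \<partial>count_space UNIV) = 1" using assms by simp
qed (use assms in auto)

lemma configs_nonempty: "configs N \<noteq> ({} :: (nat \<Rightarrow> 'q::finite) set)"
proof -
  have "restrict (\<lambda>_. undefined) {1..N} \<in> (configs N :: (nat \<Rightarrow> 'q) set)" by (auto simp: configs_def)
  then show ?thesis by blast
qed

lemma partition_sum_eq: "partition_sum TYPE('q::finite) \<beta> g N = (\<Sum>\<sigma>\<in>configs N. boltzmann \<beta> g N (\<sigma> :: nat \<Rightarrow> 'q))"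
  by (simp add: partition_sum_def boltzmann_def)

lemma partition_sum_pos: "0 < partition_sum TYPE('q::finite) \<beta> g N"
  unfolding partition_sum_eq by (rule sum_pos) (auto simp: finite_configs configs_nonempty)

lemma pmf_gibbs:
  fixes \<sigma> :: "nat \<Rightarrow> 'q::finite"
  shows "pmf (gibbs \<beta> g N) \<sigma> = (if \<sigma> \<in> configs N then boltzmann \<beta> g N \<sigma> / partition_sum TYPE('q) \<beta> g N else 0)"
proof -
  have "pmf (gibbs \<beta> g N) \<sigma> = (if \<sigma> \<in> configs N then exp (- \<beta> * hamiltonian g N \<sigma>) / partition_sum TYPE('q) \<beta> g N else 0)"
    unfolding gibbs_def
  proof (rule pmf_embed_pmf_finite[OF finite_configs])
    have "(\<Sum>x\<in>configs N. exp (- \<beta> * hamiltonian g N (x :: nat \<Rightarrow> 'q)) / partition_sum TYPE('q) \<beta> g N) = 1"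
      using partition_sum_pos[where 'q='q, of \<beta> g N]
      unfolding sum_divide_distrib[symmetric] partition_sum_def by simp
    then show "(\<Sum>x\<in>configs N. if x \<in> configs N then exp (- \<beta> * hamiltonian g N (x :: nat \<Rightarrow> 'q)) / partition_sum TYPE('q) \<beta> g N else 0) = 1"
      by simp
  qed (use partition_sum_pos[where 'q='q, of \<beta> g N] in \<open>auto simp: less_imp_le\<close>)
  then show ?thesis by (simp add: boltzmann_def)
qed

lemma set_pmf_gibbs: "set_pmf (gibbs \<beta> g N) = (configs N :: (nat \<Rightarrow> 'q::finite) set)"
proof (rule set_eqI)
  fix \<sigma> :: "nat \<Rightarrow> 'q"
  have "boltzmann \<beta> g N \<sigma> / partition_sum TYPE('q) \<beta> g N \<noteq> 0"
    using partition_sum_pos[where 'q='q, of \<beta> g N] less_imp_neq[OF boltzmann_pos(1)[of \<beta> g N \<sigma>]] by simp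
  then show "\<sigma> \<in> set_pmf (gibbs \<beta> g N) \<longleftrightarrow> \<sigma> \<in> configs N"
    by (simp only: set_pmf_iff pmf_gibbs split: if_split) simp
qed

lemma adjacent_iff:
  assumes "\<sigma> \<in> configs N" "\<eta> \<in> configs N"
  shows "adjacent N \<sigma> \<eta> \<longleftrightarrow> (\<exists>i\<in>{1..N}. \<exists>b. \<sigma> i \<noteq> b \<and> \<eta> = \<sigma>(i := b))"
proof
  assume "adjacent N \<sigma> \<eta>"
  then obtain i where i: "{j\<in>{1..N}. \<sigma> j \<noteq> \<eta> j} = {i}" unfolding adjacent_def by (rule card_1_singletonE)
  have "i \<in> {j\<in>{1..N}. \<sigma> j \<noteq> \<eta> j}" unfolding i by (rule singletonI)
  then have i1: "i \<in> {1..N}" and i2: "\<sigma> i \<noteq> \<eta> i" by blast+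
  have "\<eta> j = (\<sigma>(i := \<eta> i)) j" for j
  proof (cases "j \<in> {1..N} \<and> j \<noteq> i")
    case True
    then have "j \<notin> {j\<in>{1..N}. \<sigma> j \<noteq> \<eta> j}" unfolding i by blast
    then show ?thesis using True by auto
  next
    case False
    show ?thesis
    proof (cases "j = i")
      case False
      then have "j \<notin> {1..N}" using \<open>\<not> (j \<in> {1..N} \<and> j \<noteq> i)\<close> by blast
      then have "\<sigma> j = undefined" "\<eta> j = undefined"
        using PiE_arb[OF assms(1)[unfolded configs_def]] PiE_arb[OF assms(2)[unfolded configs_def]] by blast+
      then show ?thesis using False by simp
    qed simp
  qed
  then have "\<eta> = \<sigma>(i := \<eta> i)" by blast
  with i1 i2 show "\<exists>i\<in>{1..N}. \<exists>b. \<sigma> i \<noteq> b \<and> \<eta> = \<sigma>(i := b)" by blast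
next
  assume "\<exists>i\<in>{1..N}. \<exists>b. \<sigma> i \<noteq> b \<and> \<eta> = \<sigma>(i := b)"
  then obtain i b where i: "i \<in> {1..N}" "\<sigma> i \<noteq> b" "\<eta> = \<sigma>(i := b)" by blast
  then have "{j\<in>{1..N}. \<sigma> j \<noteq> \<eta> j} = {i}" by auto
  then show "adjacent N \<sigma> \<eta>" by (simp add: adjacent_def)
qed

lemma adjacent_sym: "adjacent N \<sigma> \<eta> \<longleftrightarrow> adjacent N \<eta> \<sigma>"
proof -
  have "{i\<in>{1..N}. \<sigma> i \<noteq> \<eta> i} = {i\<in>{1..N}. \<eta> i \<noteq> \<sigma> i}" by (intro Collect_cong) metis
  then show ?thesis unfolding adjacent_def by (simp only:)
qed

lemma card_adjacent:
  fixes \<sigma> :: "nat \<Rightarrow> 'q::finite"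
  assumes "\<sigma> \<in> configs N"
  shows "card {\<eta>\<in>configs N. adjacent N \<sigma> \<eta>} \<le> N * CARD('q)"
proof -
  have "{\<eta>\<in>configs N. adjacent N \<sigma> \<eta>} \<subseteq> (\<lambda>(i, b). \<sigma>(i := b)) ` ({1..N} \<times> UNIV)"
  proof
    fix \<eta> assume "\<eta> \<in> {\<eta>\<in>configs N. adjacent N \<sigma> \<eta>}"
    then obtain i b where "i \<in> {1..N}" "\<eta> = \<sigma>(i := b)" using adjacent_iff[OF assms] by blast
    then show "\<eta> \<in> (\<lambda>(i, b). \<sigma>(i := b)) ` ({1..N} \<times> UNIV)" by (intro image_eqI[of _ _ "(i, b)"]) auto
  qed
  then have "card {\<eta>\<in>configs N. adjacent N \<sigma> \<eta>} \<le> card ((\<lambda>(i, b). \<sigma>(i := b)) ` ({1..N} \<times> (UNIV :: 'q set)))"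
    by (intro card_mono) auto
  also have "\<dots> \<le> card ({1..N} \<times> (UNIV :: 'q set))" by (rule card_image_le) auto
  also have "\<dots> = N * CARD('q)" by (simp add: card_cartesian_product)
  finally show ?thesis .
qed

lemma flip_prob_eq:
  assumes "\<sigma> \<in> configs N" "\<eta> \<in> configs N"
  shows "flip_prob \<beta> g N \<sigma> \<eta> = (if adjacent N \<sigma> \<eta> then 1 / (real N * real CARD('q::finite)) * exp (- \<beta> * max 0 (hamiltonian g N \<eta> - hamiltonian g N (\<sigma> :: nat \<Rightarrow> 'q))) else 0)"
  using assms by (simp add: flip_prob_def adjacent_def)

lemma flip_prob_nonneg: "0 \<le> flip_prob \<beta> g N \<sigma> \<eta>"
  by (simp add: flip_prob_def)

lemma sum_flip_prob:
  fixes \<sigma> :: "nat \<Rightarrow> 'q::finite"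
  assumes N: "1 \<le> N" and \<beta>: "0 < \<beta>" and s: "\<sigma> \<in> configs N"
  shows "(\<Sum>\<xi>\<in>configs N - {\<sigma>}. flip_prob \<beta> g N \<sigma> \<xi>) \<le> 1"
proof -
  have "(\<Sum>\<xi>\<in>configs N - {\<sigma>}. flip_prob \<beta> g N \<sigma> \<xi>) \<le> (\<Sum>\<xi>\<in>configs N. if adjacent N \<sigma> \<xi> then 1 / (real N * real CARD('q)) else 0)"
  proof (rule sum_le_included[where i="\<lambda>x. x"])
    show "\<forall>x\<in>configs N - {\<sigma>}. \<exists>y\<in>configs N. y = x \<and> flip_prob \<beta> g N \<sigma> x \<le> (if adjacent N \<sigma> y then 1 / (real N * real CARD('q)) else 0)"
    proof
      fix x assume x: "x \<in> configs N - {\<sigma>}"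
      have "1 / (real N * real CARD('q)) * exp (- \<beta> * max 0 (hamiltonian g N x - hamiltonian g N \<sigma>)) \<le> 1 / (real N * real CARD('q)) * 1"
        using \<beta> by (intro mult_left_mono) auto
      then show "\<exists>y\<in>configs N. y = x \<and> flip_prob \<beta> g N \<sigma> x \<le> (if adjacent N \<sigma> y then 1 / (real N * real CARD('q)) else 0)"
        using x s by (auto simp: flip_prob_eq)
    qed
  qed (auto simp: finite_configs)
  also have "\<dots> = real (card {\<eta>\<in>configs N. adjacent N \<sigma> \<eta>}) * (1 / (real N * real CARD('q)))"
    by (subst sum.inter_filter[symmetric]) (auto simp: finite_configs)
  also have "\<dots> \<le> real (N * CARD('q)) * (1 / (real N * real CARD('q)))"
    using card_adjacent[OF s] by (intro mult_right_mono) (simp_all only: of_nat_le_iff, simp)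
  also have "\<dots> \<le> 1" by simp
  finally show ?thesis .
qed

lemma pmf_metropolis:
  fixes \<sigma> :: "nat \<Rightarrow> 'q::finite"
  assumes N: "1 \<le> N" and \<beta>: "0 < \<beta>" and s: "\<sigma> \<in> configs N"
  shows "pmf (metropolis \<beta> g N \<sigma>) \<eta> = (if \<eta> = \<sigma> then 1 - (\<Sum>\<xi>\<in>configs N - {\<sigma>}. flip_prob \<beta> g N \<sigma> \<xi>) else flip_prob \<beta> g N \<sigma> \<eta>)"
  unfolding metropolis_def
proof (rule pmf_embed_pmf_finite[OF finite_configs])
  show "(\<Sum>x\<in>configs N. if x = \<sigma> then 1 - (\<Sum>\<xi>\<in>configs N - {\<sigma>}. flip_prob \<beta> g N \<sigma> \<xi>) else flip_prob \<beta> g N \<sigma> x) = 1"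
    by (subst sum.remove[OF finite_configs s]) simp
qed (use sum_flip_prob[OF assms] s in \<open>auto simp: flip_prob_nonneg flip_prob_def\<close>)

lemma set_pmf_metropolis:
  assumes "1 \<le> N" "0 < \<beta>" "\<sigma> \<in> configs N"
  shows "set_pmf (metropolis \<beta> g N (\<sigma> :: nat \<Rightarrow> 'q::finite)) \<subseteq> configs N"
  using assms by (auto simp: set_pmf_eq pmf_metropolis flip_prob_def split: if_splits)

lemma detailed_balance:
  fixes \<sigma> \<eta> :: "nat \<Rightarrow> 'q::finite"
  assumes N: "1 \<le> N" and \<beta>: "0 < \<beta>" and s: "\<sigma> \<in> configs N" "\<eta> \<in> configs N" "\<sigma> \<noteq> \<eta>"
  shows "pmf (gibbs \<beta> g N) \<sigma> * pmf (metropolis \<beta> g N \<sigma>) \<eta> =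
    conductance N (boltzmann \<beta> g N) \<sigma> \<eta> / (real N * real CARD('q) * partition_sum TYPE('q) \<beta> g N)"
proof -
  have "boltzmann \<beta> g N \<sigma> * exp (- \<beta> * max 0 (hamiltonian g N \<eta> - hamiltonian g N \<sigma>)) = min (boltzmann \<beta> g N \<sigma>) (boltzmann \<beta> g N \<eta>)"
  proof (cases "hamiltonian g N \<eta> \<le> hamiltonian g N \<sigma>")
    case True then show ?thesis using \<beta> by (simp add: boltzmann_def max_def min_def)
  next
    case False then show ?thesis using \<beta> by (simp add: boltzmann_def max_def min_def exp_add[symmetric] algebra_simps)
  qed
  then show ?thesis using s by (simp add: pmf_gibbs pmf_metropolis[OF N \<beta>] flip_prob_eq conductance_def)
qed

lemma hits_before_dirichlet:
  fixes A B :: "(nat \<Rightarrow> 'q::finite) set"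
  assumes N: "1 \<le> N" and \<beta>: "0 < \<beta>" and AB: "A \<subseteq> configs N" "B \<subseteq> configs N" "A \<inter> B = {}" "A \<noteq> {}"
  obtains h where "\<And>s. s \<in> A \<Longrightarrow> h s = 0" "\<And>s. s \<in> B \<Longrightarrow> h s = 1"
    "(\<Sum>s\<in>A. boltzmann \<beta> g N s) * (real N * real CARD('q)) * prob_hits_before (metropolis \<beta> g N) (cond_pmf (gibbs \<beta> g N) A) B A
      = dirichlet (configs N) (conductance N (boltzmann \<beta> g N)) h"
    "\<And>f. (\<And>s. s \<in> A \<Longrightarrow> f s = 0) \<Longrightarrow> (\<And>s. s \<in> B \<Longrightarrow> f s = 1) \<Longrightarrow>
      dirichlet (configs N) (conductance N (boltzmann \<beta> g N)) h \<le> dirichlet (configs N) (conductance N (boltzmann \<beta> g N)) f"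
proof -
  let ?Z = "partition_sum TYPE('q) \<beta> g N" and ?K = "metropolis \<beta> g N :: _ \<Rightarrow> (nat \<Rightarrow> 'q) pmf" and ?mu = "gibbs \<beta> g N :: (nat \<Rightarrow> 'q) pmf"
  let ?c = "real N * real CARD('q) * ?Z"
  have Z: "0 < ?Z" by (rule partition_sum_pos)
  have c: "0 < ?c" using N Z by (simp add: card_gt_0_iff)
  have rev: "pmf ?mu s * pmf (?K s) t = pmf ?mu t * pmf (?K t) s" if "s \<in> configs N" "t \<in> configs N" for s t
    using that by (cases "s = t") (simp_all add: detailed_balance[OF N \<beta>] conductance_def adjacent_sym[of N t s] min.commute)
  have D: "dirichlet (configs N) (\<lambda>s t. pmf ?mu s * pmf (?K s) t) f = dirichlet (configs N) (conductance N (boltzmann \<beta> g N)) f / ?c" for f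
  proof -
    have "(\<Sum>s\<in>configs N. \<Sum>t\<in>configs N. pmf ?mu s * pmf (?K s) t * (f s - f t)\<^sup>2) = (\<Sum>s\<in>configs N. \<Sum>t\<in>configs N. conductance N (boltzmann \<beta> g N) s t * (f s - f t)\<^sup>2 / ?c)"
    proof (intro sum.cong refl)
      fix s t :: "nat \<Rightarrow> 'q" assume "s \<in> configs N" "t \<in> configs N"
      then show "pmf ?mu s * pmf (?K s) t * (f s - f t)\<^sup>2 = conductance N (boltzmann \<beta> g N) s t * (f s - f t)\<^sup>2 / ?c"
        by (cases "s = t") (simp_all add: detailed_balance[OF N \<beta>])
    qed
    then show ?thesis by (simp add: dirichlet_def sum_divide_distrib[symmetric])
  qed
  have mu: "set_pmf ?mu \<subseteq> configs N" "set_pmf ?mu \<inter> A \<noteq> {}" unfolding set_pmf_gibbs using AB by auto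
  obtain h where h: "\<And>s. s \<in> A \<Longrightarrow> h s = 0" "\<And>s. s \<in> B \<Longrightarrow> h s = 1"
    "(\<Sum>s\<in>A. pmf ?mu s) * prob_hits_before ?K (cond_pmf ?mu A) B A = dirichlet (configs N) (\<lambda>s t. pmf ?mu s * pmf (?K s) t) h"
    "\<And>f. (\<And>s. s \<in> A \<Longrightarrow> f s = 0) \<Longrightarrow> (\<And>s. s \<in> B \<Longrightarrow> f s = 1) \<Longrightarrow>
      dirichlet (configs N) (\<lambda>s t. pmf ?mu s * pmf (?K s) t) h \<le> dirichlet (configs N) (\<lambda>s t. pmf ?mu s * pmf (?K s) t) f"
    using prob_hits_before_dirichlet[OF finite_configs AB(1-3) mu set_pmf_metropolis[OF N \<beta>] rev] by blast
  have "(\<Sum>s\<in>A. pmf ?mu s) = (\<Sum>s\<in>A. boltzmann \<beta> g N s) / ?Z"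
    unfolding sum_divide_distrib by (rule sum.cong) (use AB in \<open>auto simp: pmf_gibbs\<close>)
  then have "(\<Sum>s\<in>A. boltzmann \<beta> g N s) * (real N * real CARD('q)) * prob_hits_before ?K (cond_pmf ?mu A) B A
      = dirichlet (configs N) (conductance N (boltzmann \<beta> g N)) h"
  proof -
    have *: "w * nq * P = d" if "w / Z * P = d / (nq * Z)" "0 < Z" "0 < nq" for w Z P d nq :: real
      using that by (simp add: field_simps)
    assume w: "(\<Sum>s\<in>A. pmf ?mu s) = (\<Sum>s\<in>A. boltzmann \<beta> g N s) / ?Z"
    show ?thesis
      by (rule *[OF h(3)[unfolded D w] Z]) (use N in \<open>simp add: card_gt_0_iff\<close>)
  qed
  moreover have "dirichlet (configs N) (conductance N (boltzmann \<beta> g N)) h \<le> dirichlet (configs N) (conductance N (boltzmann \<beta> g N)) f"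
    if "\<And>s. s \<in> A \<Longrightarrow> f s = 0" "\<And>s. s \<in> B \<Longrightarrow> f s = 1" for f
    using h(4)[of f] that c unfolding D by (simp add: divide_le_cancel)
  ultimately show ?thesis using h(1,2) that[of h] by blast
qed

definition close_to_mean :: "'q::finite itself \<Rightarrow> real \<Rightarrow> (nat \<Rightarrow> nat \<Rightarrow> real) \<Rightarrow> nat \<Rightarrow> bool" where
  "close_to_mean _ e g N \<longleftrightarrow> (\<forall>\<sigma>\<in>(configs N :: (nat \<Rightarrow> 'q) set). \<bar>hamiltonian g N \<sigma> - hamiltonian (\<lambda>_ _. 1) N \<sigma>\<bar> \<le> e * real N)"

lemma boltzmann_close:
  assumes "0 < \<beta>" "close_to_mean TYPE('q::finite) e g N" "(\<sigma> :: nat \<Rightarrow> 'q) \<in> configs N"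
  shows "boltzmann \<beta> g N \<sigma> \<le> exp (\<beta> * e * real N) * boltzmann1 \<beta> N \<sigma>" "boltzmann1 \<beta> N \<sigma> \<le> exp (\<beta> * e * real N) * boltzmann \<beta> g N \<sigma>"
proof -
  let ?d = "hamiltonian g N \<sigma> - hamiltonian (\<lambda>_ _. 1) N \<sigma>"
  have "\<bar>?d\<bar> \<le> e * real N" using assms(2,3) by (auto simp: close_to_mean_def)
  then have "\<beta> * \<bar>?d\<bar> \<le> \<beta> * (e * real N)" using assms(1) by (intro mult_left_mono) auto
  moreover have "\<bar>\<beta> * ?d\<bar> = \<beta> * \<bar>?d\<bar>" using assms(1) by (simp add: abs_mult)
  ultimately have "\<bar>\<beta> * ?d\<bar> \<le> \<beta> * (e * real N)" by simp
  then have *: "\<beta> * ?d \<le> \<beta> * (e * real N)" "- (\<beta> * (e * real N)) \<le> \<beta> * ?d" by auto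
  show "boltzmann \<beta> g N \<sigma> \<le> exp (\<beta> * e * real N) * boltzmann1 \<beta> N \<sigma>" "boltzmann1 \<beta> N \<sigma> \<le> exp (\<beta> * e * real N) * boltzmann \<beta> g N \<sigma>"
    using * by (simp_all add: boltzmann_def exp_add[symmetric] algebra_simps)
qed

lemma dirichlet_close:
  fixes f :: "(nat \<Rightarrow> 'q::finite) \<Rightarrow> real"
  assumes "0 < \<beta>" "close_to_mean TYPE('q) e g N"
  shows "dirichlet (configs N) (conductance N (boltzmann1 \<beta> N)) f \<le> exp (\<beta> * e * real N) * dirichlet (configs N) (conductance N (boltzmann \<beta> g N)) f"
proof -
  have "(\<Sum>s\<in>configs N. \<Sum>t\<in>configs N. conductance N (boltzmann1 \<beta> N) s t * (f s - f t)\<^sup>2) \<le>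
    (\<Sum>s\<in>configs N. \<Sum>t\<in>configs N. exp (\<beta> * e * real N) * (conductance N (boltzmann \<beta> g N) s t * (f s - f t)\<^sup>2))"
  proof (intro sum_mono)
    fix s t :: "nat \<Rightarrow> 'q" assume st: "s \<in> configs N" "t \<in> configs N"
    have "conductance N (boltzmann1 \<beta> N) s t \<le> exp (\<beta> * e * real N) * conductance N (boltzmann \<beta> g N) s t"
      using boltzmann_close(2)[OF assms st(1)] boltzmann_close(2)[OF assms st(2)] by (auto simp: conductance_def min_def)
    then show "conductance N (boltzmann1 \<beta> N) s t * (f s - f t)\<^sup>2 \<le> exp (\<beta> * e * real N) * (conductance N (boltzmann \<beta> g N) s t * (f s - f t)\<^sup>2)"
      unfolding mult.assoc[symmetric] by (rule mult_right_mono) simp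
  qed
  then show ?thesis unfolding dirichlet_def by (simp add: sum_distrib_left[symmetric])
qed

text \<open>For the equilibrium potential \<open>h\<close> the function \<open>1 - h\<close> vanishes on \<open>U\<close> and is 1 on \<open>X\<close>, so the
  Poincare inequality bounds the weight of \<open>X\<close> by the Dirichlet form of \<open>h\<close>. The passage between
  mean-field and disordered weights costs the factor \<open>exp (\<beta> * e * N)\<close> twice.\<close>

lemma escape_lower_bound:
  fixes U X :: "(nat \<Rightarrow> 'q::finite) set"
  assumes N: "1 \<le> N" and \<beta>: "0 < \<beta>" and g: "close_to_mean TYPE('q) e g N"
    and P: "\<And>u :: (nat \<Rightarrow> 'q) \<Rightarrow> real. (\<forall>\<sigma>\<in>U. u \<sigma> = 0) \<Longrightarrow>
      (\<Sum>\<sigma>\<in>configs N. boltzmann1 \<beta> N \<sigma> * (u \<sigma>)\<^sup>2) \<le> C * dirichlet (configs N) (conductance N (boltzmann1 \<beta> N)) u"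
    and C: "0 < C" and U: "U \<subseteq> configs N" and X: "X \<noteq> {}" "X \<subseteq> configs N - U"
  shows "1 / (C * exp (2 * \<beta> * e * real N) * (real N * real CARD('q))) \<le> prob_hits_before (metropolis \<beta> g N) (cond_pmf (gibbs \<beta> g N) X) U X"
proof -
  let ?P = "prob_hits_before (metropolis \<beta> g N) (cond_pmf (gibbs \<beta> g N) X) U X"
  let ?w = "\<Sum>s\<in>X. boltzmann \<beta> g N s" and ?E = "exp (\<beta> * e * real N)"
  have fX: "finite X" using X finite_configs finite_subset by (metis Diff_subset order_trans)
  have w: "0 < ?w" by (rule sum_pos) (use X fX in auto)
  have nq: "0 < real N * real CARD('q)" using N by (simp add: card_gt_0_iff)
  obtain h where h: "\<And>s. s \<in> X \<Longrightarrow> h s = 0" "\<And>s. s \<in> U \<Longrightarrow> h s = 1"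
    "?w * (real N * real CARD('q)) * ?P = dirichlet (configs N) (conductance N (boltzmann \<beta> g N)) h"
    by (rule hits_before_dirichlet[OF N \<beta>, of X U g]) (use X U in blast)+
  define u where "u s = 1 - h s" for s
  have "?w \<le> (\<Sum>s\<in>X. ?E * boltzmann1 \<beta> N s)" by (rule sum_mono) (use X boltzmann_close(1)[OF \<beta> g] in blast)
  also have "\<dots> = ?E * (\<Sum>s\<in>X. boltzmann1 \<beta> N s)" by (simp add: sum_distrib_left)
  also have "(\<Sum>s\<in>X. boltzmann1 \<beta> N s) = (\<Sum>s\<in>X. boltzmann1 \<beta> N s * (u s)\<^sup>2)" by (rule sum.cong) (auto simp: u_def h)
  also have "\<dots> \<le> (\<Sum>s\<in>configs N. boltzmann1 \<beta> N s * (u s)\<^sup>2)" by (rule sum_mono2) (use X finite_configs in auto)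
  also have "\<dots> \<le> C * dirichlet (configs N) (conductance N (boltzmann1 \<beta> N)) u" by (rule P) (auto simp: u_def h)
  also have "dirichlet (configs N) (conductance N (boltzmann1 \<beta> N)) u = dirichlet (configs N) (conductance N (boltzmann1 \<beta> N)) h"
    by (simp add: dirichlet_def u_def power2_commute)
  also have "C * \<dots> \<le> C * (?E * dirichlet (configs N) (conductance N (boltzmann \<beta> g N)) h)"
    using C by (intro mult_left_mono dirichlet_close[OF \<beta> g]) auto
  also have "dirichlet (configs N) (conductance N (boltzmann \<beta> g N)) h = ?w * (real N * real CARD('q)) * ?P" using h(3) by simp
  finally have "?w \<le> ?w * (C * (?E * ?E) * (real N * real CARD('q)) * ?P)" by (simp add: algebra_simps)
  then have "1 \<le> C * (?E * ?E) * (real N * real CARD('q)) * ?P" using w by simp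
  moreover have "?E * ?E = exp (2 * \<beta> * e * real N)" by (simp add: exp_add[symmetric])
  ultimately show ?thesis using C nq by (simp add: divide_le_eq mult.commute mult_pos_pos)
qed

lemma adjacent_unit_moves:
  assumes "\<sigma> \<in> configs N" "\<eta> \<in> configs N" "adjacent N \<sigma> \<eta>"
  shows "(colour_count N \<sigma>, colour_count N (\<eta> :: nat \<Rightarrow> 'q::finite)) \<in> unit_moves"
proof -
  obtain i b where i: "i \<in> {1..N}" "\<sigma> i \<noteq> b" "\<eta> = \<sigma>(i := b)" using assms adjacent_iff by blast
  have "\<sigma>(i := b) \<in> level N (move_unit (\<sigma> i) b (colour_count N \<sigma>))"
    by (rule flip_level) (use i assms(1) in \<open>auto simp: level_def\<close>)
  then have "colour_count N \<eta> = move_unit (\<sigma> i) b (colour_count N \<sigma>)" using i(3) by (simp add: level_def)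
  moreover have "0 < colour_count N \<sigma> (\<sigma> i)" unfolding colour_count_def using i(1) by (auto simp: card_gt_0_iff)
  ultimately show ?thesis unfolding unit_moves_def using i(2) by blast
qed

text \<open>The test function is 0 on the configurations whose level can be reached from \<open>n\<close> inside \<open>G\<close>, and 1
  elsewhere. An edge on which it varies has an end outside \<open>G\<close>, whose weight bounds the conductance.\<close>

lemma escape_upper_bound:
  fixes A B :: "(nat \<Rightarrow> 'q::finite) set" and n :: "'q \<Rightarrow> nat"
  assumes N: "1 \<le> N" and \<beta>: "0 < \<beta>" and n: "n \<in> compositions N" "n \<in> G" and A: "A = level N n" and B: "B \<subseteq> configs N"
    and sep: "\<And>\<sigma>. \<sigma> \<in> B \<Longrightarrow> (n, colour_count N \<sigma>) \<notin> (unit_moves \<inter> G \<times> G)\<^sup>*"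
  shows "prob_hits_before (metropolis \<beta> g N) (cond_pmf (gibbs \<beta> g N) A) B A * (\<Sum>\<sigma>\<in>A. boltzmann \<beta> g N \<sigma>)
    \<le> (\<Sum>\<sigma>\<in>{\<sigma>\<in>configs N. colour_count N \<sigma> \<notin> G}. boltzmann \<beta> g N \<sigma>)"
proof -
  let ?P = "prob_hits_before (metropolis \<beta> g N) (cond_pmf (gibbs \<beta> g N) A) B A"
  let ?w = "boltzmann \<beta> g N :: (nat \<Rightarrow> 'q) \<Rightarrow> real"
  let ?D = "dirichlet (configs N) (conductance N ?w)"
  let ?nq = "real N * real CARD('q)"
  have nq: "0 < ?nq" using N by (simp add: card_gt_0_iff)
  define C where "C = {\<sigma>. (n, colour_count N \<sigma>) \<in> (unit_moves \<inter> G \<times> G)\<^sup>*}"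
  define f where "f \<sigma> = (if \<sigma> \<in> C then 0 else 1 :: real)" for \<sigma> :: "nat \<Rightarrow> 'q"
  have AC: "A \<subseteq> C" unfolding A C_def by (auto simp: level_def)
  have A': "A \<subseteq> configs N" "A \<noteq> {}" using level_nonempty[OF n(1)] by (force simp: A level_def) (use level_nonempty[OF n(1)] A in force)
  have AB: "A \<inter> B = {}" using AC sep by (auto simp: C_def)
  obtain h where h: "(\<Sum>s\<in>A. ?w s) * ?nq * ?P = ?D h"
    "\<And>f. (\<And>s. s \<in> A \<Longrightarrow> f s = 0) \<Longrightarrow> (\<And>s. s \<in> B \<Longrightarrow> f s = 1) \<Longrightarrow> ?D h \<le> ?D f"
    using hits_before_dirichlet[OF N \<beta> A'(1) B AB A'(2), of g] by metis
  have "?D h \<le> ?D f" by (rule h(2)) (use AC sep in \<open>auto simp: f_def C_def\<close>)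
  let ?H = "\<lambda>\<sigma>. if colour_count N \<sigma> \<notin> G then ?w \<sigma> else 0"
  let ?a = "\<lambda>\<sigma> \<eta>. if adjacent N \<sigma> \<eta> then 1 else 0 :: real"
  have CG: "colour_count N \<sigma> \<in> G" if "\<sigma> \<in> C" for \<sigma>
    using that n(2) unfolding C_def by (auto elim: rtranclE)
  have out: "colour_count N \<eta> \<notin> G" if "\<sigma> \<in> configs N" "\<eta> \<in> configs N" "adjacent N \<sigma> \<eta>" "\<sigma> \<in> C" "\<eta> \<notin> C" for \<sigma> \<eta>
  proof
    assume "colour_count N \<eta> \<in> G"
    then have "(colour_count N \<sigma>, colour_count N \<eta>) \<in> unit_moves \<inter> G \<times> G"
      using adjacent_unit_moves[OF that(1-3)] CG[OF that(4)] by blast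
    then show False using that(4,5) unfolding C_def by (auto intro: rtrancl_into_rtrancl)
  qed
  have edge: "conductance N ?w \<sigma> \<eta> * (f \<sigma> - f \<eta>)\<^sup>2 \<le> ?a \<sigma> \<eta> * ?H \<eta> + ?a \<eta> \<sigma> * ?H \<sigma>" if st: "\<sigma> \<in> configs N" "\<eta> \<in> configs N" for \<sigma> \<eta>
  proof (cases "adjacent N \<sigma> \<eta>")
    case False
    then show ?thesis by (simp add: conductance_def)
  next
    case adj: True
    then have adj': "adjacent N \<eta> \<sigma>" by (simp add: adjacent_sym)
    consider "\<sigma> \<in> C" "\<eta> \<notin> C" | "\<sigma> \<notin> C" "\<eta> \<in> C" | "(\<sigma> \<in> C) = (\<eta> \<in> C)" by blast
    then show ?thesis
    proof cases
      case 1 then show ?thesis using out[OF st adj] adj adj' boltzmann_pos(2)[of \<beta> g N \<sigma>] boltzmann_pos(2)[of \<beta> g N \<eta>]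
        by (auto simp: f_def conductance_def min_def simp del: boltzmann_pos)
    next
      case 2 then show ?thesis using out[OF st(2,1) adj'] adj adj' boltzmann_pos(2)[of \<beta> g N \<sigma>] boltzmann_pos(2)[of \<beta> g N \<eta>]
        by (auto simp: f_def conductance_def min_def simp del: boltzmann_pos)
    next
      case 3 then show ?thesis by (auto simp: f_def)
    qed
  qed
  have "2 * ?D f \<le> (\<Sum>\<sigma>\<in>configs N. \<Sum>\<eta>\<in>configs N. ?a \<sigma> \<eta> * ?H \<eta> + ?a \<eta> \<sigma> * ?H \<sigma>)"
    unfolding dirichlet_def by (simp, intro sum_mono edge) auto
  also have "\<dots> = (\<Sum>\<sigma>\<in>configs N. \<Sum>\<eta>\<in>configs N. ?a \<sigma> \<eta> * ?H \<eta>) + (\<Sum>\<sigma>\<in>configs N. \<Sum>\<eta>\<in>configs N. ?a \<eta> \<sigma> * ?H \<sigma>)"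
    by (simp only: sum.distrib)
  also have "(\<Sum>\<sigma>\<in>configs N. \<Sum>\<eta>\<in>configs N. ?a \<sigma> \<eta> * ?H \<eta>) = (\<Sum>\<eta>\<in>configs N. \<Sum>\<sigma>\<in>configs N. ?a \<sigma> \<eta> * ?H \<eta>)"
    by (rule sum.swap)
  finally have "?D f \<le> (\<Sum>\<eta>\<in>configs N. \<Sum>\<sigma>\<in>configs N. ?a \<sigma> \<eta> * ?H \<eta>)" by simp
  also have "\<dots> \<le> (\<Sum>\<eta>\<in>configs N. ?nq * ?H \<eta>)"
  proof (rule sum_mono)
    fix \<eta> :: "nat \<Rightarrow> 'q" assume e: "\<eta> \<in> configs N"
    have "(\<Sum>\<sigma>\<in>configs N. ?a \<sigma> \<eta>) = real (card {\<sigma>\<in>configs N. adjacent N \<eta> \<sigma>})"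
      by (subst adjacent_sym) (simp add: sum.inter_filter[symmetric] finite_configs)
    also have "\<dots> \<le> real (N * CARD('q))" using card_adjacent[OF e] by (simp only: of_nat_le_iff)
    finally have "(\<Sum>\<sigma>\<in>configs N. ?a \<sigma> \<eta>) \<le> ?nq" by simp
    then have "(\<Sum>\<sigma>\<in>configs N. ?a \<sigma> \<eta>) * ?H \<eta> \<le> ?nq * ?H \<eta>" by (rule mult_right_mono) auto
    then show "(\<Sum>\<sigma>\<in>configs N. ?a \<sigma> \<eta> * ?H \<eta>) \<le> ?nq * ?H \<eta>" by (simp only: sum_distrib_right)
  qed
  also have "\<dots> = ?nq * (\<Sum>\<sigma>\<in>{\<sigma>\<in>configs N. colour_count N \<sigma> \<notin> G}. ?w \<sigma>)"
    by (simp only: sum_distrib_left[symmetric] sum.inter_filter[OF finite_configs])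
  finally have "?nq * (?P * (\<Sum>s\<in>A. ?w s)) \<le> ?nq * (\<Sum>\<sigma>\<in>{\<sigma>\<in>configs N. colour_count N \<sigma> \<notin> G}. ?w \<sigma>)"
    using h(1) \<open>?D h \<le> ?D f\<close> by (simp add: mult.commute mult.left_commute)
  then show ?thesis using nq by (simp only: mult_le_cancel_left_pos)
qed

section \<open>Concentration of the disordered energy\<close>

lemma exp_le_quadratic: "exp y \<le> 1 + y + y\<^sup>2 * exp \<bar>y\<bar>" for y :: real
proof -
  obtain t where t: "\<bar>t\<bar> \<le> \<bar>y\<bar>" "exp y = (\<Sum>m<2. y ^ m / fact m) + exp t / fact 2 * y ^ 2"
    using Maclaurin_exp_le[of y 2] by blast
  have "exp t / 2 * y\<^sup>2 \<le> exp \<bar>y\<bar> * y\<^sup>2"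
  proof (rule mult_right_mono)
    have "exp t \<le> exp \<bar>y\<bar>" using t(1) by auto
    moreover have "0 < exp t" by simp
    ultimately show "exp t / 2 \<le> exp \<bar>y\<bar>" by linarith
  qed simp
  then show ?thesis using t(2) by (simp add: numeral_2_eq_2 mult.commute)
qed

text \<open>The linear term of the exponential has mean 0, and the remainder is dominated by \<open>l\<^sup>2\<close> times an
  integrable function, because \<open>x\<^sup>2\<close> is bounded by an exponential of \<open>\<bar>x\<bar>\<close>.\<close>

lemma (in prob_space) mgf_quadratic_bound:
  assumes X: "random_variable borel X" "integrable M X" "expectation X = 0" and a: "0 < a"
    and int: "integrable M (\<lambda>\<omega>. exp (a * X \<omega>))" "integrable M (\<lambda>\<omega>. exp (- a * X \<omega>))"
  obtains C where "0 \<le> C" "\<And>l. \<bar>l\<bar> \<le> a / 2 \<Longrightarrow> (\<integral>\<^sup>+\<omega>. ennreal (exp (l * X \<omega>)) \<partial>M) \<le> ennreal (exp (C * l\<^sup>2))"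
proof -
  let ?S = "\<lambda>\<omega>. exp (a * X \<omega>) + exp (- a * X \<omega>)"
  define C where "C = 8 / a\<^sup>2 * expectation ?S"
  have "0 \<le> expectation ?S" by (intro Bochner_Integration.integral_nonneg) (auto intro: add_nonneg_nonneg)
  then have C: "0 \<le> C" by (simp add: C_def)
  have "(\<integral>\<^sup>+\<omega>. ennreal (exp (l * X \<omega>)) \<partial>M) \<le> ennreal (exp (C * l\<^sup>2))" if l: "\<bar>l\<bar> \<le> a / 2" for l
  proof -
    let ?B = "\<lambda>\<omega>. 1 + l * X \<omega> + l\<^sup>2 * (8 / a\<^sup>2) * ?S \<omega>"
    have le: "exp (l * x) \<le> 1 + l * x + l\<^sup>2 * (8 / a\<^sup>2) * (exp (a * x) + exp (- a * x))" for x
    proof -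
      let ?t = "a * \<bar>x\<bar> / 2"
      have "0 \<le> ?t" using a by simp
      then have "?t\<^sup>2 / 2 \<le> exp ?t" using exp_lower_Taylor_quadratic[of ?t] by linarith
      then have x2: "x\<^sup>2 \<le> 8 / a\<^sup>2 * exp ?t" using a by (simp add: field_simps power2_eq_square)
      have "\<bar>l\<bar> * \<bar>x\<bar> \<le> a / 2 * \<bar>x\<bar>" using l by (intro mult_right_mono) auto
      then have "\<bar>l * x\<bar> \<le> ?t" by (simp add: abs_mult)
      then have e: "exp \<bar>l * x\<bar> \<le> exp ?t" by simp
      have "x\<^sup>2 * exp \<bar>l * x\<bar> \<le> 8 / a\<^sup>2 * exp ?t * exp ?t" by (rule mult_mono[OF x2 e]) auto
      also have "\<dots> = 8 / a\<^sup>2 * exp (a * \<bar>x\<bar>)" by (simp add: mult.assoc exp_add[symmetric])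
      also have "\<dots> \<le> 8 / a\<^sup>2 * (exp (a * x) + exp (- a * x))"
        by (intro mult_left_mono) (auto simp: abs_if)
      finally have "l\<^sup>2 * (x\<^sup>2 * exp \<bar>l * x\<bar>) \<le> l\<^sup>2 * (8 / a\<^sup>2 * (exp (a * x) + exp (- a * x)))" by (rule mult_left_mono) simp
      then show ?thesis using exp_le_quadratic[of "l * x"] by (simp add: power_mult_distrib mult.assoc)
    qed
    have intB: "integrable M ?B" using X int by (intro Bochner_Integration.integrable_add integrable_mult_right) auto
    have "0 \<le> ?B \<omega>" for \<omega> using le[of "X \<omega>"] by (rule order_trans[rotated]) simp
    then have "(\<integral>\<^sup>+\<omega>. ennreal (?B \<omega>) \<partial>M) = ennreal (expectation ?B)" by (intro nn_integral_eq_integral intB) auto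
    also have "expectation ?B = 1 + C * l\<^sup>2"
    proof -
      have "expectation ?B = expectation (\<lambda>\<omega>. 1 + l * X \<omega>) + expectation (\<lambda>\<omega>. l\<^sup>2 * (8 / a\<^sup>2) * ?S \<omega>)"
        by (rule Bochner_Integration.integral_add) (use X int in auto)
      also have "expectation (\<lambda>\<omega>. 1 + l * X \<omega>) = 1" using X by (simp add: prob_space)
      also have "expectation (\<lambda>\<omega>. l\<^sup>2 * (8 / a\<^sup>2) * ?S \<omega>) = l\<^sup>2 * (8 / a\<^sup>2) * expectation ?S" by simp
      finally show ?thesis by (simp add: C_def)
    qed
    also have "1 + C * l\<^sup>2 \<le> exp (C * l\<^sup>2)" by (rule exp_ge_add_one_self)
    finally have "(\<integral>\<^sup>+\<omega>. ennreal (?B \<omega>) \<partial>M) \<le> ennreal (exp (C * l\<^sup>2))" by (simp add: ennreal_leI)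
    moreover have "(\<integral>\<^sup>+\<omega>. ennreal (exp (l * X \<omega>)) \<partial>M) \<le> (\<integral>\<^sup>+\<omega>. ennreal (?B \<omega>) \<partial>M)"
      by (intro nn_integral_mono ennreal_leI le)
    ultimately show ?thesis by simp
  qed
  then show ?thesis using that C by blast
qed

lemma (in prob_space) chernoff_sum:
  fixes X :: "'i \<Rightarrow> 'a \<Rightarrow> real"
  assumes T: "finite T" and ind: "indep_vars (\<lambda>_. borel) X T"
    and mgf: "\<And>i. i \<in> T \<Longrightarrow> (\<integral>\<^sup>+\<omega>. ennreal (exp (l * X i \<omega>)) \<partial>M) \<le> ennreal (exp D)"
  shows "prob {\<omega>\<in>space M. c \<le> l * (\<Sum>i\<in>T. X i \<omega>)} \<le> exp (- c + real (card T) * D)"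
proof -
  let ?u = "\<lambda>\<omega>. \<Prod>i\<in>T. ennreal (exp (l * X i \<omega>))"
  have rv: "X i \<in> borel_measurable M" if "i \<in> T" for i using ind that by (auto simp: indep_vars_def)
  have um: "?u \<in> borel_measurable M" using rv by (intro borel_measurable_prod_ennreal) measurable
  have u: "?u \<omega> = ennreal (exp (l * (\<Sum>i\<in>T. X i \<omega>)))" for \<omega>
    using T by (simp add: prod_ennreal exp_sum sum_distrib_left)
  have "(\<integral>\<^sup>+\<omega>. ?u \<omega> \<partial>M) = (\<Prod>i\<in>T. \<integral>\<^sup>+\<omega>. ennreal (exp (l * X i \<omega>)) \<partial>M)"
    by (rule indep_vars_nn_integral[OF T]) (auto intro!: indep_vars_compose2[OF ind])
  also have "\<dots> \<le> (\<Prod>i\<in>T. ennreal (exp D))" 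
    using T mgf by (induction T rule: finite_induct) (auto intro: mult_mono)
  also have "\<dots> = ennreal (exp (real (card T) * D))"
    by (simp add: ennreal_power exp_of_nat_mult)
  finally have Eu: "(\<integral>\<^sup>+\<omega>. ?u \<omega> \<partial>M) \<le> ennreal (exp (real (card T) * D))" .
  have set_eq: "{\<omega>\<in>space M. c \<le> l * (\<Sum>i\<in>T. X i \<omega>)} = {\<omega>\<in>space M. 1 \<le> ennreal (exp (- c)) * ?u \<omega>}"
    unfolding u by (simp add: ennreal_mult'[symmetric] exp_add[symmetric] ennreal_1[symmetric] ennreal_le_iff del: ennreal_1)
  have "emeasure M {\<omega>\<in>space M. c \<le> l * (\<Sum>i\<in>T. X i \<omega>)} \<le> ennreal (exp (- c)) * (\<integral>\<^sup>+\<omega>. ?u \<omega> * indicator (space M) \<omega> \<partial>M)"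
    unfolding set_eq by (rule nn_integral_Markov_inequality) (use um in auto)
  also have "(\<integral>\<^sup>+\<omega>. ?u \<omega> * indicator (space M) \<omega> \<partial>M) = (\<integral>\<^sup>+\<omega>. ?u \<omega> \<partial>M)"
    by (rule nn_integral_cong) simp
  also have "ennreal (exp (- c)) * \<dots> \<le> ennreal (exp (- c)) * ennreal (exp (real (card T) * D))"
    by (rule mult_left_mono[OF Eu]) simp
  also have "\<dots> = ennreal (exp (- c + real (card T) * D))" by (simp add: ennreal_mult'[symmetric] exp_add[symmetric])
  finally show ?thesis by (simp add: emeasure_eq_measure)
qed

text \<open>For one configuration the sum of at most \<open>N\<^sup>2\<close> independent centred couplings exceeds \<open>e N\<^sup>2\<close> with
  probability of order \<open>exp (- w N\<^sup>2)\<close>. This outweighs the number of configurations, which is only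
  exponential in \<open>N\<close>, and the Borel-Cantelli lemma applies.\<close>

lemma AE_close_to_mean:
  fixes M :: "'a measure" and J :: "nat \<Rightarrow> nat \<Rightarrow> 'a \<Rightarrow> real"
  assumes ps: "prob_space M"
    and ind: "prob_space.indep_vars M (\<lambda>_. borel) (\<lambda>(i, j). J i j) {(i, j). 1 \<le> i \<and> i < j}"
    and iid: "\<And>i j. 1 \<le> i \<Longrightarrow> i < j \<Longrightarrow> distr M borel (J i j) = distr M borel (J 1 2)"
    and int: "integrable M (J 1 2)" "prob_space.expectation M (J 1 2) = 1"
    and mgf: "0 \<in> interior {l. integrable M (\<lambda>\<omega>. exp (l * J 1 2 \<omega>))}"
    and e: "0 < e"
  shows "AE \<omega> in M. \<forall>\<^sub>F N in sequentially. close_to_mean TYPE('q::finite) e (\<lambda>i j. J i j \<omega>) N"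
proof -
  interpret prob_space M by (rule ps)
  let ?I = "{(i, j). 1 \<le> i \<and> i < j} :: (nat \<times> nat) set"
  let ?X = "\<lambda>(i, j) \<omega>. J i j \<omega> - 1 :: real"
  have rv: "J i j \<in> borel_measurable M" if "1 \<le> i" "i < j" for i j
    using ind that by (force simp: indep_vars_def)
  have "indep_vars (\<lambda>_. borel) (\<lambda>p \<omega>. (case p of (i, j) \<Rightarrow> J i j) \<omega> - 1) ?I"
    by (rule indep_vars_compose2[OF ind]) auto
  then have indX: "indep_vars (\<lambda>_. borel) ?X ?I" by (simp add: case_prod_beta')
  obtain d where d: "0 < d" "ball 0 d \<subseteq> {l. integrable M (\<lambda>\<omega>. exp (l * J 1 2 \<omega>))}"
    using mgf unfolding mem_interior by blast
  define a where "a = d / 2"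
  have a: "0 < a" using d by (simp add: a_def)
  have intJ: "integrable M (\<lambda>\<omega>. exp (l * J 1 2 \<omega>))" if "\<bar>l\<bar> = a" for l
    using d that by (auto simp: a_def subset_iff)
  have intX: "integrable M (\<lambda>\<omega>. exp (l * (J 1 2 \<omega> - 1)))" if "\<bar>l\<bar> = a" for l
    using integrable_mult_right[OF intJ[OF that], of "exp (- l)"] by (simp add: exp_add[symmetric] algebra_simps)
  have rv12: "J 1 2 \<in> borel_measurable M" by (rule rv) auto
  obtain C where C: "0 \<le> C" "\<And>l. \<bar>l\<bar> \<le> a / 2 \<Longrightarrow> (\<integral>\<^sup>+\<omega>. ennreal (exp (l * (J 1 2 \<omega> - 1))) \<partial>M) \<le> ennreal (exp (C * l\<^sup>2))"
  proof (rule mgf_quadratic_bound[of "\<lambda>\<omega>. J 1 2 \<omega> - 1" a])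
    show "expectation (\<lambda>\<omega>. J 1 2 \<omega> - 1) = 0" using int by (simp add: prob_space)
  qed (use rv12 int a intX[of a] intX[of "- a"] in auto)
  \<comment> \<open>Small enough for the quadratic term \<open>C * l\<^sup>2\<close> to be at most half of the linear gain \<open>l * e\<close>.\<close>
  define l where "l = min (a / 2) (e / (2 * (C + 1)))"
  have "0 < l" using a e C(1) by (simp add: l_def)
  moreover have "l \<le> a / 2" unfolding l_def by (rule min.cobounded1)
  ultimately have l: "0 < l" "\<bar>l\<bar> \<le> a / 2" "\<bar>- l\<bar> \<le> a / 2" by auto
  have Cl: "C * l \<le> e / 2"
  proof -
    have "C * l \<le> (C + 1) * (e / (2 * (C + 1)))" using C(1) l(1) by (intro mult_mono) (auto simp: l_def)
    also have "\<dots> = e / 2" using C(1) by (simp add: field_simps)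
    finally show ?thesis .
  qed
  have mgfX: "(\<integral>\<^sup>+\<omega>. ennreal (exp (l * ?X p \<omega>)) \<partial>M) \<le> ennreal (exp (C * l\<^sup>2))" if p: "p \<in> ?I" and l: "\<bar>l\<bar> \<le> a / 2" for p l
  proof -
    obtain i j where ij: "p = (i, j)" "1 \<le> i" "i < j" using p by auto
    have "(\<integral>\<^sup>+\<omega>. ennreal (exp (l * (J i j \<omega> - 1))) \<partial>M) = (\<integral>\<^sup>+y. ennreal (exp (l * (y - 1))) \<partial>distr M borel (J i j))"
      using rv[OF ij(2,3)] by (subst nn_integral_distr) auto
    also have "\<dots> = (\<integral>\<^sup>+\<omega>. ennreal (exp (l * (J 1 2 \<omega> - 1))) \<partial>M)"
      unfolding iid[OF ij(2,3)] using rv12 by (subst nn_integral_distr) auto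
    also have "\<dots> \<le> ennreal (exp (C * l\<^sup>2))" by (rule C(2)[OF l])
    finally show ?thesis by (simp add: ij(1))
  qed
  define T where "T N \<sigma> = {(i, j). 1 \<le> i \<and> i < j \<and> j \<le> N \<and> \<sigma> i = \<sigma> j}" for N and \<sigma> :: "nat \<Rightarrow> 'q"
  have Tsub: "T N \<sigma> \<subseteq> ?I" "T N \<sigma> \<subseteq> {1..N} \<times> {1..N}" for N \<sigma> by (auto simp: T_def)
  have Tfin: "finite (T N \<sigma>)" for N \<sigma> by (rule finite_subset[OF Tsub(2)]) auto
  have Tcard: "real (card (T N \<sigma>)) \<le> (real N)\<^sup>2" for N \<sigma>
  proof -
    have "card (T N \<sigma>) \<le> card ({1..N} \<times> {1..N})" by (rule card_mono[OF _ Tsub(2)]) auto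
    then have "real (card (T N \<sigma>)) \<le> real (N * N)" by (simp only: card_cartesian_product card_atLeastAtMost of_nat_le_iff) simp
    then show ?thesis by (simp add: power2_eq_square)
  qed
  define S where "S N \<sigma> \<omega> = (\<Sum>p\<in>T N \<sigma>. ?X p \<omega>)" for N \<sigma> \<omega>
  define B where "B N \<sigma> s = {\<omega>\<in>space M. l * e * (real N)\<^sup>2 \<le> s * l * S N \<sigma> \<omega>}" for N \<sigma> and s :: real
  have Bp: "prob (B N \<sigma> s) \<le> exp (- (l * e / 2) * (real N)\<^sup>2)" if s: "\<bar>s\<bar> = 1" for N \<sigma> s
  proof -
    have sl: "\<bar>s * l\<bar> \<le> a / 2" "(s * l)\<^sup>2 = l\<^sup>2" using s l by (auto simp: abs_mult power_mult_distrib power2_eq_1_iff abs_if split: if_splits)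
    have "prob (B N \<sigma> s) \<le> exp (- (l * e * (real N)\<^sup>2) + real (card (T N \<sigma>)) * (C * l\<^sup>2))"
      unfolding B_def S_def
    proof (rule chernoff_sum[OF Tfin indep_vars_subset[OF indX Tsub(1)]])
      fix p assume "p \<in> T N \<sigma>"
      then have "p \<in> ?I" using Tsub(1) by blast
      from mgfX[OF this sl(1)] show "(\<integral>\<^sup>+\<omega>. ennreal (exp (s * l * ?X p \<omega>)) \<partial>M) \<le> ennreal (exp (C * l\<^sup>2))"
        unfolding sl(2) .
    qed
    also have "\<dots> \<le> exp (- (l * e / 2) * (real N)\<^sup>2)"
    proof -
      have "real (card (T N \<sigma>)) * (C * l\<^sup>2) \<le> (real N)\<^sup>2 * (C * l\<^sup>2)" using Tcard C(1) by (intro mult_right_mono) auto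
      also have "\<dots> = (real N)\<^sup>2 * l * (C * l)" by (simp add: power2_eq_square)
      also have "\<dots> \<le> (real N)\<^sup>2 * l * (e / 2)" using Cl l by (intro mult_left_mono) auto
      finally show ?thesis by (simp add: algebra_simps)
    qed
    finally show ?thesis .
  qed
  have Sm: "S N \<sigma> \<in> borel_measurable M" for N \<sigma>
  proof -
    have "?X p \<in> borel_measurable M" if p: "p \<in> T N \<sigma>" for p
    proof -
      obtain i j where ij: "p = (i, j)" "1 \<le> i" "i < j" using p unfolding T_def by blast
      show ?thesis using rv[OF ij(2,3)] by (simp add: ij(1))
    qed
    then show ?thesis unfolding S_def[abs_def] by (rule borel_measurable_sum)
  qed
  have Bm: "B N \<sigma> s \<in> sets M" for N \<sigma> s unfolding B_def using Sm by measurable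
  define A where "A N = (\<Union>\<sigma>\<in>configs N. B N \<sigma> 1 \<union> B N \<sigma> (-1))" for N
  have Am: "A N \<in> sets M" for N unfolding A_def using Bm finite_configs by (intro sets.finite_UN) auto
  define L where "L = ln (real CARD('q))"
  define w where "w = l * e / 2"
  have w: "0 < w" using l e by (simp add: w_def)
  have Ap: "prob (A N) \<le> 2 * exp (real N * L - w * (real N)\<^sup>2)" for N
  proof -
    have "prob (A N) \<le> (\<Sum>\<sigma>\<in>(configs N :: (nat \<Rightarrow> 'q) set). prob (B N \<sigma> 1 \<union> B N \<sigma> (-1)))"
      unfolding A_def by (rule measure_UNION_le) (use finite_configs Bm in auto)
    also have "\<dots> \<le> (\<Sum>\<sigma>\<in>(configs N :: (nat \<Rightarrow> 'q) set). 2 * exp (- w * (real N)\<^sup>2))"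
    proof (rule sum_mono)
      fix \<sigma> :: "nat \<Rightarrow> 'q"
      have "prob (B N \<sigma> 1 \<union> B N \<sigma> (-1)) \<le> prob (B N \<sigma> 1) + prob (B N \<sigma> (-1))" by (rule measure_Un_le) (auto simp: Bm)
      with Bp[of 1 N \<sigma>] Bp[of "-1" N \<sigma>] show "prob (B N \<sigma> 1 \<union> B N \<sigma> (-1)) \<le> 2 * exp (- w * (real N)\<^sup>2)" by (simp add: w_def)
    qed
    also have "\<dots> = 2 * (real CARD('q) ^ N * exp (- w * (real N)\<^sup>2))" by (simp add: card_configs)
    also have "real CARD('q) ^ N = exp (real N * L)" by (simp add: L_def exp_of_nat_mult)
    finally show ?thesis by (simp add: exp_add[symmetric])
  qed
  have "((\<lambda>x. 2 * exp (x * L - w * x\<^sup>2 + x)) \<longlongrightarrow> 0) at_top" using w by real_asymp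
  from filterlim_compose[OF this filterlim_real_sequentially]
  have "(\<lambda>N. 2 * exp (real N * L - w * (real N)\<^sup>2 + real N)) \<longlonglongrightarrow> 0" .
  from order_tendstoD(2)[OF this zero_less_one]
  have "\<forall>\<^sub>F N in sequentially. norm (prob (A N)) \<le> exp (- 1) ^ N"
  proof eventually_elim
    case (elim N)
    have "2 * exp (real N * L - w * (real N)\<^sup>2) = 2 * exp (real N * L - w * (real N)\<^sup>2 + real N) * exp (- real N)"
      by (simp add: exp_add[symmetric])
    also have "\<dots> \<le> 1 * exp (- real N)" using elim by (intro mult_right_mono) auto
    finally show ?case using Ap[of N] by (simp add: exp_of_nat_mult[symmetric])
  qed
  then have "summable (\<lambda>N. prob (A N))"
    by (rule summable_comparison_test_ev) (intro summable_geometric, simp)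
  then have "AE \<omega> in M. \<forall>\<^sub>F N in sequentially. \<omega> \<in> space M - A N"
    by (intro borel_cantelli_AE1 Am) (auto simp: emeasure_eq_measure)
  then show ?thesis
  proof (rule AE_mp, intro AE_I2 impI)
    fix \<omega> assume \<omega>: "\<omega> \<in> space M" and ev: "\<forall>\<^sub>F N in sequentially. \<omega> \<in> space M - A N"
    from ev eventually_ge_at_top[of 1] show "\<forall>\<^sub>F N in sequentially. close_to_mean TYPE('q) e (\<lambda>i j. J i j \<omega>) N"
    proof eventually_elim
      case (elim N)
      show ?case unfolding close_to_mean_def
      proof
        fix \<sigma> :: "nat \<Rightarrow> 'q" assume s: "\<sigma> \<in> configs N"
        then have "\<omega> \<notin> B N \<sigma> 1" "\<omega> \<notin> B N \<sigma> (-1)" using elim(1) by (auto simp: A_def)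
        then have "l * S N \<sigma> \<omega> < l * (e * (real N)\<^sup>2)" "l * - S N \<sigma> \<omega> < l * (e * (real N)\<^sup>2)"
          using \<omega> by (auto simp: B_def not_le mult.assoc)
        then have S: "\<bar>S N \<sigma> \<omega>\<bar> \<le> e * (real N)\<^sup>2" using l(1) by (simp only: mult_less_cancel_left_pos abs_le_iff less_imp_le)
        let ?P = "{(i, j). 1 \<le> i \<and> i < j \<and> j \<le> N}"
        have fP: "finite ?P" by (rule finite_subset[of _ "{1..N} \<times> {1..N}"]) auto
        have "hamiltonian (\<lambda>i j. J i j \<omega>) N \<sigma> - hamiltonian (\<lambda>_ _. 1) N \<sigma> = - (1 / real N) * (\<Sum>(i, j)\<in>?P. (J i j \<omega> - 1) * of_bool (\<sigma> i = \<sigma> j))"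
          unfolding hamiltonian_def by (simp add: case_prod_beta' sum_subtractf left_diff_distrib right_diff_distrib)
        also have "(\<Sum>(i, j)\<in>?P. (J i j \<omega> - 1) * of_bool (\<sigma> i = \<sigma> j)) = S N \<sigma> \<omega>"
          unfolding S_def by (rule sum.mono_neutral_cong_right[OF fP]) (auto simp: T_def)
        finally have "\<bar>hamiltonian (\<lambda>i j. J i j \<omega>) N \<sigma> - hamiltonian (\<lambda>_ _. 1) N \<sigma>\<bar> = \<bar>S N \<sigma> \<omega>\<bar> / real N"
          by (simp add: abs_mult)
        also have "\<dots> \<le> e * (real N)\<^sup>2 / real N" by (rule divide_right_mono[OF S]) simp
        also have "\<dots> = e * real N" using elim(2) by (simp add: power2_eq_square)
        finally show "\<bar>hamiltonian (\<lambda>i j. J i j \<omega>) N \<sigma> - hamiltonian (\<lambda>_ _. 1) N \<sigma>\<bar> \<le> e * real N" .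
      qed
    qed
  qed
qed

section \<open>Measurability in the disorder\<close>

lemma measurable_exit_prob:
  assumes S: "finite S" "\<And>\<omega> s. \<omega> \<in> space M \<Longrightarrow> s \<in> S \<Longrightarrow> set_pmf (K \<omega> s) \<subseteq> S"
    and K: "\<And>s y. s \<in> S \<Longrightarrow> y \<in> S \<Longrightarrow> (\<lambda>\<omega>. pmf (K \<omega> s) y) \<in> borel_measurable M" and y: "y \<in> S"
  shows "(\<lambda>\<omega>. exit_prob (K \<omega>) A B y) \<in> borel_measurable M"
proof -
  have "(\<lambda>\<omega>. (killed_op (K \<omega>) D ^^ m) (indicator B) y) \<in> borel_measurable M" if "y \<in> S" for m y D
    using that
  proof (induction m arbitrary: y)
    case (Suc m)
    have "(\<lambda>\<omega>. indicator D y * (\<Sum>x\<in>S. ennreal (pmf (K \<omega> y) x) * (killed_op (K \<omega>) D ^^ m) (indicator B) x)) \<in> borel_measurable M"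
      using Suc K by (intro borel_measurable_times_ennreal borel_measurable_sum measurable_compose[OF _ measurable_ennreal]) auto
    moreover have "indicator D y * (\<Sum>x\<in>S. ennreal (pmf (K \<omega> y) x) * (killed_op (K \<omega>) D ^^ m) (indicator B) x) = (killed_op (K \<omega>) D ^^ Suc m) (indicator B) y"
      if "\<omega> \<in> space M" for \<omega>
      using nn_integral_pmf_finite[OF S(1) S(2)[OF that Suc.prems]] by (simp add: killed_op_def transition_op_def)
    ultimately show ?case by (subst measurable_cong[symmetric]) auto
  qed simp
  then show ?thesis unfolding exit_prob_def using y by (intro borel_measurable_suminf_order) auto
qed

lemma measurable_prob_hits_before:
  fixes K :: "'w \<Rightarrow> 's \<Rightarrow> 's pmf" and p :: "'w \<Rightarrow> 's pmf"
  assumes S: "finite S" "\<And>\<omega> s. \<omega> \<in> space M \<Longrightarrow> s \<in> S \<Longrightarrow> set_pmf (K \<omega> s) \<subseteq> S" "\<And>\<omega>. \<omega> \<in> space M \<Longrightarrow> set_pmf (p \<omega>) \<subseteq> S"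
    and K: "\<And>s y. s \<in> S \<Longrightarrow> y \<in> S \<Longrightarrow> (\<lambda>\<omega>. pmf (K \<omega> s) y) \<in> borel_measurable M"
    and p: "\<And>s. s \<in> S \<Longrightarrow> (\<lambda>\<omega>. pmf (p \<omega>) s) \<in> borel_measurable M" and AB: "A \<inter> B = {}"
  shows "(\<lambda>\<omega>. prob_hits_before (K \<omega>) (p \<omega>) B A) \<in> borel_measurable M"
proof -
  have "(\<lambda>\<omega>. \<Sum>s\<in>S. pmf (p \<omega>) s * (\<Sum>y\<in>S. pmf (K \<omega> s) y * enn2real (exit_prob (K \<omega>) A B y))) \<in> borel_measurable M"
    using K p measurable_exit_prob[OF S(1,2) K]
    by (intro borel_measurable_sum borel_measurable_times borel_measurable_enn2real) auto
  then show ?thesis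
    by (subst measurable_cong[OF prob_hits_before_eq[OF S(1) _ _ AB]]) (use S in auto)
qed

lemma measurable_hamiltonian:
  assumes "\<And>i j. 1 \<le> i \<Longrightarrow> i < j \<Longrightarrow> J i j \<in> borel_measurable M"
  shows "(\<lambda>\<omega>. hamiltonian (\<lambda>i j. J i j \<omega>) N \<sigma>) \<in> borel_measurable M"
  unfolding hamiltonian_def case_prod_beta
  using assms by (intro borel_measurable_times borel_measurable_sum borel_measurable_const) auto

text \<open>Almost sure containment in the event is not enough for its probability to be 1: the event itself has to
  be measurable. Hitting probabilities are countable sums of polynomials in the transition probabilities,
  and these are explicit functions of finitely many couplings.\<close>

lemma measurable_metastable_ratio:
  fixes J :: "nat \<Rightarrow> nat \<Rightarrow> 'a \<Rightarrow> real" and A :: "'i \<Rightarrow> (nat \<Rightarrow> 'q::finite) set"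
  assumes J: "\<And>i j. 1 \<le> i \<Longrightarrow> i < j \<Longrightarrow> J i j \<in> borel_measurable M" and N: "1 \<le> N" and \<beta>: "0 < \<beta>"
    and I: "finite I" and A: "\<And>i. i \<in> I \<Longrightarrow> A i \<subseteq> configs N" "\<And>i. i \<in> I \<Longrightarrow> A i \<noteq> {}"
  shows "(\<lambda>\<omega>. metastable_ratio (metropolis \<beta> (\<lambda>i j. J i j \<omega>) N) (gibbs \<beta> (\<lambda>i j. J i j \<omega>) N) (configs N) I A) \<in> borel_measurable M"
proof -
  let ?g = "\<lambda>\<omega> i j. J i j \<omega>" and ?S = "configs N :: (nat \<Rightarrow> 'q) set"
  have H: "(\<lambda>\<omega>. hamiltonian (?g \<omega>) N \<sigma>) \<in> borel_measurable M" for \<sigma> :: "nat \<Rightarrow> 'q"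
    by (rule measurable_hamiltonian[OF J])
  have bz: "(\<lambda>\<omega>. boltzmann \<beta> (?g \<omega>) N \<sigma>) \<in> borel_measurable M" for \<sigma> :: "nat \<Rightarrow> 'q"
    unfolding boltzmann_def using H by measurable
  have Z: "(\<lambda>\<omega>. partition_sum TYPE('q) \<beta> (?g \<omega>) N) \<in> borel_measurable M"
    unfolding partition_sum_eq using bz by measurable
  have flip: "(\<lambda>\<omega>. flip_prob \<beta> (?g \<omega>) N \<sigma> \<eta>) \<in> borel_measurable M" for \<sigma> \<eta> :: "nat \<Rightarrow> 'q"
    unfolding flip_prob_def using H by measurable
  have K: "(\<lambda>\<omega>. pmf (metropolis \<beta> (?g \<omega>) N \<sigma>) \<eta>) \<in> borel_measurable M" if "\<sigma> \<in> ?S" for \<sigma> \<eta>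
    unfolding pmf_metropolis[OF N \<beta> that] using flip by measurable
  have mu: "(\<lambda>\<omega>. pmf (gibbs \<beta> (?g \<omega>) N) \<sigma>) \<in> borel_measurable M" for \<sigma> :: "nat \<Rightarrow> 'q"
    unfolding pmf_gibbs using bz Z by measurable
  have P: "(\<lambda>\<omega>. prob_hits_before (metropolis \<beta> (?g \<omega>) N) (cond_pmf (gibbs \<beta> (?g \<omega>) N) X) B X) \<in> borel_measurable M"
    if X: "X \<subseteq> ?S" "X \<noteq> {}" "X \<inter> B = {}" for X B
  proof (rule measurable_prob_hits_before[OF finite_configs _ _ K _ X(3)])
    have ne: "set_pmf (gibbs \<beta> g N) \<inter> X \<noteq> {}" for g using X by (auto simp: set_pmf_gibbs)
    show "set_pmf (metropolis \<beta> (?g \<omega>) N s) \<subseteq> ?S" if "s \<in> ?S" for \<omega> s by (rule set_pmf_metropolis[OF N \<beta> that])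
    show "set_pmf (cond_pmf (gibbs \<beta> (?g \<omega>) N) X) \<subseteq> ?S" for \<omega> using X set_cond_pmf[OF ne] by auto
    show "(\<lambda>\<omega>. pmf (cond_pmf (gibbs \<beta> (?g \<omega>) N) X) s) \<in> borel_measurable M" for s
      unfolding pmf_cond[OF ne] measure_measure_pmf_finite[OF finite_subset[OF X(1) finite_configs]]
      using mu by measurable
  qed
  let ?U = "\<Union>i\<in>I. A i"
  have "finite {X. X \<noteq> {} \<and> X \<subseteq> ?S - ?U}"
    by (rule finite_subset[of _ "Pow ?S"]) (auto simp: finite_configs)
  then have "(\<lambda>\<omega>. MIN X\<in>{X. X \<noteq> {} \<and> X \<subseteq> ?S - ?U}. prob_hits_before (metropolis \<beta> (?g \<omega>) N) (cond_pmf (gibbs \<beta> (?g \<omega>) N) X) ?U X) \<in> borel_measurable M"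
    by (rule borel_measurable_Min) (rule P; blast)
  moreover have "(\<lambda>\<omega>. MAX j\<in>I. prob_hits_before (metropolis \<beta> (?g \<omega>) N) (cond_pmf (gibbs \<beta> (?g \<omega>) N) (A j)) (?U - A j) (A j)) \<in> borel_measurable M"
    using I by (rule borel_measurable_Max) (rule P; use A in blast)
  ultimately show ?thesis unfolding metastable_ratio_def Let_def by (intro borel_measurable_times borel_measurable_divide borel_measurable_const)
qed

section \<open>Almost sure metastability\<close>

lemma sum_boltzmann1_levels:
  assumes N: "1 \<le> N" and S: "S \<subseteq> compositions N"
  shows "(\<Sum>\<sigma>\<in>{\<sigma>\<in>configs N. colour_count N \<sigma> \<in> S}. boltzmann1 \<beta> N \<sigma>) = (\<Sum>n\<in>S. level_mass \<beta> N n)"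
proof -
  have "{\<sigma>\<in>configs N. colour_count N \<sigma> \<in> S} = (\<Union>n\<in>S. level N n)" by (auto simp: level_def)
  then have "(\<Sum>\<sigma>\<in>{\<sigma>\<in>configs N. colour_count N \<sigma> \<in> S}. boltzmann1 \<beta> N \<sigma>) = (\<Sum>\<sigma>\<in>(\<Union>n\<in>S. level N n). boltzmann1 \<beta> N \<sigma>)" by simp
  also have "\<dots> = (\<Sum>n\<in>S. \<Sum>\<sigma>\<in>level N n. boltzmann1 \<beta> N \<sigma>)"
    by (rule sum.UNION_disjoint) (auto simp: finite_subset[OF S finite_compositions] finite_level level_disjoint)
  also have "\<dots> = (\<Sum>n\<in>S. level_mass \<beta> N n)"
    by (rule sum.cong) (auto simp: level_mass_eq boltzmann1_level[OF N])
  finally show ?thesis .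
qed

lemma k1_le:
  fixes i j :: "'q::finite option"
  assumes "i \<in> min_index \<beta>" "j \<in> min_index \<beta>" "i \<noteq> j" "0 < \<beta>"
  shows "k1 TYPE('q) \<beta> \<le> \<beta> * (comm_height \<beta> (min_point \<beta> i) (min_point \<beta> j) - free_energy \<beta> (min_point \<beta> j))"
proof -
  let ?h = "\<lambda>(i :: 'q option, j). comm_height \<beta> (min_point \<beta> i) (min_point \<beta> j) - free_energy \<beta> (min_point \<beta> j)"
  let ?S = "{comm_height \<beta> (min_point \<beta> i) (min_point \<beta> j) - free_energy \<beta> (min_point \<beta> j)
     | i j :: 'q option. i \<in> min_index \<beta> \<and> j \<in> min_index \<beta> \<and> i \<noteq> j}"
  have "?S \<subseteq> ?h ` UNIV" by auto
  then have "finite ?S" by (rule finite_subset) simp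
  then have "Min ?S \<le> ?h (i, j)" by (rule Min_le) (use assms in auto)
  then show ?thesis unfolding k1_def using assms(4) by simp
qed

text \<open>By the definition of \<^const>\<open>k1\<close> the threshold \<open>c\<close> lies below every communication height between the
  well \<open>j\<close> and another well, so the chain has to cross levels of free energy above \<open>c\<close>. By \<open>escape_upper_bound\<close> the escape probability is at most
  the weight of these levels divided by the weight of the well.\<close>

lemma escape_from_well:
  fixes a :: "nat \<Rightarrow> 'q::finite option \<Rightarrow> 'q \<Rightarrow> nat"
  assumes q: "2 \<le> CARD('q)" and b: "beta1 TYPE('q) < \<beta>" and \<beta>: "0 < \<beta>" and e1: "0 < e1" "2 * \<beta> * e1 \<le> k1 TYPE('q) \<beta>"
    and a: "\<And>N i. 1 \<le> N \<Longrightarrow> i \<in> min_index \<beta> \<Longrightarrow> a N i \<in> compositions N"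
    and lim: "\<And>i. i \<in> min_index \<beta> \<Longrightarrow> (\<lambda>N. lattice_point N (a N i)) \<longlonglongrightarrow> min_point \<beta> i"
    and j: "j \<in> min_index \<beta>"
  shows "\<forall>\<^sub>F N in sequentially. \<forall>g. close_to_mean TYPE('q) e g N \<longrightarrow>
    prob_hits_before (metropolis \<beta> g N) (cond_pmf (gibbs \<beta> g N) (level N (a N j))) ((\<Union>i\<in>min_index \<beta>. level N (a N i)) - level N (a N j)) (level N (a N j))
    \<le> (real N + 1) ^ CARD('q) * exp (- real N * (k1 TYPE('q) \<beta> - 2 * \<beta> * e1 - 2 * e1 - 2 * \<beta> * e))"
proof -
  let ?F = "free_energy \<beta> :: real ^ 'q \<Rightarrow> real" and ?m = "min_point \<beta> :: 'q option \<Rightarrow> real ^ 'q"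
  let ?k = "k1 TYPE('q) \<beta>"
  define c where "c = ?F (?m j) + ?k / \<beta> - e1"
  have bc: "\<beta> * c = \<beta> * ?F (?m j) + ?k - \<beta> * e1" using \<beta> by (simp add: c_def algebra_simps)
  have c: "?F (?m j) + e1 \<le> c" using e1(2) \<beta> by (simp add: c_def field_simps)
  have bar: "\<forall>\<^sub>F N in sequentially. a N j \<in> sublevel \<beta> N c \<longrightarrow> (a N j, a N i) \<notin> (unit_moves \<inter> sublevel \<beta> N c \<times> sublevel \<beta> N c)\<^sup>*"
    if i: "i \<in> min_index \<beta>" "i \<noteq> j" for i
  proof (rule barrier)
    have "?k / \<beta> \<le> comm_height \<beta> (?m i) (?m j) - ?F (?m j)"
      using k1_le[OF i(1) j i(2) \<beta>] \<beta> by (simp add: pos_divide_le_eq mult.commute)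
    then show "c < comm_height \<beta> (?m i) (?m j)" using e1(1) by (simp add: c_def)
  qed (use i j a lim min_point_bounds(1)[OF q b] in auto)
  have ev1: "\<forall>\<^sub>F N in sequentially. \<forall>i\<in>min_index \<beta> - {j}. a N j \<in> sublevel \<beta> N c \<longrightarrow> (a N j, a N i) \<notin> (unit_moves \<inter> sublevel \<beta> N c \<times> sublevel \<beta> N c)\<^sup>*"
    using bar by (intro eventually_ball_finite) auto
  have ev2: "\<forall>\<^sub>F N in sequentially. ?F (lattice_point N (a N j)) < ?F (?m j) + e1"
  proof -
    have "(\<lambda>N. ?F (lattice_point N (a N j))) \<longlonglongrightarrow> ?F (?m j)"
    proof (rule continuous_on_tendsto_compose[OF continuous_on_free_energy lim[OF j]])
      show "?m j \<in> prob_simplex" by (rule min_point_bounds[OF q b])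
      show "\<forall>\<^sub>F N in sequentially. lattice_point N (a N j) \<in> prob_simplex"
        using eventually_ge_at_top[of 1] by eventually_elim (use a j lattice_point_simplex in blast)
    qed
    from order_tendstoD(2)[OF this, of "?F (?m j) + e1"] e1(1) show ?thesis by simp
  qed
  from ev1 ev2 eventually_level_mass[where 'q='q, OF \<beta> e1(1)] eventually_ge_at_top[of 1]
  show ?thesis
  proof eventually_elim
    case (elim N)
    show ?case
    proof (intro allI impI)
      fix g assume g: "close_to_mean TYPE('q) e g N"
      let ?A = "level N (a N j)"
      let ?B = "(\<Union>i\<in>min_index \<beta>. level N (a N i)) - ?A"
      let ?P = "prob_hits_before (metropolis \<beta> g N) (cond_pmf (gibbs \<beta> g N) ?A) ?B ?A"
      let ?G = "sublevel \<beta> N c :: ('q \<Rightarrow> nat) set"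
      let ?E = "exp (\<beta> * e * real N)"
      have aj: "a N j \<in> compositions N" by (rule a[OF elim(4) j])
      have ajG: "a N j \<in> ?G" using aj elim(2) c by (simp add: sublevel_def)
      have up: "?P * (\<Sum>\<sigma>\<in>?A. boltzmann \<beta> g N \<sigma>) \<le> (\<Sum>\<sigma>\<in>{\<sigma>\<in>configs N. colour_count N \<sigma> \<notin> ?G}. boltzmann \<beta> g N \<sigma>)"
      proof (rule escape_upper_bound[OF elim(4) \<beta> aj ajG refl])
        show "?B \<subseteq> configs N" by (auto simp: level_def)
        fix \<sigma> assume "\<sigma> \<in> ?B"
        then obtain i where i: "i \<in> min_index \<beta>" "\<sigma> \<in> level N (a N i)" "\<sigma> \<notin> ?A" by blast
        then have "i \<noteq> j" by blast
        then have "(a N j, a N i) \<notin> (unit_moves \<inter> ?G \<times> ?G)\<^sup>*" using elim(1) i(1) ajG by blast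
        moreover have "colour_count N \<sigma> = a N i" using i(2) by (simp add: level_def)
        ultimately show "(a N j, colour_count N \<sigma>) \<notin> (unit_moves \<inter> ?G \<times> ?G)\<^sup>*" by simp
      qed
      also have "\<dots> \<le> (\<Sum>\<sigma>\<in>{\<sigma>\<in>configs N. colour_count N \<sigma> \<notin> ?G}. ?E * boltzmann1 \<beta> N \<sigma>)"
        by (rule sum_mono) (use boltzmann_close(1)[OF \<beta> g] in blast)
      also have "\<dots> = ?E * (\<Sum>\<sigma>\<in>{\<sigma>\<in>configs N. colour_count N \<sigma> \<in> compositions N - ?G}. boltzmann1 \<beta> N \<sigma>)"
        by (simp add: sum_distrib_left colour_count_compositions)
      also have "\<dots> = ?E * (\<Sum>n\<in>compositions N - ?G. level_mass \<beta> N n)"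
        by (subst sum_boltzmann1_levels[OF elim(4)]) auto
      also have "\<dots> \<le> ?E * ((real N + 1) ^ CARD('q) * exp (- real N * (\<beta> * c - e1)))"
      proof (rule mult_left_mono)
        have "(\<Sum>n\<in>compositions N - ?G. level_mass \<beta> N n) \<le> (\<Sum>n\<in>compositions N - ?G. exp (- real N * (\<beta> * c - e1)))"
        proof (rule sum_mono)
          fix n assume n: "n \<in> compositions N - ?G"
          then have "c \<le> ?F (lattice_point N n)" by (auto simp: sublevel_def)
          then have "\<beta> * c \<le> \<beta> * ?F (lattice_point N n)" using \<beta> by simp
          then have "real N * (\<beta> * c - e1) \<le> real N * (\<beta> * ?F (lattice_point N n) - e1)" by (intro mult_left_mono) auto
          then have "exp (- real N * (\<beta> * ?F (lattice_point N n) - e1)) \<le> exp (- real N * (\<beta> * c - e1))" by simp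
          moreover have "level_mass \<beta> N n \<le> exp (- real N * (\<beta> * ?F (lattice_point N n) - e1))" using elim(3) n by blast
          ultimately show "level_mass \<beta> N n \<le> exp (- real N * (\<beta> * c - e1))" by (rule order_trans[rotated])
        qed
        also have "\<dots> = real (card (compositions N - ?G)) * exp (- real N * (\<beta> * c - e1))" by simp
        also have "\<dots> \<le> (real N + 1) ^ CARD('q) * exp (- real N * (\<beta> * c - e1))"
        proof (rule mult_right_mono)
          have "card (compositions N - ?G) \<le> card (compositions N :: ('q \<Rightarrow> nat) set)" by (rule card_mono[OF finite_compositions]) auto
          also have "\<dots> \<le> (N + 1) ^ CARD('q)" by (rule card_compositions)
          finally have "real (card (compositions N - ?G)) \<le> real ((N + 1) ^ CARD('q))" by (simp only: of_nat_le_iff)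
          then show "real (card (compositions N - ?G)) \<le> (real N + 1) ^ CARD('q)" by (simp add: add.commute)
        qed simp
        finally show "(\<Sum>n\<in>compositions N - ?G. level_mass \<beta> N n) \<le> (real N + 1) ^ CARD('q) * exp (- real N * (\<beta> * c - e1))" .
      qed simp
      finally have up: "?P * (\<Sum>\<sigma>\<in>?A. boltzmann \<beta> g N \<sigma>) \<le> ?E * ((real N + 1) ^ CARD('q) * exp (- real N * (\<beta> * c - e1)))" .
      define LB where "LB = exp (- real N * (\<beta> * ?F (?m j) + \<beta> * e1 + e1))"
      have "LB \<le> exp (- real N * (\<beta> * ?F (lattice_point N (a N j)) + e1))"
      proof -
        have "\<beta> * ?F (lattice_point N (a N j)) \<le> \<beta> * (?F (?m j) + e1)" using elim(2) \<beta> by (intro mult_left_mono) auto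
        then have "real N * (\<beta> * ?F (lattice_point N (a N j)) + e1) \<le> real N * (\<beta> * ?F (?m j) + \<beta> * e1 + e1)"
          by (intro mult_left_mono) (auto simp: algebra_simps)
        then show ?thesis by (simp add: LB_def)
      qed
      also have "\<dots> \<le> level_mass \<beta> N (a N j)" using elim(3) aj by blast
      also have "\<dots> = (\<Sum>\<sigma>\<in>?A. boltzmann1 \<beta> N \<sigma>)" by (simp add: level_mass_eq boltzmann1_level[OF elim(4)])
      also have "\<dots> \<le> (\<Sum>\<sigma>\<in>?A. ?E * boltzmann \<beta> g N \<sigma>)"
        by (rule sum_mono) (use boltzmann_close(2)[OF \<beta> g] in \<open>auto simp: level_def\<close>)
      finally have low: "LB \<le> ?E * (\<Sum>\<sigma>\<in>?A. boltzmann \<beta> g N \<sigma>)" by (simp add: sum_distrib_left)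
      have P0: "0 \<le> ?P" by (simp add: prob_hits_before_def)
      have "?P * LB \<le> ?P * (?E * (\<Sum>\<sigma>\<in>?A. boltzmann \<beta> g N \<sigma>))" by (rule mult_left_mono[OF low P0])
      also have "\<dots> = ?E * (?P * (\<Sum>\<sigma>\<in>?A. boltzmann \<beta> g N \<sigma>))" by simp
      also have "\<dots> \<le> ?E * (?E * ((real N + 1) ^ CARD('q) * exp (- real N * (\<beta> * c - e1))))"
        by (rule mult_left_mono[OF up]) simp
      also have "\<dots> = (real N + 1) ^ CARD('q) * exp (- real N * (?k - 2 * \<beta> * e1 - 2 * e1 - 2 * \<beta> * e)) * LB"
      proof -
        have "?E * (?E * exp (- real N * (\<beta> * c - e1))) = exp (- real N * (?k - 2 * \<beta> * e1 - 2 * e1 - 2 * \<beta> * e)) * LB"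
          unfolding LB_def exp_add[symmetric] bc by (simp add: algebra_simps)
        then show ?thesis by (simp add: mult.left_commute mult.assoc)
      qed
      finally show "?P \<le> (real N + 1) ^ CARD('q) * exp (- real N * (?k - 2 * \<beta> * e1 - 2 * e1 - 2 * \<beta> * e))"
        by (rule mult_right_le_imp_le) (simp add: LB_def)
    qed
  qed
qed

lemma closest_points_converge:
  fixes mN :: "nat \<Rightarrow> 'q::finite option \<Rightarrow> real ^ 'q"
  assumes m: "min_point \<beta> i \<in> prob_simplex"
    and am: "\<And>N. 1 \<le> N \<Longrightarrow> is_arg_min (\<lambda>y. dist y (min_point \<beta> i)) (\<lambda>y. y \<in> lattice_simplex N) (mN N i)"
  shows "(\<lambda>N. mN N i) \<longlonglongrightarrow> min_point \<beta> i"
proof (rule tendstoI)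
  fix e :: real assume e: "0 < e"
  from eventually_lattice_point_near[where 'q='q, OF e] eventually_ge_at_top[of 1]
  show "\<forall>\<^sub>F N in sequentially. dist (mN N i) (min_point \<beta> i) < e"
  proof eventually_elim
    case (elim N)
    from elim(1) m obtain n where n: "n \<in> compositions N" "dist (lattice_point N n) (min_point \<beta> i) < e" by blast
    have "lattice_point N n \<in> lattice_simplex N" using n(1) lattice_simplex_eq[OF elim(2)] by blast
    then have "\<not> dist (lattice_point N n) (min_point \<beta> i) < dist (mN N i) (min_point \<beta> i)"
      using am[OF elim(2)] unfolding is_arg_min_def by blast
    then show ?case using n(2) by linarith
  qed
qed

text \<open>The wells are eventually disjoint, since the minimizers are distinct. No minimizer is a vertex, so the
  constant configurations lie outside the wells and the minimum in \<^const>\<open>metastable_ratio\<close> is over a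
  nonempty family.\<close>

lemma wells_configuration:
  fixes a :: "nat \<Rightarrow> 'q::finite option \<Rightarrow> 'q \<Rightarrow> nat"
  assumes q: "2 \<le> CARD('q)" and b: "beta1 TYPE('q) < \<beta>"
    and lim: "\<And>i. i \<in> min_index \<beta> \<Longrightarrow> (\<lambda>N. lattice_point N (a N i)) \<longlonglongrightarrow> min_point \<beta> i"
  shows "\<forall>\<^sub>F N in sequentially. inj_on (a N) (min_index \<beta>) \<and> configs N - (\<Union>i\<in>min_index \<beta>. level N (a N i)) \<noteq> {}"
proof -
  let ?I = "min_index \<beta> :: 'q option set"
  have ne: "\<forall>\<^sub>F N in sequentially. a N i \<noteq> a N j" if "i \<in> ?I" "j \<in> ?I" "i \<noteq> j" for i j
  proof -
    have "min_point \<beta> i \<noteq> min_point \<beta> j" using min_point_inj[OF q b] that(3) by (auto dest: injD)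
    then have "min_point \<beta> i - min_point \<beta> j \<noteq> 0" by simp
    with tendsto_diff[OF lim[OF that(1)] lim[OF that(2)]]
    have "\<forall>\<^sub>F N in sequentially. lattice_point N (a N i) - lattice_point N (a N j) \<noteq> 0" by (rule tendsto_imp_eventually_ne)
    then show ?thesis by eventually_elim auto
  qed
  have "\<forall>\<^sub>F N in sequentially. \<forall>i\<in>?I. \<forall>j\<in>?I - {i}. a N i \<noteq> a N j"
    using ne by (intro eventually_ball_finite ballI) auto
  moreover obtain c :: 'q where True by simp
  have "\<forall>\<^sub>F N in sequentially. \<forall>i\<in>?I. lattice_point N (a N i) $ c < 1"
  proof (intro eventually_ball_finite ballI)
    fix i assume i: "i \<in> ?I"
    show "\<forall>\<^sub>F N in sequentially. lattice_point N (a N i) $ c < 1"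
      by (rule order_tendstoD(2)[OF tendsto_vec_nth[OF lim[OF i]] min_point_bounds(2)[OF q b]])
  qed simp
  ultimately show ?thesis using eventually_ge_at_top[of 1]
  proof eventually_elim
    case (elim N)
    let ?s = "restrict (\<lambda>_. c) {1..N}"
    have "{i\<in>{1..N}. ?s i = c} = {1..N}" by auto
    then have cc: "colour_count N ?s c = N" unfolding colour_count_def by simp
    have "?s \<notin> level N (a N i)" if "i \<in> ?I" for i
    proof
      assume "?s \<in> level N (a N i)"
      then have "a N i c = N" using cc by (auto simp: level_def)
      then have "lattice_point N (a N i) $ c = 1" using elim(3) by (simp add: lattice_point_def)
      then show False using elim(2) that by force
    qed
    moreover have "?s \<in> configs N" by (auto simp: configs_def)
    moreover have "inj_on (a N) ?I" using elim(1) by (intro inj_onI) blast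
    ultimately show ?case by blast
  qed
qed


text \<open>The exponential rate of the numerator is at most \<open>- k1\<close> and that of the denominator at least 0, up to
  errors that together stay below \<open>k1 - k\<close>.\<close>

lemma metastable_ratio_bound:
  fixes a :: "nat \<Rightarrow> 'q::finite option \<Rightarrow> 'q \<Rightarrow> nat"
  assumes q: "2 \<le> CARD('q)" and b: "beta1 TYPE('q) < \<beta>" and k: "0 < k" "k < k1 TYPE('q) \<beta>"
    and a: "\<And>N i. 1 \<le> N \<Longrightarrow> i \<in> min_index \<beta> \<Longrightarrow> a N i \<in> compositions N"
    and lim: "\<And>i. i \<in> min_index \<beta> \<Longrightarrow> (\<lambda>N. lattice_point N (a N i)) \<longlonglongrightarrow> min_point \<beta> i"
  obtains e where "0 < e" "\<forall>\<^sub>F N in sequentially. \<forall>g. close_to_mean TYPE('q) e g N \<longrightarrow>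
    metastable_ratio (metropolis \<beta> g N) (gibbs \<beta> g N) (configs N) (min_index \<beta>) (\<lambda>i. level N (a N i)) \<le> exp (- k * real N)"
proof -
  let ?I = "min_index \<beta> :: 'q option set" 
  define K1 where "K1 = k1 TYPE('q) \<beta>"
  have k': "0 < k" "k < K1" using k by (simp_all add: K1_def)
  obtain s where \<beta>: "0 < \<beta>" by (rule beta1_less[OF q b])
  define \<delta> where "\<delta> = K1 - k"
  have \<delta>: "0 < \<delta>" using k' by (simp add: \<delta>_def)
  define e1 where "e1 = \<delta> / (16 * (\<beta> + 1))"
  \<comment> \<open>With the Poincare constant the losses add up to \<open>3 * \<delta> / 8\<close>; a further \<open>\<delta> / 2\<close> absorbs the polynomial factors.\<close>
  define e where "e = \<delta> / (32 * \<beta>)"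
  have e1: "0 < e1" "2 * \<beta> * e1 + 2 * e1 = \<delta> / 8" using \<delta> \<beta> by (simp_all add: e1_def divide_simps) (simp add: algebra_simps)
  have e: "0 < e" "4 * \<beta> * e = \<delta> / 8" using \<delta> \<beta> by (simp_all add: e_def)
  have k1: "2 * \<beta> * e1 \<le> K1" 
  proof -
    have *: "x \<le> y" if "0 < z" "x + 2 * z = (y - w) / 8" "0 < w" "w < y" for x y z w :: real
      using that by (simp add: field_simps)
    show ?thesis using *[OF e1(1) _ k'] e1(2) by (simp add: \<delta>_def)
  qed
  have e8: "0 < \<delta> / 8" using \<delta> by simp
  define Q where "Q = CARD('q)"
  have I: "finite ?I" "?I \<noteq> {}" by (auto simp: min_index_def)
  define K where "K = real (card ?I)"
  have K: "0 < K" using I by (simp add: K_def card_gt_0_iff)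
  have "((\<lambda>x. K * (x + 1) ^ Q * (x * real Q) * exp (- (\<delta> / 2) * x)) \<longlongrightarrow> 0) at_top" using \<delta> by real_asymp
  from filterlim_compose[OF this filterlim_real_sequentially]
  have "(\<lambda>N. K * (real N + 1) ^ Q * (real N * real Q) * exp (- (\<delta> / 2) * real N)) \<longlonglongrightarrow> 0" .
  from order_tendstoD(2)[OF this zero_less_one]
  have pol: "\<forall>\<^sub>F N in sequentially. K * (real N + 1) ^ Q * (real N * real Q) * exp (- (\<delta> / 2) * real N) < 1" .
  have num: "\<forall>\<^sub>F N in sequentially. \<forall>j\<in>?I. \<forall>g. close_to_mean TYPE('q) e g N \<longrightarrow>
    prob_hits_before (metropolis \<beta> g N) (cond_pmf (gibbs \<beta> g N) (level N (a N j))) ((\<Union>i\<in>?I. level N (a N i)) - level N (a N j)) (level N (a N j))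
    \<le> (real N + 1) ^ Q * exp (- real N * (K1 - 2 * \<beta> * e1 - 2 * e1 - 2 * \<beta> * e))"
    unfolding Q_def by (intro eventually_ball_finite I ballI escape_from_well[OF q b \<beta> e1(1), folded K1_def, OF k1]) (use a lim in auto)
  have poi: "\<forall>\<^sub>F N in sequentially. \<forall>u :: (nat \<Rightarrow> 'q) \<Rightarrow> real. (\<forall>i\<in>?I. \<forall>\<sigma>\<in>level N (a N i). u \<sigma> = 0) \<longrightarrow>
    (\<Sum>\<sigma>\<in>configs N. boltzmann1 \<beta> N \<sigma> * (u \<sigma>)\<^sup>2) \<le> exp (\<delta> / 8 * real N) * dirichlet (configs N) (conductance N (boltzmann1 \<beta> N)) u"
    by (rule poincare[OF q b \<beta> e8]) (use a lim in auto)
  have wc: "\<forall>\<^sub>F N in sequentially. inj_on (a N) ?I \<and> configs N - (\<Union>i\<in>?I. level N (a N i)) \<noteq> {}"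
    by (rule wells_configuration[where a=a, OF q b]) (use lim in auto)
  have main: "\<forall>\<^sub>F N in sequentially. \<forall>g. close_to_mean TYPE('q) e g N \<longrightarrow>
    metastable_ratio (metropolis \<beta> g N) (gibbs \<beta> g N) (configs N) ?I (\<lambda>i. level N (a N i)) \<le> exp (- k * real N)"
    using pol num poi wc eventually_ge_at_top[of 1]
  proof eventually_elim
    case (elim N)
    show ?case
    proof (intro allI impI)
      fix g assume g: "close_to_mean TYPE('q) e g N"
      let ?U = "\<Union>i\<in>?I. level N (a N i)"
      let ?X = "{X. X \<noteq> {} \<and> X \<subseteq> configs N - ?U}"
      let ?p = "\<lambda>j. prob_hits_before (metropolis \<beta> g N) (cond_pmf (gibbs \<beta> g N) (level N (a N j))) (?U - level N (a N j)) (level N (a N j))"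
      let ?r = "\<lambda>X. prob_hits_before (metropolis \<beta> g N) (cond_pmf (gibbs \<beta> g N) X) ?U X"
      define R1 where "R1 = (real N + 1) ^ Q * exp (- real N * (K1 - 2 * \<beta> * e1 - 2 * e1 - 2 * \<beta> * e))"
      define R2 where "R2 = 1 / (exp (\<delta> / 8 * real N) * exp (2 * \<beta> * e * real N) * (real N * real Q))"
      have Q0: "0 < real Q" by (simp add: Q_def card_gt_0_iff)
      have R2: "0 < R2" using elim(5) Q0 by (simp add: R2_def)
      have R1: "0 \<le> R1" by (simp add: R1_def)
      have mx: "(MAX j\<in>?I. ?p j) \<le> R1"
        using I elim(2) g by (intro Max.boundedI) (auto simp: R1_def)
      have fX: "finite ?X" by (rule finite_subset[of _ "Pow (configs N)"]) (auto simp: finite_configs)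
      have U: "?U \<subseteq> configs N" by (auto simp: level_def)
      have low: "R2 \<le> ?r X" if X: "X \<in> ?X" for X
        unfolding R2_def Q_def
      proof (rule escape_lower_bound[OF elim(5) \<beta> g _ _ U])
        fix u :: "(nat \<Rightarrow> 'q) \<Rightarrow> real" assume "\<forall>\<sigma>\<in>?U. u \<sigma> = 0"
        then show "(\<Sum>\<sigma>\<in>configs N. boltzmann1 \<beta> N \<sigma> * (u \<sigma>)\<^sup>2) \<le> exp (\<delta> / 8 * real N) * dirichlet (configs N) (conductance N (boltzmann1 \<beta> N)) u"
          using elim(3) by blast
      qed (use X in auto)
      have "?X \<noteq> {}" using elim(4) by blast
      then have mn: "R2 \<le> (MIN X\<in>?X. ?r X)"
        using fX low by (intro Min.boundedI) auto
      have "(MAX j\<in>?I. ?p j) / (MIN X\<in>?X. ?r X) \<le> R1 / R2" by (rule frac_le[OF R1 mx R2 mn])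
      then have "metastable_ratio (metropolis \<beta> g N) (gibbs \<beta> g N) (configs N) ?I (\<lambda>i. level N (a N i)) \<le> K * (R1 / R2)"
        unfolding metastable_ratio_def Let_def K_def by (intro mult_left_mono) auto
      also have "K * (R1 / R2) = (K * (real N + 1) ^ Q * (real N * real Q) * exp (- (\<delta> / 2) * real N)) * exp (- real N * (K1 - 3 * (\<delta> / 8) - \<delta> / 2))"
      proof -
        have "exp (- real N * (K1 - 2 * \<beta> * e1 - 2 * e1 - 2 * \<beta> * e)) * (exp (\<delta> / 8 * real N) * exp (2 * \<beta> * e * real N))
          = exp (- real N * (K1 - (2 * \<beta> * e1 + 2 * e1) - 4 * \<beta> * e - \<delta> / 8))"
          unfolding exp_add[symmetric] by (simp add: algebra_simps)
        also have "\<dots> = exp (- (\<delta> / 2) * real N) * exp (- real N * (K1 - 3 * (\<delta> / 8) - \<delta> / 2))"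
          unfolding exp_add[symmetric] e1(2) e(2) by (simp add: algebra_simps)
        finally have "exp (- real N * (K1 - 2 * \<beta> * e1 - 2 * e1 - 2 * \<beta> * e)) * (exp (\<delta> / 8 * real N) * exp (2 * \<beta> * e * real N))
          = exp (- (\<delta> / 2) * real N) * exp (- real N * (K1 - 3 * (\<delta> / 8) - \<delta> / 2))" .
        moreover have "K * (R1 / R2) = K * (real N + 1) ^ Q * (real N * real Q) *
          (exp (- real N * (K1 - 2 * \<beta> * e1 - 2 * e1 - 2 * \<beta> * e)) * (exp (\<delta> / 8 * real N) * exp (2 * \<beta> * e * real N)))"
          by (simp add: R1_def R2_def)
        ultimately show ?thesis by (simp only: mult.assoc)
      qed
      also have "\<dots> \<le> 1 * exp (- real N * (K1 - 3 * (\<delta> / 8) - \<delta> / 2))"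
        using elim(1) by (intro mult_right_mono) auto
      also have "\<dots> \<le> exp (- k * real N)"
      proof -
        have "k \<le> K1 - 3 * (\<delta> / 8) - \<delta> / 2" using \<delta> by (simp add: \<delta>_def field_simps)
        then have "real N * k \<le> real N * (K1 - 3 * (\<delta> / 8) - \<delta> / 2)" by (rule mult_left_mono) simp
        then show ?thesis by (simp add: mult.commute)
      qed
      finally show "metastable_ratio (metropolis \<beta> g N) (gibbs \<beta> g N) (configs N) ?I (\<lambda>i. level N (a N i)) \<le> exp (- k * real N)" .
    qed
  qed
  show ?thesis by (rule that[OF e(1) main])
qed

theorem theorem1p9:
  fixes M :: "'a measure"
    and J :: "nat \<Rightarrow> nat \<Rightarrow> 'a \<Rightarrow> real"
    and v \<beta> k :: real
    and mN :: "nat \<Rightarrow> 'q::finite option \<Rightarrow> real ^ 'q"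
  assumes "CARD('q) \<ge> 2"
    and "prob_space M"
    and "prob_space.indep_vars M (\<lambda>_. borel) (\<lambda>(i, j). J i j) {(i, j). 1 \<le> i \<and> i < j}"
    and "\<And>i j. 1 \<le> i \<Longrightarrow> i < j \<Longrightarrow> distr M borel (J i j) = distr M borel (J 1 2)"
    and "integrable M (J 1 2)" and "prob_space.expectation M (J 1 2) = 1"
    and "integrable M (\<lambda>\<omega>. (J 1 2 \<omega>)\<^sup>2)" and "prob_space.variance M (J 1 2) = v" and "0 < v"
    and "0 \<in> interior {l. integrable M (\<lambda>\<omega>. exp (l * J 1 2 \<omega>))}"
    and "beta1 TYPE('q) < \<beta>"
    and "0 < k" and "k < k1 TYPE('q) \<beta>"
    and "\<And>N i. 1 \<le> N \<Longrightarrow> i \<in> min_index \<beta> \<Longrightarrow>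
      is_arg_min (\<lambda>y. dist y (min_point \<beta> i)) (\<lambda>y. y \<in> lattice_simplex N) (mN N i)"
  shows "measure M (liminf (Omega_meta M J mN \<beta> k)) = 1"
proof -
  note q = assms(1) and ps = assms(2) and ind = assms(3) and b = assms(11) and k = assms(12,13) and argmin = assms(14)
  interpret prob_space M by (rule ps)
  let ?I = "min_index \<beta> :: 'q option set"
  let ?g = "\<lambda>\<omega> i j. J i j \<omega>"
  obtain s where \<beta>: "0 < \<beta>" by (rule beta1_less[OF q b])
  have J: "J i j \<in> borel_measurable M" if "1 \<le> i" "i < j" for i j
    using ind that by (force simp: indep_vars_def)
  define a where "a N i = (SOME n. n \<in> compositions N \<and> mN N i = lattice_point N n)" for N i
  have a': "a N i \<in> compositions N \<and> mN N i = lattice_point N (a N i)" if "1 \<le> N" "i \<in> ?I" for N i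
  proof -
    have "mN N i \<in> lattice_simplex N" using argmin[OF that] by (simp add: is_arg_min_def)
    then have "\<exists>n. n \<in> compositions N \<and> mN N i = lattice_point N n" using lattice_simplex_eq[OF that(1)] by blast
    then show ?thesis unfolding a_def by (rule someI_ex)
  qed
  have a: "a N i \<in> compositions N" if "1 \<le> N" "i \<in> ?I" for N i using a'[OF that] by simp
  have mN: "meta_set N (mN N i) = level N (a N i)" if "1 \<le> N" "i \<in> ?I" for N i
    using a'[OF that] meta_set_eq[OF that(1)] by simp
  have lim: "(\<lambda>N. lattice_point N (a N i)) \<longlonglongrightarrow> min_point \<beta> i" if i: "i \<in> ?I" for i
  proof (rule Lim_transform_eventually)
    show "(\<lambda>N. mN N i) \<longlonglongrightarrow> min_point \<beta> i"
      by (rule closest_points_converge[where mN=mN and i=i and \<beta>=\<beta>, OF min_point_bounds(1)[OF q b] argmin[OF _ i]])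
    show "\<forall>\<^sub>F N in sequentially. mN N i = lattice_point N (a N i)"
      using eventually_ge_at_top[of 1] by eventually_elim (use a' i in blast)
  qed
  obtain e where e: "0 < e" and ratio: "\<forall>\<^sub>F N in sequentially. \<forall>g. close_to_mean TYPE('q) e g N \<longrightarrow>
    metastable_ratio (metropolis \<beta> g N) (gibbs \<beta> g N) (configs N) ?I (\<lambda>i. level N (a N i)) \<le> exp (- k * real N)"
    by (rule metastable_ratio_bound[where a=a, OF q b k]) (use a lim in auto)
  let ?r = "\<lambda>N \<omega>. metastable_ratio (metropolis \<beta> (?g \<omega>) N) (gibbs \<beta> (?g \<omega>) N) (configs N) ?I (\<lambda>i. level N (a N i))"
  have wc: "\<forall>\<^sub>F N in sequentially. inj_on (a N) ?I \<and> configs N - (\<Union>i\<in>?I. level N (a N i)) \<noteq> {}"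
    by (rule wells_configuration[where a=a, OF q b]) (use lim in auto)
  from ratio wc eventually_ge_at_top[of 1]
  have "\<forall>\<^sub>F N in sequentially. 1 \<le> N \<and> inj_on (a N) ?I \<and> (\<forall>g. close_to_mean TYPE('q) e g N \<longrightarrow>
    metastable_ratio (metropolis \<beta> g N) (gibbs \<beta> g N) (configs N) ?I (\<lambda>i. level N (a N i)) \<le> exp (- k * real N))"
    by eventually_elim blast
  then obtain N0 where N0: "\<And>N. N0 \<le> N \<Longrightarrow> 1 \<le> N \<and> inj_on (a N) ?I \<and> (\<forall>g. close_to_mean TYPE('q) e g N \<longrightarrow>
    metastable_ratio (metropolis \<beta> g N) (gibbs \<beta> g N) (configs N) ?I (\<lambda>i. level N (a N i)) \<le> exp (- k * real N))"
    unfolding eventually_sequentially by blast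
  have decay: "(\<lambda>n. exp (- k * real n)) \<longlonglongrightarrow> 0"
  proof -
    have "((\<lambda>x. exp (- k * x)) \<longlongrightarrow> 0) at_top" using k(1) by real_asymp
    from filterlim_compose[OF this filterlim_real_sequentially] show ?thesis .
  qed
  have Om: "Omega_meta M J mN \<beta> k N = {\<omega>\<in>space M. ?r N \<omega> \<le> exp (- k * real N)}" if N: "N0 \<le> N" for N
  proof -
    have N1: "1 \<le> N" and inj: "inj_on (a N) ?I" using N0[OF N] by auto
    have "metastable_ratio (metropolis \<beta> (?g \<omega>) N) (gibbs \<beta> (?g \<omega>) N) (configs N) ?I (\<lambda>i. meta_set N (mN N i)) = ?r N \<omega>" for \<omega>
      unfolding metastable_ratio_def Let_def using mN[OF N1] by (simp cong: image_cong_simp)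
    moreover have "\<forall>i\<in>?I. meta_set N (mN N i) \<subseteq> configs N" by (auto simp: meta_set_def)
    moreover have "disjoint_family_on (\<lambda>i. meta_set N (mN N i)) ?I"
      unfolding disjoint_family_on_def
    proof (intro ballI impI)
      fix i j assume ij: "i \<in> ?I" "j \<in> ?I" "i \<noteq> j"
      then have "a N i \<noteq> a N j" using inj by (auto dest: inj_onD)
      then show "meta_set N (mN N i) \<inter> meta_set N (mN N j) = {}" using mN[OF N1] ij level_disjoint by metis
    qed
    ultimately show ?thesis unfolding Omega_meta_def metastable_at_def using decay by simp
  qed
  have rm: "?r N \<in> borel_measurable M" if N: "N0 \<le> N" for N
  proof (rule measurable_metastable_ratio[OF J _ \<beta>])
    show N1: "1 \<le> N" using N0[OF N] by blast
    fix i assume "i \<in> ?I"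
    then show "level N (a N i) \<noteq> {}" using level_nonempty[OF a[OF N1]] by force
  qed (auto simp: level_def)
  have Oms: "Omega_meta M J mN \<beta> k N \<in> sets M" if N: "N0 \<le> N" for N
    unfolding Om[OF N] using rm[OF N] by measurable
  have li: "liminf (Omega_meta M J mN \<beta> k) = (\<Union>n. \<Inter>m\<in>{max n N0..}. Omega_meta M J mN \<beta> k m)"
    unfolding liminf_SUP_INF
  proof (intro equalityI subsetI)
    fix \<omega> assume "\<omega> \<in> (\<Union>n. \<Inter>m\<in>{n..}. Omega_meta M J mN \<beta> k m)"
    then obtain n where n: "\<And>m. n \<le> m \<Longrightarrow> \<omega> \<in> Omega_meta M J mN \<beta> k m" by auto
    show "\<omega> \<in> (\<Union>n. \<Inter>m\<in>{max n N0..}. Omega_meta M J mN \<beta> k m)"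
      by (rule UN_I[of n]) (use n in auto)
  next
    fix \<omega> assume "\<omega> \<in> (\<Union>n. \<Inter>m\<in>{max n N0..}. Omega_meta M J mN \<beta> k m)"
    then show "\<omega> \<in> (\<Union>n. \<Inter>m\<in>{n..}. Omega_meta M J mN \<beta> k m)" by blast
  qed
  have lis: "liminf (Omega_meta M J mN \<beta> k) \<in> sets M"
  proof -
    have "(\<Inter>m\<in>{max n N0..}. Omega_meta M J mN \<beta> k m) \<in> sets M" for n
      by (rule sets.countable_INT') (use Oms in auto)
    then show ?thesis unfolding li by (intro sets.countable_UN) auto
  qed
  have close: "AE \<omega> in M. \<forall>\<^sub>F N in sequentially. close_to_mean TYPE('q) e (?g \<omega>) N"
  proof (rule AE_close_to_mean[OF ps ind _ assms(5,6,10) e])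
    fix i j :: nat assume "1 \<le> i" "i < j"
    then show "distr M borel (J i j) = distr M borel (J 1 2)" by (rule assms(4))
  qed
  have "AE \<omega> in M. \<omega> \<in> liminf (Omega_meta M J mN \<beta> k)"
    using close
  proof (rule AE_mp, intro AE_I2 impI)
    fix \<omega> assume \<omega>: "\<omega> \<in> space M" and ev: "\<forall>\<^sub>F N in sequentially. close_to_mean TYPE('q) e (?g \<omega>) N"
    then obtain N1 where N1: "\<And>N. N1 \<le> N \<Longrightarrow> close_to_mean TYPE('q) e (?g \<omega>) N" unfolding eventually_sequentially by blast
    have "\<omega> \<in> Omega_meta M J mN \<beta> k N" if "max N1 N0 \<le> N" for N
      using that N1[of N] N0[of N] Om[of N] \<omega> by auto
    then show "\<omega> \<in> liminf (Omega_meta M J mN \<beta> k)" unfolding li by blast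
  qed
  then show ?thesis using prob_eq_1[OF lis] by simp
qed

end
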